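(* Let $G$ be a connected bipartite graph on the vertex set $[n]=\{1,\dots,n\}$ which is not a path. Then the following are equivalent: (i) $L_G$ is an almost complete intersection ideal; (ii) $\mathcal{I}_G$ is an almost complete intersection ideal; (iii) $G$ is obtained either by adding an edge between two disjoint paths (that is, joining a vertex of one path to a vertex of the other), or by adding an edge between two vertices of a path such that the girth of $G$ is even.
   Context: All graphs are finite and simple. Let $\mathbb{K}$ be any field and $S=\mathbb{K}[x_1,\dots,x_n,y_1,\dots,y_n]$. For a graph $G$ on $[n]$, the Lovász-Saks-Schrijver (LSS) ideal is $L_G=(x_ix_j+y_iy_j : \{i,j\}\in E(G))\subset S$ and the parity binomial edge ideal is $\mathcal{I}_G=(x_ix_j-y_iy_j : \{i,j\}\in E(G))\subset S$. For a homogeneous ideal $I$, $\mu(I)$ is the cardinality of a minimal homogeneous generating set; $I$ is a complete intersection if $\mu(I)=\operatorname{ht}(I)$, and an almost complete intersection if $\mu(I)=\operatorname{ht}(I)+1$ and $I_{\mathfrak p}$ is a complete intersection (i.e. $\mu(I_{\mathfrak p})=\operatorname{ht}(I_{\mathfrak p})$) for every minimal prime $\mathfrak p$ of $I$. The girth of a graph is the length of a shortest cycle in it. A single vertex counts as a path. *)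

theory Defs
  imports
    "HOL-Algebra.Ideal"
    "HOL-Library.Poly_Mapping"
    "HOL-Library.Extended_Nat"
begin

section \<open>Height and localization\<close>

definition prime_height :: "('a, 'b) ring_scheme \<Rightarrow> 'a set \<Rightarrow> enat" where
  "prime_height R P =
     Sup {enat k | k. \<exists>C :: nat \<Rightarrow> 'a set.
            (\<forall>i\<le>k. primeideal (C i) R) \<and> (\<forall>i<k. C i \<subset> C (Suc i)) \<and> C k = P}"

definition height :: "('a, 'b) ring_scheme \<Rightarrow> 'a set \<Rightarrow> enat" where
  "height R I = Inf {prime_height R P | P. primeideal P R \<and> I \<subseteq> P}"

definition minimal_primes :: "('a, 'b) ring_scheme \<Rightarrow> 'a set \<Rightarrow> 'a set set" where
  "minimal_primes R I =
     {P. primeideal P R \<and> I \<subseteq> P \<and> \<not> (\<exists>Q. primeideal Q R \<and> I \<subseteq> Q \<and> Q \<subset> P)}"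

text \<open>A fraction is an equivalence class of pairs (numerator, denominator). The ring operations on
  classes are taken over all representatives, as usual for functions that respect a relation.\<close>

definition frac_rel :: "('a, 'b) ring_scheme \<Rightarrow> 'a set \<Rightarrow> (('a \<times> 'a) \<times> ('a \<times> 'a)) set" where
  "frac_rel R M =
     {((a, s), (b, t)) | a s b t. a \<in> carrier R \<and> b \<in> carrier R \<and> s \<in> M \<and> t \<in> M \<and>
        (\<exists>u\<in>M. u \<otimes>\<^bsub>R\<^esub> (a \<otimes>\<^bsub>R\<^esub> t \<ominus>\<^bsub>R\<^esub> b \<otimes>\<^bsub>R\<^esub> s) = \<zero>\<^bsub>R\<^esub>)}"

definition frac :: "('a, 'b) ring_scheme \<Rightarrow> 'a set \<Rightarrow> 'a \<Rightarrow> 'a \<Rightarrow> ('a \<times> 'a) set" where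
  "frac R M a s = frac_rel R M `` {(a, s)}"

definition fraction_ring :: "('a, 'b) ring_scheme \<Rightarrow> 'a set \<Rightarrow> ('a \<times> 'a) set ring" where
  "fraction_ring R M =
     \<lparr>carrier = {frac R M a s | a s. a \<in> carrier R \<and> s \<in> M},
      mult = (\<lambda>x y. \<Union>(a, s)\<in>x. \<Union>(b, t)\<in>y. frac R M (a \<otimes>\<^bsub>R\<^esub> b) (s \<otimes>\<^bsub>R\<^esub> t)),
      one = frac R M \<one>\<^bsub>R\<^esub> \<one>\<^bsub>R\<^esub>,
      zero = frac R M \<zero>\<^bsub>R\<^esub> \<one>\<^bsub>R\<^esub>,
      add = (\<lambda>x y. \<Union>(a, s)\<in>x. \<Union>(b, t)\<in>y.
               frac R M (a \<otimes>\<^bsub>R\<^esub> t \<oplus>\<^bsub>R\<^esub> b \<otimes>\<^bsub>R\<^esub> s) (s \<otimes>\<^bsub>R\<^esub> t))\<rparr>"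

definition localization :: "('a, 'b) ring_scheme \<Rightarrow> 'a set \<Rightarrow> ('a \<times> 'a) set ring" where
  "localization R P = fraction_ring R (carrier R - P)"

definition localized_ideal :: "('a, 'b) ring_scheme \<Rightarrow> 'a set \<Rightarrow> 'a set \<Rightarrow> ('a \<times> 'a) set set" where
  "localized_ideal R P I = {frac R (carrier R - P) a s | a s. a \<in> I \<and> s \<in> carrier R - P}"

definition min_gens :: "('a, 'b) ring_scheme \<Rightarrow> 'a set \<Rightarrow> nat" where
  "min_gens R I = (LEAST k. \<exists>A. finite A \<and> A \<subseteq> carrier R \<and> card A = k \<and> Idl\<^bsub>R\<^esub> A = I)"


section \<open>The polynomial ring and homogeneous ideals\<close>

datatype lss_var = VX nat | VY nat

fun var_index :: "lss_var \<Rightarrow> nat" where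
  "var_index (VX i) = i"
| "var_index (VY i) = i"

type_synonym 'k lss_poly = "(lss_var \<Rightarrow>\<^sub>0 nat) \<Rightarrow>\<^sub>0 'k"

text \<open>The ambient type has the variables \<open>x\<^sub>i, y\<^sub>i\<close> for all natural \<open>i\<close>; the ring
  \<open>S = K[x\<^sub>1, \<dots>, x\<^sub>n, y\<^sub>1, \<dots>, y\<^sub>n]\<close> is cut out by its carrier.\<close>

definition poly_S :: "nat \<Rightarrow> 'k::field lss_poly ring" where
  "poly_S n =
     \<lparr>carrier = {p. \<forall>m\<in>Poly_Mapping.keys p. \<forall>v\<in>Poly_Mapping.keys m. var_index v \<in> {1..n}},
      mult = (*), one = 1, zero = 0, add = (+)\<rparr>"

definition var_poly :: "lss_var \<Rightarrow> 'k::field lss_poly" where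
  "var_poly v = Poly_Mapping.single (Poly_Mapping.single v 1) 1"

abbreviation xvar :: "nat \<Rightarrow> 'k::field lss_poly" where "xvar i \<equiv> var_poly (VX i)"
abbreviation yvar :: "nat \<Rightarrow> 'k::field lss_poly" where "yvar i \<equiv> var_poly (VY i)"

definition monom_degree :: "(lss_var \<Rightarrow>\<^sub>0 nat) \<Rightarrow> nat" where
  "monom_degree m = (\<Sum>v\<in>Poly_Mapping.keys m. Poly_Mapping.lookup m v)"

definition homogeneous :: "'k::field lss_poly \<Rightarrow> bool" where
  "homogeneous p \<longleftrightarrow> (\<exists>d. \<forall>m\<in>Poly_Mapping.keys p. monom_degree m = d)"

definition hom_generating_set :: "nat \<Rightarrow> 'k::field lss_poly set \<Rightarrow> 'k lss_poly set \<Rightarrow> bool" where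
  "hom_generating_set n A I \<longleftrightarrow>
     A \<subseteq> carrier (poly_S n) \<and> (\<forall>p\<in>A. homogeneous p) \<and> Idl\<^bsub>poly_S n\<^esub> A = I"

definition min_hom_generating_set :: "nat \<Rightarrow> 'k::field lss_poly set \<Rightarrow> 'k lss_poly set \<Rightarrow> bool" where
  "min_hom_generating_set n A I \<longleftrightarrow>
     hom_generating_set n A I \<and> \<not> (\<exists>B. B \<subset> A \<and> hom_generating_set n B I)"

text \<open>All minimal homogeneous generating sets of a homogeneous ideal have the same cardinality, by
  the graded version of Nakayama's lemma.\<close>

definition mu :: "nat \<Rightarrow> 'k::field lss_poly set \<Rightarrow> nat" where
  "mu n I = (THE k. \<exists>A. min_hom_generating_set n A I \<and> finite A \<and> card A = k)"

definition almost_complete_intersection :: "nat \<Rightarrow> 'k::field lss_poly set \<Rightarrow> bool" where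
  "almost_complete_intersection n I \<longleftrightarrow>
     enat (mu n I) = height (poly_S n) I + 1 \<and>
     (\<forall>P\<in>minimal_primes (poly_S n) I.
        enat (min_gens (localization (poly_S n) P) (localized_ideal (poly_S n) P I)) =
        height (localization (poly_S n) P) (localized_ideal (poly_S n) P I))"


section \<open>Graphs and their ideals\<close>

definition simple_graph :: "'a set \<Rightarrow> 'a set set \<Rightarrow> bool" where
  "simple_graph V E \<longleftrightarrow> finite V \<and> E \<subseteq> {{u, v} | u v. u \<in> V \<and> v \<in> V \<and> u \<noteq> v}"

definition connected_graph :: "'a set \<Rightarrow> 'a set set \<Rightarrow> bool" where
  "connected_graph V E \<longleftrightarrow> V \<noteq> {} \<and> (\<forall>u\<in>V. \<forall>v\<in>V. (u, v) \<in> {(a, b). {a, b} \<in> E}\<^sup>*)"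

definition bipartite_graph :: "'a set \<Rightarrow> 'a set set \<Rightarrow> bool" where
  "bipartite_graph V E \<longleftrightarrow>
     (\<exists>A B. A \<union> B = V \<and> A \<inter> B = {} \<and> (\<forall>e\<in>E. \<exists>a\<in>A. \<exists>b\<in>B. e = {a, b}))"

definition path_edges :: "'a list \<Rightarrow> 'a set set" where
  "path_edges vs = {{vs ! i, vs ! Suc i} | i. Suc i < length vs}"

definition path_graph :: "'a set \<Rightarrow> 'a set set \<Rightarrow> bool" where
  "path_graph V E \<longleftrightarrow> (\<exists>vs. vs \<noteq> [] \<and> distinct vs \<and> set vs = V \<and> E = path_edges vs)"

definition is_cycle :: "'a set set \<Rightarrow> 'a list \<Rightarrow> bool" where
  "is_cycle E vs \<longleftrightarrow>
     length vs \<ge> 3 \<and> distinct vs \<and> path_edges vs \<subseteq> E \<and> {last vs, hd vs} \<in> E"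

text \<open>The girth of an acyclic graph is infinite.\<close>

definition girth :: "'a set set \<Rightarrow> enat" where
  "girth E = Inf {enat (length vs) | vs. is_cycle E vs}"

definition edge_between_paths :: "'a set \<Rightarrow> 'a set set \<Rightarrow> bool" where
  "edge_between_paths V E \<longleftrightarrow>
     (\<exists>V1 E1 V2 E2 u v. path_graph V1 E1 \<and> path_graph V2 E2 \<and> V1 \<inter> V2 = {} \<and> V = V1 \<union> V2 \<and>
        u \<in> V1 \<and> v \<in> V2 \<and> E = insert {u, v} (E1 \<union> E2))"

definition edge_within_path :: "'a set \<Rightarrow> 'a set set \<Rightarrow> bool" where
  "edge_within_path V E \<longleftrightarrow>
     (\<exists>E' u v. path_graph V E' \<and> u \<in> V \<and> v \<in> V \<and> u \<noteq> v \<and> {u, v} \<notin> E' \<and> E = insert {u, v} E')"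

definition LSS_ideal :: "nat \<Rightarrow> nat set set \<Rightarrow> 'k::field lss_poly set" where
  "LSS_ideal n E =
     Idl\<^bsub>poly_S n\<^esub> {xvar i * xvar j + yvar i * yvar j | i j. {i, j} \<in> E}"

definition parity_binomial_edge_ideal :: "nat \<Rightarrow> nat set set \<Rightarrow> 'k::field lss_poly set" where
  "parity_binomial_edge_ideal n E =
     Idl\<^bsub>poly_S n\<^esub> {xvar i * xvar j - yvar i * yvar j | i j. {i, j} \<in> E}"

end

(*
  For a bipartite graph the edge generators x_i x_j + e y_i y_j (e = 1 or e = -1) become, after the
  change of variables (x_j, y_j) -> (-e y_j, x_j) on one side of the bipartition, the 2-minors
  p_i q_j - p_j q_i that generate the binomial edge ideal; both ideals are treated at once.

  Every prime over the edge ideal contains the kernel of a monomial substitution given by a set T of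
  deleted vertices and a partition of the other vertices, with no edge between different classes,
  into c classes; the kernel has height n + |T| - c. The lower bound comes from an explicit chain of
  such kernels, the upper bound from counting: in a chain of length k below a prime over which u
  variables are independent, at least (d + 1)^(u + k) polynomials with exponents at most A d are
  independent modulo the smallest prime, while the whole space of these polynomials has dimension
  (A d + 1)^(2 n). So the height of the edge ideal is the minimum of n + |T| - c.

  The local condition always holds: a minimal prime is one of the kernels, the h = n + |T| - c
  obvious elements of the kernel generate the edge ideal locally, and a diagonal Jacobian shows that
  fewer generators do not suffice. Hence the ideal is an almost complete intersection iff
  |E| = min (n + |T| - c) + 1. Taking T = {}, {x}, {x, y} shows that G then has at most n edges, that
  its degrees are at most 3, and that vertices of degree 3 are pairwise adjacent; deleting one edge
  leaves degrees at most 2, so that G is covered by one or two paths.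
*)

theory Submission
  imports "HOL-Computational_Algebra.Polynomial" Defs
begin

section \<open>Separations and path covers\<close>

text \<open>Minimizing over all partitions without edges between distinct classes makes it
  unnecessary to speak of components: merging classes only raises n + |T| - c. Height is defined by
  chains, so a lower bound needs one chain, while an upper bound must exclude all longer chains,
  also those whose members are not kernels. Counting achieves this: an element of one prime outside
  the next smaller one behaves, modulo the smaller one, like a further independent variable, and
  growth of degree u + k in d cannot stay below growth of degree 2 n unless u + k \<le> 2 n. A
  kernel describes columns (p_i, q_i) that are proportional within each class: one entry of a column
  is kept, the other is the kept one times a slope common to the class. The kept entry must become
  invertible at the given prime, so the row that is kept is chosen class by class. The number of
  local generators is a rank of differentials, computed at the generic point of the kernel. Beyond
  the change of variables, bipartiteness excludes triangles, so that at most two vertices have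
  degree 3, and makes every cycle even.\<close>

definition separation :: "'a set \<Rightarrow> 'a set set \<Rightarrow> 'a set \<Rightarrow> ('a \<Rightarrow> 'b) \<Rightarrow> bool" where
  "separation V E T c \<longleftrightarrow> T \<subseteq> V \<and> (\<forall>i j. {i, j} \<in> E \<longrightarrow> i \<in> V - T \<longrightarrow> j \<in> V - T \<longrightarrow> c i = c j)"

lemma path_edges_Nil [simp]: "path_edges [] = {}"
  and path_edges_single [simp]: "path_edges [x] = {}"
  by (auto simp: path_edges_def)

lemma path_edges_Cons [simp]: "path_edges (x # y # xs) = insert {x, y} (path_edges (y # xs))"
proof -
  have *: "path_edges vs = (\<lambda>i. {vs ! i, vs ! Suc i}) ` {i. Suc i < length vs}" for vs :: "'a list"
    unfolding path_edges_def by (rule setcompr_eq_image)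
  have "{i. Suc i < length (x # y # xs)} = insert 0 (Suc ` {i. Suc i < length (y # xs)})"
  proof (rule Set.set_eqI)
    show "i \<in> {i. Suc i < length (x # y # xs)} \<longleftrightarrow> i \<in> insert 0 (Suc ` {i. Suc i < length (y # xs)})" for i
      by (cases i) auto
  qed
  then show ?thesis by (simp add: * image_image)
qed

lemma path_edges_subset_Pow: "path_edges vs \<subseteq> Pow (set vs)"
  by (auto simp: path_edges_def)

lemma finite_path_edges [simp]: "finite (path_edges vs)"
  by (rule finite_subset[OF path_edges_subset_Pow]) simp

lemma card_path_edges: "distinct vs \<Longrightarrow> vs \<noteq> [] \<Longrightarrow> Suc (card (path_edges vs)) = length vs"
proof (induction vs rule: induct_list012)
  case (3 x y xs)
  have "{x, y} \<notin> path_edges (y # xs)"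
    using path_edges_subset_Pow[of "y # xs"] 3 by auto
  then show ?case using 3 by auto
qed auto

lemma path_edges_append:
  "xs \<noteq> [] \<Longrightarrow> ys \<noteq> [] \<Longrightarrow>
    path_edges (xs @ ys) = insert {last xs, hd ys} (path_edges xs \<union> path_edges ys)"
proof (induction xs rule: induct_list012)
  case (2 x)
  then show ?case by (cases ys) auto
next
  case (3 x y zs)
  then have "path_edges ((y # zs) @ ys) = insert {last (y # zs), hd ys} (path_edges (y # zs) \<union> path_edges ys)"
    by blast
  moreover have "last (x # y # zs) = last (y # zs)" by simp
  moreover have "path_edges ((x # y # zs) @ ys) = insert {x, y} (path_edges ((y # zs) @ ys))"
    by simp
  ultimately show ?case
    unfolding path_edges_Cons by (metis Un_insert_left insert_commute)
qed auto

lemma path_edges_rev [simp]: "path_edges (rev vs) = path_edges vs"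
proof (induction vs rule: induct_list012)
  case (3 x y zs)
  have "path_edges (rev (x # y # zs)) = insert {y, x} (path_edges (rev (y # zs)))"
    using path_edges_append[of "rev (y # zs)" "[x]"] by simp
  then show ?case using 3 by (simp add: insert_commute[of y x])
qed auto

text \<open>Deleting \<open>k\<close> vertices cuts a path into at most \<open>k + 1\<close> pieces.
  The induction along the list needs the sharper count for a deleted head: no piece lies before it,
  so one piece is saved.\<close>

lemma path_separation_bound:
  assumes "\<And>i j. {i, j} \<in> path_edges vs \<Longrightarrow> i \<notin> T \<Longrightarrow> j \<notin> T \<Longrightarrow> c i = c j" "distinct vs" "vs \<noteq> []"
  shows "card (c ` (set vs - T)) \<le> card (set vs \<inter> T) + (if hd vs \<in> T then 0 else 1)"
  using assms
proof (induction vs rule: induct_list012)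
  case (2 x)
  then show ?case by (auto simp: insert_Diff_if)
next
  case (3 x y zs)
  let ?ys = "y # zs"
  have IH: "card (c ` (set ?ys - T)) \<le> card (set ?ys \<inter> T) + (if y \<in> T then 0 else 1)"
    using "3.IH"(2) "3.prems" by force
  show ?case
  proof (cases "x \<in> T")
    case True
    have "set (x # ?ys) - T = set ?ys - T" using True by auto
    moreover have "set (x # ?ys) \<inter> T = insert x (set ?ys \<inter> T)" using True by auto
    moreover have "x \<notin> set ?ys \<inter> T" using "3.prems" by auto
    ultimately show ?thesis using IH True by (simp add: card_insert_disjoint split: if_splits)
  next
    case False
    have e1: "c ` (set (x # ?ys) - T) = insert (c x) (c ` (set ?ys - T))" using False by auto
    have e2: "set (x # ?ys) \<inter> T = set ?ys \<inter> T" using False by auto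
    show ?thesis
    proof (cases "y \<in> T")
      case True
      have "card (insert (c x) (c ` (set ?ys - T))) \<le> Suc (card (c ` (set ?ys - T)))"
        by (rule card_insert_le_m1) auto
      then show ?thesis using IH False True unfolding e1 e2 by simp
    next
      case yF: False
      have "c x = c y" by (rule "3.prems"(1)) (use False yF in auto)
      then have "insert (c x) (c ` (set ?ys - T)) = c ` (set ?ys - T)"
        using yF by auto
      then show ?thesis using IH False e1 e2 yF by simp
    qed
  qed
qed auto

text \<open>Start with every vertex in a class of its own and insert the edges one by one; an edge
  merges at most two classes.\<close>

lemma exists_many_classes:
  assumes "finite V" "finite E"
  shows "\<exists>c :: 'a \<Rightarrow> 'a. (\<forall>i j. {i, j} \<in> E \<longrightarrow> c i = c j) \<and> card V \<le> card (c ` V) + card E"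
  using assms(2)
proof (induction E)
  case empty
  show ?case by (rule exI[of _ id]) auto
next
  case (insert e E)
  then obtain c :: "'a \<Rightarrow> 'a" where c: "\<forall>i j. {i, j} \<in> E \<longrightarrow> c i = c j" "card V \<le> card (c ` V) + card E"
    by auto
  show ?case
  proof (cases "\<exists>a b. e = {a, b}")
    case False
    then show ?thesis using c insert by (intro exI[of _ c]) auto
  next
    case True
    then obtain a b where e: "e = {a, b}" by auto
    \<comment> \<open>The whole class of \<open>a\<close> takes the label of \<open>b\<close>, so at
      most the label \<open>c a\<close> is lost.\<close>
    define d where "d = (\<lambda>x. if c x = c a then c b else c x)"
    have "c ` V \<subseteq> insert (c a) (d ` V)" by (auto simp: d_def)
    then have "card (c ` V) \<le> card (insert (c a) (d ` V))"
      using assms(1) by (intro card_mono) auto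
    also have "\<dots> \<le> Suc (card (d ` V))" by (rule card_insert_le_m1) auto
    finally have "card (c ` V) \<le> Suc (card (d ` V))" .
    moreover have "\<forall>i j. {i, j} \<in> insert e E \<longrightarrow> d i = d j"
      using c(1) by (auto simp: d_def e doubleton_eq_iff)
    ultimately show ?thesis using c(2) insert by (intro exI[of _ d]) auto
  qed
qed

text \<open>Only edges that survive the deletion of \<open>T\<close> cost classes, at most one each.
  An upper bound on the number of classes thus becomes an upper bound on the number of edges meeting
  \<open>T\<close>, that is, on degrees.\<close>

lemma separation_exists:
  assumes "simple_graph V E" "T \<subseteq> V"
  shows "\<exists>c :: 'a \<Rightarrow> 'a. separation V E T c \<and>
    card V + card {e \<in> E. e \<inter> T \<noteq> {}} \<le> card (c ` (V - T)) + card T + card E"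
proof -
  have finV: "finite V" using assms(1) by (simp add: simple_graph_def)
  have "E \<subseteq> Pow V" using assms(1) by (auto simp: simple_graph_def)
  then have finE: "finite E" using finV by (meson finite_Pow_iff finite_subset)
  let ?F = "{e \<in> E. e \<inter> T = {}}"
  have "finite (V - T)" "finite ?F" using finV finE by auto
  from exists_many_classes[OF this]
  obtain c :: "'a \<Rightarrow> 'a" where c: "\<forall>i j. {i, j} \<in> ?F \<longrightarrow> c i = c j" "card (V - T) \<le> card (c ` (V - T)) + card ?F"
    by blast
  have "card E = card (?F \<union> {e \<in> E. e \<inter> T \<noteq> {}})" by (rule arg_cong[of _ _ card]) auto
  also have "\<dots> = card ?F + card {e \<in> E. e \<inter> T \<noteq> {}}" using finE by (intro card_Un_disjoint) auto
  finally have "card E = card ?F + card {e \<in> E. e \<inter> T \<noteq> {}}" .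
  moreover have "card (V - T) = card V - card T" "card T \<le> card V"
    using assms finV by (auto simp: card_Diff_subset finite_subset card_mono)
  moreover have "separation V E T c"
    unfolding separation_def
  proof (intro conjI allI impI assms(2))
    fix i j assume "{i, j} \<in> E" "i \<in> V - T" "j \<in> V - T"
    then show "c i = c j" using c(1)[rule_format, of i j] by simp
  qed
  ultimately show ?thesis using c(2) by (intro exI[of _ c]) simp
qed


section \<open>Degrees and Hamiltonian paths\<close>

definition nbhd :: "'a set set \<Rightarrow> 'a \<Rightarrow> 'a set" where
  "nbhd E v = {w. {v, w} \<in> E}"

lemma simple_graphD:
  assumes "simple_graph V E"
  shows "finite V" "finite E" "\<And>e. e \<in> E \<Longrightarrow> \<exists>a b. e = {a, b} \<and> a \<in> V \<and> b \<in> V \<and> a \<noteq> b"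
    "\<And>a b. {a, b} \<in> E \<Longrightarrow> a \<in> V \<and> b \<in> V \<and> a \<noteq> b" "\<And>v. nbhd E v \<subseteq> V" "\<And>v. finite (nbhd E v)"
proof -
  show V: "finite V" using assms by (simp add: simple_graph_def)
  show e: "\<And>e. e \<in> E \<Longrightarrow> \<exists>a b. e = {a, b} \<and> a \<in> V \<and> b \<in> V \<and> a \<noteq> b"
    using assms unfolding simple_graph_def by blast
  then have "E \<subseteq> Pow V" by fastforce
  then show "finite E" using V by (meson finite_Pow_iff finite_subset)
  show ab: "\<And>a b. {a, b} \<in> E \<Longrightarrow> a \<in> V \<and> b \<in> V \<and> a \<noteq> b"
  proof -
    fix a b assume "{a, b} \<in> E"
    from e[OF this] show "a \<in> V \<and> b \<in> V \<and> a \<noteq> b" by (auto simp: doubleton_eq_iff)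
  qed
  then show "\<And>v. nbhd E v \<subseteq> V" by (auto simp: nbhd_def)
  then show "\<And>v. finite (nbhd E v)" using V finite_subset by blast
qed

lemma card_edges_at:
  assumes "simple_graph V E"
  shows "card {e \<in> E. e \<inter> {v} \<noteq> {}} = card (nbhd E v)"
proof -
  have "{e \<in> E. e \<inter> {v} \<noteq> {}} = (\<lambda>w. {v, w}) ` nbhd E v"
  proof (intro equalityI subsetI)
    fix e assume e: "e \<in> {e \<in> E. e \<inter> {v} \<noteq> {}}"
    then obtain a b where "e = {a, b}" using simple_graphD(3)[OF assms, of e] by blast
    with e have "e = {v, a} \<and> {v, a} \<in> E \<or> e = {v, b} \<and> {v, b} \<in> E"
      by (auto simp: insert_commute)
    then show "e \<in> (\<lambda>w. {v, w}) ` nbhd E v" by (auto simp: nbhd_def)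
  qed (auto simp: nbhd_def)
  moreover have "inj_on (\<lambda>w. {v, w}) (nbhd E v)"
    by (auto simp: inj_on_def doubleton_eq_iff)
  ultimately show ?thesis by (simp add: card_image)
qed

lemma connected_boundary_edge:
  assumes "connected_graph V E" "W \<subseteq> V" "W \<noteq> {}" "W \<noteq> V"
  obtains x y where "x \<in> W" "y \<notin> W" "{x, y} \<in> E"
proof -
  obtain a b where ab: "a \<in> W" "b \<in> V" "b \<notin> W" using assms by blast
  then have "(a, b) \<in> {(a, b). {a, b} \<in> E}\<^sup>*" using assms by (auto simp: connected_graph_def)
  then have "b \<in> W \<or> (\<exists>x y. x \<in> W \<and> y \<notin> W \<and> {x, y} \<in> E)"
  proof (induction rule: rtrancl_induct)
    case base
    then show ?case using ab by simp
  next
    case (step y z)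
    then show ?case by auto
  qed
  then show ?thesis using ab that by blast
qed

lemma card_ge_3:
  assumes "finite S" "{a, b, c} \<subseteq> S" "a \<noteq> b" "a \<noteq> c" "b \<noteq> c"
  shows "3 \<le> card S"
proof -
  have "card {a, b, c} = 3" using assms by simp
  then show ?thesis using assms card_mono by metis
qed

lemma path_edges_nth: "Suc i < length vs \<Longrightarrow> {vs ! i, vs ! Suc i} \<in> path_edges vs"
  by (auto simp: path_edges_def)

text \<open>A longest path works. Its interior vertices have their two neighbours on it and its ends
  cannot be extended, so by connectedness no vertex is missed, and the only further edge possible
  joins the two ends.\<close>

lemma hamiltonian_path:
  assumes sg: "simple_graph V E" and con: "connected_graph V E" and deg: "\<forall>v\<in>V. card (nbhd E v) \<le> 2"
  obtains vs where "vs \<noteq> []" "distinct vs" "set vs = V" "path_edges vs \<subseteq> E"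
    "E \<subseteq> insert {last vs, hd vs} (path_edges vs)"
proof -
  note D = simple_graphD[OF sg]
  define P where "P vs \<longleftrightarrow> vs \<noteq> [] \<and> distinct vs \<and> set vs \<subseteq> V \<and> path_edges vs \<subseteq> E" for vs
  obtain v0 where "v0 \<in> V" using con by (auto simp: connected_graph_def)
  then have "P [v0]" by (simp add: P_def)
  moreover have "length vs < Suc (card V)" if "P vs" for vs
    using that D(1) by (metis P_def card_mono distinct_card le_imp_less_Suc)
  ultimately obtain vs where vs: "P vs" and max: "\<And>ws. P ws \<Longrightarrow> length ws \<le> length vs"
    using ex_has_greatest_nat[of P "[v0]" length "Suc (card V)"] by auto
  let ?l = "length vs"
  have dist: "distinct vs" and ne: "vs \<noteq> []" and pe: "path_edges vs \<subseteq> E" and sub: "set vs \<subseteq> V"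
    using vs by (auto simp: P_def)
  have nx: "{vs ! i, vs ! Suc i} \<in> E" if "Suc i < ?l" for i
    using path_edges_nth[OF that] pe by blast
  \<comment> \<open>Stated for every path of maximal length, so that it can be applied to
    \<open>rev vs\<close> and rules out extensions at the last vertex too.\<close>
  have hd_ext: False if "P ws" "length ws = ?l" "y \<in> V" "y \<notin> set ws" "{hd ws, y} \<in> E" for ws y
  proof -
    have "path_edges (y # ws) \<subseteq> E"
      using that by (cases ws) (auto simp: P_def insert_commute)
    then have "P (y # ws)" using that by (auto simp: P_def)
    from max[OF this] that show False by simp
  qed
  have interior: False
    if "0 < i" "Suc i < ?l" "{vs ! i, y} \<in> E" "y \<noteq> vs ! (i - 1)" "y \<noteq> vs ! Suc i" for i y
  proof -
    have "{vs ! (i - 1), vs ! i} \<in> E" using nx[of "i - 1"] that by simp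
    then have "{vs ! (i - 1), vs ! Suc i, y} \<subseteq> nbhd E (vs ! i)"
      using nx[of i] that by (auto simp: nbhd_def insert_commute)
    moreover have "vs ! (i - 1) \<noteq> vs ! Suc i" using dist that by (simp add: nth_eq_iff_index_eq)
    ultimately have "3 \<le> card (nbhd E (vs ! i))"
      using that card_ge_3[OF D(6), of "vs ! (i - 1)" "vs ! Suc i" y "vs ! i"] by simp
    moreover have "vs ! i \<in> V" using sub that by auto
    ultimately show False using deg by fastforce
  qed
  have all: "set vs = V"
  proof (rule ccontr)
    assume "set vs \<noteq> V"
    then obtain x y where xy: "x \<in> set vs" "y \<notin> set vs" "{x, y} \<in> E"
      using connected_boundary_edge[OF con sub] ne by auto
    then have yV: "y \<in> V" using D(4) by blast
    obtain i where i: "i < ?l" "x = vs ! i" using xy by (auto simp: in_set_conv_nth)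
    have "i \<noteq> 0" using hd_ext[OF vs refl yV xy(2)] xy i ne by (metis hd_conv_nth)
    moreover have "i \<noteq> ?l - 1"
    proof
      assume "i = ?l - 1"
      then have "hd (rev vs) = x" using ne i by (simp add: hd_rev last_conv_nth)
      moreover have "P (rev vs)" using vs by (simp add: P_def)
      ultimately show False using hd_ext[of "rev vs" y] yV xy by simp
    qed
    moreover have "y \<noteq> vs ! (i - 1)" using xy i by auto
    moreover have "y \<noteq> vs ! Suc i" if "Suc i < ?l" using xy that by auto
    moreover from \<open>i \<noteq> ?l - 1\<close> i have "Suc i < ?l" by linarith
    ultimately show False using interior[of i y] xy i by simp
  qed
  have key: "{vs ! i, vs ! j} \<in> insert {last vs, hd vs} (path_edges vs)"
    if "i < j" "j < ?l" "{vs ! i, vs ! j} \<in> E" for i j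
  proof (cases "j = Suc i")
    case True
    then show ?thesis using that path_edges_nth[of i vs] by auto
  next
    case False
    have "i = 0"
    proof (rule ccontr)
      assume "i \<noteq> 0"
      then have "vs ! j \<noteq> vs ! (i - 1)" "vs ! j \<noteq> vs ! Suc i"
        using that False dist by (simp_all add: nth_eq_iff_index_eq)
      then show False using interior[of i "vs ! j"] that \<open>i \<noteq> 0\<close> by simp
    qed
    moreover have "j = ?l - 1"
    proof (rule ccontr)
      assume "j \<noteq> ?l - 1"
      then have j: "Suc j < ?l" using that by linarith
      then have "vs ! i \<noteq> vs ! (j - 1)" "vs ! i \<noteq> vs ! Suc j"
        using that False dist by (simp_all add: nth_eq_iff_index_eq)
      moreover have "{vs ! j, vs ! i} \<in> E" using that by (simp add: insert_commute)
      ultimately show False using interior[of j "vs ! i"] that j by simp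
    qed
    ultimately show ?thesis using ne by (simp add: hd_conv_nth last_conv_nth insert_commute)
  qed
  have "E \<subseteq> insert {last vs, hd vs} (path_edges vs)"
  proof
    fix e assume e: "e \<in> E"
    then obtain a b where ab: "e = {a, b}" "a \<in> V" "b \<in> V" "a \<noteq> b" using D(3) by blast
    then obtain i j where ij: "i < ?l" "j < ?l" "a = vs ! i" "b = vs ! j"
      using all by (metis in_set_conv_nth)
    then have "i < j \<or> j < i" using ab by (metis linorder_neqE_nat)
    then show "e \<in> insert {last vs, hd vs} (path_edges vs)"
      using key[of i j] key[of j i] ab ij e by (auto simp: insert_commute)
  qed
  then show ?thesis using that ne dist all pe by blast
qed

text \<open>A cycle can be cut open at \<open>u\<close>, and a path may already end in
  \<open>u\<close>. In the remaining case \<open>u\<close> is interior and the graph has no edge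
  beyond the path; this equality is what later turns \<open>u\<close> into the centre of a
  separation with three classes.\<close>

lemma hamiltonian_path_from:
  assumes "simple_graph V E" "connected_graph V E" "\<forall>v\<in>V. card (nbhd E v) \<le> 2" "u \<in> V"
  shows "(\<exists>vs. distinct (u # vs) \<and> set (u # vs) = V \<and> path_edges (u # vs) \<subseteq> E) \<or>
    (\<exists>xs ys. xs \<noteq> [] \<and> ys \<noteq> [] \<and> distinct (xs @ u # ys) \<and> set (xs @ u # ys) = V \<and> E = path_edges (xs @ u # ys))"
proof -
  obtain vs where vs: "vs \<noteq> []" "distinct vs" "set vs = V" "path_edges vs \<subseteq> E"
    "E \<subseteq> insert {last vs, hd vs} (path_edges vs)"
    using hamiltonian_path[OF assms(1-3)] by metis
  obtain xs ys where xy: "vs = xs @ u # ys" using assms(4) vs(3) by (metis split_list)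
  show ?thesis
  proof (cases "{last vs, hd vs} \<in> path_edges vs \<or> {last vs, hd vs} \<notin> E")
    case True
    then have E: "E = path_edges vs" using vs by blast
    show ?thesis
    proof (cases "xs = [] \<or> ys = []")
      case True
      then have "vs = u # ys \<or> rev vs = u # rev xs" by (auto simp: xy)
      then show ?thesis using vs E by (metis distinct_rev path_edges_rev set_rev subset_refl)
    next
      case False
      then show ?thesis using vs E xy by blast
    qed
  next
    case False
    show ?thesis
    proof (cases "xs = []")
      case True
      then show ?thesis using vs xy by (metis append_Nil)
    next
      case xs: False
      have "path_edges (u # ys @ xs) = insert {last (u # ys), hd xs} (path_edges (u # ys) \<union> path_edges xs)"
        using path_edges_append[of "u # ys" xs] xs by simp
      moreover have "path_edges vs = insert {last xs, u} (path_edges xs \<union> path_edges (u # ys))"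
        using path_edges_append[of xs "u # ys"] xs by (simp add: xy)
      moreover have "last vs = last (u # ys)" "hd vs = hd xs" using xs by (simp_all add: xy)
      ultimately have "path_edges (u # ys @ xs) \<subseteq> E" using False vs(4) by auto
      moreover have "distinct (u # ys @ xs)" "set (u # ys @ xs) = V" using vs(2,3) by (auto simp: xy)
      ultimately show ?thesis by blast
    qed
  qed
qed


section \<open>Deleting an edge of a sparse graph\<close>

lemma connected_components_of_bridge:
  assumes sg: "simple_graph V E" and con: "connected_graph V E" and uv: "{u, v} \<in> E"
    and ncon: "\<not> connected_graph V (E - {{u, v}})"
  obtains V1 V2 where "u \<in> V1" "v \<in> V2" "V1 \<inter> V2 = {}" "V = V1 \<union> V2"
    "connected_graph V1 {e \<in> E - {{u, v}}. e \<subseteq> V1}" "connected_graph V2 {e \<in> E - {{u, v}}. e \<subseteq> V2}"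
    "E - {{u, v}} = {e \<in> E - {{u, v}}. e \<subseteq> V1} \<union> {e \<in> E - {{u, v}}. e \<subseteq> V2}"
proof -
  note D = simple_graphD[OF sg]
  define E' where "E' = E - {{u, v}}"
  define R where "R = {(a, b). {a, b} \<in> E'}"
  define C where "C w = {x. (w, x) \<in> R\<^sup>*}" for w
  have symR: "sym (R\<^sup>*)" by (rule sym_rtrancl) (auto simp: sym_def R_def insert_commute)
  have uvV: "u \<in> V" "v \<in> V" using D(4)[OF uv] by auto
  have CV: "C w \<subseteq> V" if "w \<in> V" for w
  proof
    fix x assume "x \<in> C w"
    then have "(w, x) \<in> R\<^sup>*" by (simp add: C_def)
    then show "x \<in> V"
      by (induction rule: rtrancl_induct) (use that D(4) in \<open>auto simp: R_def E'_def\<close>)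
  qed
  have cover: "x \<in> C u \<union> C v" if "x \<in> V" for x
  proof -
    have "(u, x) \<in> {(a, b). {a, b} \<in> E}\<^sup>*" using con that uvV by (simp add: connected_graph_def)
    then show ?thesis
    proof (induction rule: rtrancl_induct)
      case base
      then show ?case by (simp add: C_def)
    next
      case (step y z)
      show ?case
      proof (cases "{y, z} = {u, v}")
        case True
        then have "z = u \<or> z = v" by (auto simp: doubleton_eq_iff)
        then show ?thesis by (auto simp: C_def)
      next
        case False
        then have "(y, z) \<in> R" using step by (auto simp: R_def E'_def)
        then show ?thesis using step.IH by (auto simp: C_def intro: rtrancl_into_rtrancl)
      qed
    qed
  qed
  have trans: "(x, y) \<in> R\<^sup>*" if "x \<in> C w" "y \<in> C w" for x y w
    using that symR unfolding C_def by (metis mem_Collect_eq rtrancl_trans symD)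
  have disj: "C u \<inter> C v = {}"
  proof (rule ccontr)
    assume "C u \<inter> C v \<noteq> {}"
    then obtain z where "(u, z) \<in> R\<^sup>*" "(v, z) \<in> R\<^sup>*" by (auto simp: C_def)
    then have "(u, v) \<in> R\<^sup>*" using symR by (meson rtrancl_trans symD)
    then have "C v \<subseteq> C u" by (auto simp: C_def)
    then have "(x, y) \<in> R\<^sup>*" if "x \<in> V" "y \<in> V" for x y
      using cover that trans[of x u y] by blast
    then show False using ncon uvV by (auto simp: connected_graph_def E'_def R_def)
  qed
  have Ccon: "connected_graph (C w) {e \<in> E'. e \<subseteq> C w}" for w
  proof -
    let ?A = "{(a, b). {a, b} \<in> {e \<in> E'. e \<subseteq> C w}}"
    have "(w, x) \<in> ?A\<^sup>*" if "x \<in> C w" for x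
    proof -
      from that have "(w, x) \<in> R\<^sup>*" by (simp add: C_def)
      then show ?thesis
      proof (induction rule: rtrancl_induct)
        case (step y z)
        have "y \<in> C w" "z \<in> C w" using step by (auto simp: C_def intro: rtrancl_into_rtrancl)
        then have "(y, z) \<in> ?A" using step by (auto simp: R_def)
        then show ?case using step.IH by (rule rtrancl_into_rtrancl[rotated])
      qed simp
    qed
    moreover have "sym (?A\<^sup>*)" by (rule sym_rtrancl) (auto simp: sym_def insert_commute)
    ultimately have "(x, y) \<in> ?A\<^sup>*" if "x \<in> C w" "y \<in> C w" for x y
      using that by (meson rtrancl_trans symD)
    moreover have "w \<in> C w" by (simp add: C_def)
    ultimately show ?thesis unfolding connected_graph_def by blast
  qed
  have "e \<subseteq> C u \<or> e \<subseteq> C v" if e: "e \<in> E'" for e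
  proof -
    obtain a b where ab: "e = {a, b}" "a \<in> V" using D(3)[of e] e by (auto simp: E'_def)
    then have "(a, b) \<in> R" using e by (simp add: R_def)
    moreover obtain w where w: "w = u \<or> w = v" "a \<in> C w" using cover ab by auto
    ultimately have "b \<in> C w" by (auto simp: C_def intro: rtrancl_into_rtrancl)
    then show ?thesis using w ab by auto
  qed
  then have split: "E' = {e \<in> E'. e \<subseteq> C u} \<union> {e \<in> E'. e \<subseteq> C v}" by blast
  have V: "V = C u \<union> C v" using cover CV uvV by auto
  have "u \<in> C u" "v \<in> C v" by (auto simp: C_def)
  from that[OF this disj V Ccon[of u, unfolded E'_def] Ccon[of v, unfolded E'_def] split[unfolded E'_def]]
  show ?thesis .
qed

text \<open>Deleting a vertex \<open>u\<close> that is interior to its path leaves three pieces: the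
  two halves of the path and the side of \<open>v\<close>. This separation attains the excess for
  two paths joined at an interior vertex, and it rules out a cycle in the path cover below.\<close>

lemma three_classes:
  assumes "V = V1 \<union> V2" "V1 \<inter> V2 = {}" "v \<in> V2" "V1 = set (xs @ u # ys)" "distinct (xs @ u # ys)"
    "xs \<noteq> []" "ys \<noteq> []" "E \<subseteq> insert {u, v} (path_edges (xs @ u # ys) \<union> E2)" "E2 \<subseteq> Pow V2"
  shows "\<exists>c :: 'a \<Rightarrow> 'a. separation V E {u} c \<and> card (c ` (V - {u})) = 3"
proof -
  \<comment> \<open>Each class is labelled by one of its vertices; the side \<open>V2\<close>
    receives the default \<open>v\<close>.\<close>
  define c where "c x = (if x \<in> set xs then hd xs else if x \<in> set ys then hd ys else v)" for x
  have "path_edges (u # ys) = insert {u, hd ys} (path_edges ys)" using assms(7) by (cases ys) auto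
  then have "path_edges (xs @ u # ys) = insert {last xs, u} (path_edges xs \<union> insert {u, hd ys} (path_edges ys))"
    using path_edges_append[of xs "u # ys"] assms(6) by simp
  then have pe: "path_edges (xs @ u # ys) \<subseteq> {{last xs, u}, {u, hd ys}} \<union> Pow (set xs) \<union> Pow (set ys)"
    using path_edges_subset_Pow[of xs] path_edges_subset_Pow[of ys] by blast
  have "separation V E {u} c"
    unfolding separation_def
  proof (intro conjI allI impI)
    show "{u} \<subseteq> V" using assms by auto
    fix i j assume ij: "{i, j} \<in> E" "i \<in> V - {u}" "j \<in> V - {u}"
    have "u \<notin> {i, j}" using ij by auto
    then have ne: "{i, j} \<noteq> {u, v}" "{i, j} \<noteq> {last xs, u}" "{i, j} \<noteq> {u, hd ys}" by blast+
    then have "{i, j} \<in> path_edges (xs @ u # ys) \<or> {i, j} \<in> E2" using ij(1) assms(8) by blast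
    then have "{i, j} \<subseteq> set xs \<or> {i, j} \<subseteq> set ys \<or> {i, j} \<subseteq> V2"
    proof
      assume "{i, j} \<in> path_edges (xs @ u # ys)"
      from subsetD[OF pe this] have "{i, j} \<subseteq> set xs \<or> {i, j} \<subseteq> set ys" using ne by simp
      then show ?thesis by blast
    next
      assume "{i, j} \<in> E2"
      then show ?thesis using assms(9) by blast
    qed
    then show "c i = c j" using assms(2,4,5) by (auto simp: c_def)
  qed
  moreover have "c ` (V - {u}) = {hd xs, hd ys, v}"
  proof
    show "c ` (V - {u}) \<subseteq> {hd xs, hd ys, v}" by (auto simp: c_def)
    have "hd xs \<in> set xs" "hd ys \<in> set ys" using assms by auto
    then have "c (hd xs) = hd xs" "c (hd ys) = hd ys" "c v = v" "{hd xs, hd ys, v} \<subseteq> V - {u}"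
      using assms(1-5) by (auto simp: c_def)
    then show "{hd xs, hd ys, v} \<subseteq> c ` (V - {u})" by force
  qed
  moreover have "card {hd xs, hd ys, v} = 3"
  proof -
    have "hd xs \<in> set xs" "hd ys \<in> set ys" using assms by auto
    then have "hd xs \<noteq> hd ys" "hd xs \<noteq> v" "hd ys \<noteq> v" using assms(2-5) by auto
    then show ?thesis by simp
  qed
  ultimately show ?thesis by metis
qed

lemma bipartite_no_triangle:
  assumes "bipartite_graph V E" "{a, b} \<in> E" "{a, c} \<in> E" "{b, c} \<in> E"
  shows False
proof -
  obtain A B where AB: "A \<inter> B = {}" "\<forall>e\<in>E. \<exists>a\<in>A. \<exists>b\<in>B. e = {a, b}"
    using assms(1) by (auto simp: bipartite_graph_def)
  have "x \<in> A \<and> y \<in> B \<or> x \<in> B \<and> y \<in> A" if "{x, y} \<in> E" for x y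
    using AB(2) that by (force simp: doubleton_eq_iff)
  from this[OF assms(2)] this[OF assms(3)] this[OF assms(4)] AB(1) show False by auto
qed

text \<open>With \<open>T = {}\<close> there are at least \<open>card V - card E\<close> classes,
  but connectedness permits only one.\<close>

lemma connected_card_edges:
  assumes "simple_graph V E" "connected_graph V E"
  shows "card V \<le> Suc (card E)"
proof -
  obtain c :: "'a \<Rightarrow> 'a" where c: "separation V E {} c" "card V \<le> card (c ` V) + card E"
    using separation_exists[OF assms(1), of "{}"] by auto
  obtain w where w: "w \<in> V" using assms(2) by (auto simp: connected_graph_def)
  have "c x = c w" if "x \<in> V" for x
  proof -
    have "(x, w) \<in> {(a, b). {a, b} \<in> E}\<^sup>*" using assms(2) that w by (simp add: connected_graph_def)
    then show ?thesis
    proof (induction rule: rtrancl_induct)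
      case (step y z)
      then have "c y = c z" using c(1) simple_graphD(4)[OF assms(1)] by (auto simp: separation_def)
      then show ?case using step by simp
    qed simp
  qed
  then have "c ` V \<subseteq> {c w}" by auto
  then have "card (c ` V) \<le> 1" using card_mono[of "{c w}" "c ` V"] by simp
  then show ?thesis using c by simp
qed


lemma card_edges_at_pair:
  assumes "simple_graph V E" "x \<noteq> y" "{x, y} \<notin> E"
  shows "card {e \<in> E. e \<inter> {x, y} \<noteq> {}} = card (nbhd E x) + card (nbhd E y)"
proof -
  note D = simple_graphD[OF assms(1)]
  have "{e \<in> E. e \<inter> {x, y} \<noteq> {}} = {e \<in> E. e \<inter> {x} \<noteq> {}} \<union> {e \<in> E. e \<inter> {y} \<noteq> {}}" by auto
  moreover have "{e \<in> E. e \<inter> {x} \<noteq> {}} \<inter> {e \<in> E. e \<inter> {y} \<noteq> {}} = {}"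
  proof (rule ccontr)
    assume "\<not> ?thesis"
    then obtain e where e: "e \<in> E" "x \<in> e" "y \<in> e" by auto
    then have "e = {x, y}" using D(3)[OF e(1)] assms(2) by auto
    then show False using e assms(3) by simp
  qed
  ultimately show ?thesis
    using D(2) card_edges_at[OF assms(1), of x] card_edges_at[OF assms(1), of y]
    by (simp add: card_Un_disjoint)
qed

text \<open>In the applications \<open>\<delta>\<close> is \<open>card E + 1 - card V\<close>: 0 for
  a tree, 1 for a connected graph with one cycle. Deleting \<open>u\<close> leaves three classes,
  while the bound for one deleted vertex permits only \<open>3 - \<delta>\<close>.\<close>

lemma edge_between_interior_bound:
  assumes "simple_graph V E" "\<delta> \<le> 1"
    and "\<And>T c :: 'a \<Rightarrow> 'a. separation V E T c \<Longrightarrow> card (c ` (V - T)) + \<delta> \<le> card T + 2"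
    and "V = V1 \<union> V2" "V1 \<inter> V2 = {}" "v \<in> V2" "V1 = set (xs @ u # ys)" "distinct (xs @ u # ys)"
    "xs \<noteq> []" "ys \<noteq> []" "E \<subseteq> insert {u, v} (path_edges (xs @ u # ys) \<union> E2)" "E2 \<subseteq> Pow V2"
  shows "\<delta> = 0"
  using three_classes[OF assms(4-)] assms(3)[of "{u}"] by fastforce

text \<open>The edge \<open>{u, v}\<close> is chosen to meet all vertices of degree 3. If its
  removal disconnects the graph, both sides have Hamiltonian paths; in the presence of a cycle these
  paths can be made to end in \<open>u\<close> and \<open>v\<close>, so that they join to a single
  one.\<close>

lemma sparse_graph_path_cover:
  assumes sg: "simple_graph V E" and con: "connected_graph V E" and bip: "bipartite_graph V E"
    and \<delta>: "\<delta> \<le> 1" and cE: "card E + 1 = card V + \<delta>"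
    and bd: "\<And>T c :: 'a \<Rightarrow> 'a. separation V E T c \<Longrightarrow> card (c ` (V - T)) + \<delta> \<le> card T + 2"
  shows "(\<exists>vs. vs \<noteq> [] \<and> distinct vs \<and> set vs = V \<and> path_edges vs \<subseteq> E) \<or>
    \<delta> = 0 \<and> (\<exists>vs ws u v. vs \<noteq> [] \<and> ws \<noteq> [] \<and> distinct vs \<and> distinct ws \<and> set vs \<inter> set ws = {} \<and>
       V = set vs \<union> set ws \<and> u \<in> set vs \<and> v \<in> set ws \<and> {u, v} \<in> E \<and> path_edges vs \<union> path_edges ws \<subseteq> E)"
proof -
  note D = simple_graphD[OF sg]
  have deg3: "card (nbhd E x) \<le> 3" if xV: "x \<in> V" for x
  proof -
    obtain c :: "'a \<Rightarrow> 'a" where c: "separation V E {x} c"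
      "card V + card {e \<in> E. e \<inter> {x} \<noteq> {}} \<le> card (c ` (V - {x})) + card {x} + card E"
      using separation_exists[OF sg, of "{x}"] xV by blast
    then show ?thesis using bd[OF c(1)] cE card_edges_at[OF sg, of x] by simp
  qed
  \<comment> \<open>No edge joins \<open>x\<close> and \<open>y\<close>, so two vertices of degree 3
    would account for six edges; the bound for two deleted vertices leaves room for five.\<close>
  have adj: "{x, y} \<in> E" if xy: "x \<in> V" "y \<in> V" "x \<noteq> y" "card (nbhd E x) \<ge> 3" "card (nbhd E y) \<ge> 3" for x y
  proof (rule ccontr)
    assume n: "{x, y} \<notin> E"
    obtain c :: "'a \<Rightarrow> 'a" where c: "separation V E {x, y} c"
      "card V + card {e \<in> E. e \<inter> {x, y} \<noteq> {}} \<le> card (c ` (V - {x, y})) + card {x, y} + card E"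
      using separation_exists[OF sg, of "{x, y}"] xy by blast
    then show False using bd[OF c(1)] cE card_edges_at_pair[OF sg xy(3) n] xy by simp
  qed
  show ?thesis
  proof (cases "\<forall>x\<in>V. card (nbhd E x) \<le> 2")
    case True
    then show ?thesis using hamiltonian_path[OF sg con] by metis
  next
    case False
    then obtain u where u: "u \<in> V" "card (nbhd E u) \<ge> 3" by fastforce
    \<comment> \<open>If there is a second vertex of degree 3, it is taken as \<open>v\<close>, and
      a third one would complete a triangle; otherwise any neighbour of \<open>u\<close> will
      do.\<close>
    obtain v where v: "{u, v} \<in> E" "\<And>w. w \<in> V \<Longrightarrow> w \<noteq> u \<Longrightarrow> w \<noteq> v \<Longrightarrow> card (nbhd E w) \<le> 2"
    proof (cases "\<exists>v. v \<in> V \<and> v \<noteq> u \<and> card (nbhd E v) \<ge> 3")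
      case True
      then obtain v where v: "v \<in> V" "v \<noteq> u" "card (nbhd E v) \<ge> 3" by auto
      have uv: "{u, v} \<in> E" using adj[of u v] u v by auto
      have "card (nbhd E w) \<le> 2" if "w \<in> V" "w \<noteq> u" "w \<noteq> v" for w
      proof (rule ccontr)
        assume "\<not> ?thesis"
        then have "{u, w} \<in> E" "{v, w} \<in> E" using adj[of u w] adj[of v w] u v that by auto
        then show False using bipartite_no_triangle[OF bip uv] by blast
      qed
      then show ?thesis using that uv by blast
    next
      case False
      have "nbhd E u \<noteq> {}" using u by auto
      then obtain v where "{u, v} \<in> E" by (auto simp: nbhd_def)
      then show ?thesis using that[of v] False by fastforce
    qed
    have uvV: "u \<in> V" "v \<in> V" "u \<noteq> v" using D(4)[OF v(1)] by auto
    define E' where "E' = E - {{u, v}}"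
    have sg': "simple_graph V E'" using sg by (auto simp: simple_graph_def E'_def)
    have deg': "\<forall>x\<in>V. card (nbhd E' x) \<le> 2"
    proof
      fix x assume x: "x \<in> V"
      have sub: "nbhd E' x \<subseteq> nbhd E x" by (auto simp: nbhd_def E'_def)
      show "card (nbhd E' x) \<le> 2"
      proof (cases "x = u \<or> x = v")
        case True
        then have "(if x = u then v else u) \<in> nbhd E x - nbhd E' x"
          using v(1) by (auto simp: nbhd_def E'_def insert_commute)
        then have "nbhd E' x \<subset> nbhd E x" using sub by blast
        then have "card (nbhd E' x) < card (nbhd E x)" using D(6) by (rule psubset_card_mono[rotated])
        then show ?thesis using deg3[OF x] by simp
      next
        case False
        then have "card (nbhd E x) \<le> 2" using v(2) x by simp
        then show ?thesis using card_mono[OF D(6) sub] by linarith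
      qed
    qed
    show ?thesis
    proof (cases "connected_graph V E'")
      case True
      then obtain vs where "vs \<noteq> []" "distinct vs" "set vs = V" "path_edges vs \<subseteq> E'"
        using hamiltonian_path[OF sg' _ deg'] by metis
      then show ?thesis unfolding E'_def by blast
    next
      case False
      obtain V1 V2 where V12: "u \<in> V1" "v \<in> V2" "V1 \<inter> V2 = {}" "V = V1 \<union> V2"
        and c1: "connected_graph V1 {e \<in> E'. e \<subseteq> V1}" and c2: "connected_graph V2 {e \<in> E'. e \<subseteq> V2}"
        and E12: "E' = {e \<in> E'. e \<subseteq> V1} \<union> {e \<in> E'. e \<subseteq> V2}"
        by (rule connected_components_of_bridge[OF sg con v(1) False[unfolded E'_def], folded E'_def])
      have sgW: "simple_graph W {e \<in> E'. e \<subseteq> W}" if "W \<subseteq> V" for W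
        unfolding simple_graph_def
      proof
        show "finite W" using that D(1) by (rule finite_subset)
        show "{e \<in> E'. e \<subseteq> W} \<subseteq> {{a, b} |a b. a \<in> W \<and> b \<in> W \<and> a \<noteq> b}"
          using simple_graphD(3)[OF sg'] by fast
      qed
      have degW: "\<forall>x\<in>W. card (nbhd {e \<in> E'. e \<subseteq> W} x) \<le> 2" if "W \<subseteq> V" for W
      proof
        fix x assume "x \<in> W"
        have "card (nbhd {e \<in> E'. e \<subseteq> W} x) \<le> card (nbhd E' x)"
          using simple_graphD(6)[OF sg'] by (intro card_mono) (auto simp: nbhd_def)
        then show "card (nbhd {e \<in> E'. e \<subseteq> W} x) \<le> 2"
          using deg' \<open>x \<in> W\<close> that by fastforce
      qed
      have W: "V1 \<subseteq> V" "V2 \<subseteq> V" using V12 by auto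
      have Eins: "E = insert {u, v} E'" using v(1) by (auto simp: E'_def)
      have twopaths: ?thesis if "\<delta> = 0"
      proof -
        obtain vs where vs: "vs \<noteq> []" "distinct vs" "set vs = V1" "path_edges vs \<subseteq> {e \<in> E'. e \<subseteq> V1}"
          by (rule hamiltonian_path[OF sgW[OF W(1)] c1 degW[OF W(1)]])
        obtain ws where ws: "ws \<noteq> []" "distinct ws" "set ws = V2" "path_edges ws \<subseteq> {e \<in> E'. e \<subseteq> V2}"
          by (rule hamiltonian_path[OF sgW[OF W(2)] c2 degW[OF W(2)]])
        have "path_edges vs \<union> path_edges ws \<subseteq> E" using vs(4) ws(4) Eins by auto
        then show ?thesis using that V12 v(1) vs(1-3) ws(1-3) by metis
      qed
      \<comment> \<open>Joining the sides through \<open>{u, v}\<close> can fail only if an end of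
        this edge is interior to a side that is exactly a path. Then three classes force
        \<open>\<delta> = 0\<close>, and two separate paths are an admissible outcome.\<close>
      from hamiltonian_path_from[OF sgW[OF W(1)] c1 degW[OF W(1)] V12(1)]
      consider (a) vs where "distinct (u # vs)" "set (u # vs) = V1" "path_edges (u # vs) \<subseteq> E'"
        | (b) xs ys where "xs \<noteq> []" "ys \<noteq> []" "distinct (xs @ u # ys)" "set (xs @ u # ys) = V1"
            "{e \<in> E'. e \<subseteq> V1} = path_edges (xs @ u # ys)" by blast
      then show ?thesis
      proof cases
        case b
        have "\<delta> = 0"
        proof (rule edge_between_interior_bound[OF sg \<delta> bd V12(4,3,2) b(4)[symmetric] b(3,1,2)])
          show "E \<subseteq> insert {u, v} (path_edges (xs @ u # ys) \<union> {e \<in> E'. e \<subseteq> V2})"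
            using Eins E12 b(5) by blast
        qed auto
        then show ?thesis by (rule twopaths)
      next
        case a
        from hamiltonian_path_from[OF sgW[OF W(2)] c2 degW[OF W(2)] V12(2)]
        consider (a') ws where "distinct (v # ws)" "set (v # ws) = V2" "path_edges (v # ws) \<subseteq> E'"
          | (b') xs ys where "xs \<noteq> []" "ys \<noteq> []" "distinct (xs @ v # ys)" "set (xs @ v # ys) = V2"
              "{e \<in> E'. e \<subseteq> V2} = path_edges (xs @ v # ys)" by blast
        then show ?thesis
        proof cases
          case b'
          have "\<delta> = 0"
          proof (rule edge_between_interior_bound[OF sg \<delta> bd _ _ V12(1) b'(4)[symmetric] b'(3,1,2)])
            show "V = V2 \<union> V1" "V2 \<inter> V1 = {}" using V12 by auto
            show "E \<subseteq> insert {v, u} (path_edges (xs @ v # ys) \<union> {e \<in> E'. e \<subseteq> V1})"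
              using Eins E12 b'(5) by (auto simp: insert_commute)
          qed auto
          then show ?thesis by (rule twopaths)
        next
          case a'
          have "path_edges (rev (u # vs) @ v # ws) = insert {u, v} (path_edges (u # vs) \<union> path_edges (v # ws))"
            by (subst path_edges_append) (auto simp del: rev.simps simp: last_rev)
          then have "path_edges (rev (u # vs) @ v # ws) \<subseteq> E" using a(3) a'(3) Eins by auto
          moreover have "distinct (rev (u # vs) @ v # ws)" "set (rev (u # vs) @ v # ws) = V"
            using a a' V12 by auto
          ultimately show ?thesis by blast
        qed
      qed
    qed
  qed
qed


section \<open>Cycles and girth of bipartite graphs\<close>

lemma bipartite_even_cycle:
  assumes "bipartite_graph V E" "is_cycle E vs"
  shows "even (length vs)"
proof -
  obtain A B where AB: "A \<inter> B = {}" "\<forall>e\<in>E. \<exists>a\<in>A. \<exists>b\<in>B. e = {a, b}"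
    using assms(1) by (auto simp: bipartite_graph_def)
  have flip: "x \<in> A \<longleftrightarrow> y \<notin> A" if xy: "{x, y} \<in> E" for x y
  proof -
    obtain a b where "a \<in> A" "b \<in> B" "{x, y} = {a, b}" using AB(2) xy by blast
    then show ?thesis using AB(1) by (auto simp: doubleton_eq_iff)
  qed
  have len: "3 \<le> length vs" and pe: "path_edges vs \<subseteq> E" and cl: "{last vs, hd vs} \<in> E"
    using assms(2) by (auto simp: is_cycle_def)
  have alt: "vs ! i \<in> A \<longleftrightarrow> (vs ! 0 \<in> A \<longleftrightarrow> even i)" if "i < length vs" for i
    using that
  proof (induction i)
    case (Suc i)
    then have "{vs ! i, vs ! Suc i} \<in> E" using path_edges_nth[of i vs] pe by blast
    then show ?case using flip[of "vs ! i" "vs ! Suc i"] Suc by auto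
  qed simp
  have "vs \<noteq> []" using len by auto
  then have "last vs = vs ! (length vs - 1)" "hd vs = vs ! 0"
    by (simp_all add: last_conv_nth hd_conv_nth)
  moreover have "length vs - 1 < length vs" using len by simp
  ultimately have "odd (length vs - 1)" using flip[OF cl] alt by metis
  then show ?thesis using len by auto
qed

lemma path_edges_sublist:
  "path_edges (take m (drop k vs)) \<subseteq> path_edges vs"
proof
  fix e assume "e \<in> path_edges (take m (drop k vs))"
  then obtain i where i: "Suc i < length (take m (drop k vs))" "e = {take m (drop k vs) ! i, take m (drop k vs) ! Suc i}"
    by (auto simp: path_edges_def)
  then have "e = {vs ! (k + i), vs ! Suc (k + i)}" "Suc (k + i) < length vs" by auto
  then show "e \<in> path_edges vs" using path_edges_nth by auto
qed

text \<open>The chord closes the stretch of the path between its ends. Since it is not a path edge,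
  at least one vertex lies strictly between them, and the cycle has length at least 3.\<close>

lemma edge_within_path_cycle:
  assumes "edge_within_path V E"
  obtains vs where "is_cycle E vs"
proof -
  obtain ws u v where ws: "distinct ws" "set ws = V" and uv: "u \<in> V" "v \<in> V" "u \<noteq> v" "{u, v} \<notin> path_edges ws"
    and E: "E = insert {u, v} (path_edges ws)"
    using assms by (auto simp: edge_within_path_def path_graph_def)
  have *: "\<exists>vs. is_cycle E vs"
    if ij: "i < j" "j < length ws" "{ws ! i, ws ! j} = {u, v}" for i j
  proof -
    have "j \<noteq> Suc i" using ij uv(4) path_edges_nth[of i ws] by auto
    let ?vs = "take (Suc (j - i)) (drop i ws)"
    have len: "length ?vs = Suc (j - i)" using ij by simp
    have "hd ?vs = ws ! i" using ij by (simp add: hd_drop_conv_nth)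
    moreover have "last ?vs = ws ! j"
      using len ij by (subst last_conv_nth) (auto simp flip: length_greater_0_conv)
    ultimately have "{last ?vs, hd ?vs} \<in> E" using ij(3) E by (simp add: insert_commute)
    moreover have "path_edges ?vs \<subseteq> E" using path_edges_sublist[of "Suc (j - i)" i ws] E by blast
    moreover have "3 \<le> length ?vs" using len \<open>j \<noteq> Suc i\<close> ij by simp
    moreover have "distinct ?vs" using ws by simp
    ultimately show ?thesis unfolding is_cycle_def by blast
  qed
  obtain i j where ij: "i < length ws" "j < length ws" "u = ws ! i" "v = ws ! j"
    using uv ws by (metis in_set_conv_nth)
  then have "i \<noteq> j" using uv by auto
  then have "\<exists>vs. is_cycle E vs" using *[of i j] *[of j i] ij by (metis insert_commute linorder_neqE_nat)
  then show ?thesis using that by blast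
qed

text \<open>The infimum of a nonempty set of lengths is attained, so the girth is the length of an
  actual cycle.\<close>

lemma bipartite_girth_even:
  assumes "bipartite_graph V E" "is_cycle E vs"
  shows "\<exists>g. girth E = enat g \<and> even g"
proof -
  let ?S = "{enat (length vs) | vs. is_cycle E vs}"
  have "?S \<noteq> {}" using assms(2) by blast
  then have "Inf ?S \<in> ?S" unfolding Inf_enat_def by (auto intro: LeastI)
  then show ?thesis using bipartite_even_cycle[OF assms(1)] unfolding girth_def by auto
qed

lemma path_separation_card:
  assumes "separation V E T c" "path_edges vs \<subseteq> E" "set vs \<subseteq> V" "distinct vs" "vs \<noteq> []"
  shows "card (c ` (set vs - T)) \<le> card (set vs \<inter> T) + 1"
proof -
  have "c i = c j" if ij: "{i, j} \<in> path_edges vs" "i \<notin> T" "j \<notin> T" for i j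
  proof -
    have "{i, j} \<subseteq> V" using ij(1) path_edges_subset_Pow[of vs] assms(3) by blast
    then show ?thesis using assms(1,2) ij unfolding separation_def by blast
  qed
  then have "card (c ` (set vs - T)) \<le> card (set vs \<inter> T) + (if hd vs \<in> T then 0 else 1)"
    by (rule path_separation_bound) (use assms in auto)
  then show ?thesis by (auto split: if_splits)
qed

section \<open>The number of edges compared with separations\<close>

definition edge_excess_bound :: "'a set \<Rightarrow> 'a set set \<Rightarrow> bool" where
  "edge_excess_bound V E \<longleftrightarrow> (\<forall>T. \<forall>c :: 'a \<Rightarrow> 'a. separation V E T c \<longrightarrow>
     card E + card (c ` (V - T)) \<le> card V + card T + 1)"

text \<open>Together with the bound: \<open>card E\<close> exceeds the minimum of
  \<open>card V + card T - k\<close> over all separations with \<open>k\<close> classes by exactly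
  1. The additive form avoids truncated subtraction. Vertices serve as labels because a class can be
  named after one of its members.\<close>

definition edge_excess_attained :: "'a set \<Rightarrow> 'a set set \<Rightarrow> bool" where
  "edge_excess_attained V E \<longleftrightarrow> (\<exists>T. \<exists>c :: 'a \<Rightarrow> 'a. separation V E T c \<and>
     card E + card (c ` (V - T)) = card V + card T + 1)"

lemma disjoint_path_edges:
  assumes "set vs \<inter> set ws = {}"
  shows "path_edges vs \<inter> path_edges ws = {}"
proof -
  have "e \<noteq> {}" if "e \<in> path_edges vs" for e
    using that by (auto simp: path_edges_def)
  moreover have "e \<subseteq> set vs \<inter> set ws" if "e \<in> path_edges vs" "e \<in> path_edges ws" for e
    using that path_edges_subset_Pow by blast
  ultimately show ?thesis using assms by blast
qed

text \<open>A single class with \<open>T = {}\<close> gives \<open>card E \<le> card V\<close>, and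
  connectedness leaves only two values for \<open>card E\<close>. Counting then shows that a
  covering path misses exactly one edge, or that two paths and the edge between them are all of
  \<open>E\<close>.\<close>

lemma excess_bound_imp_shape:
  assumes sg: "simple_graph V E" and con: "connected_graph V E" and bip: "bipartite_graph V E"
    and npath: "\<not> path_graph V E" and bd: "edge_excess_bound V E"
  shows "edge_between_paths V E \<or> edge_within_path V E"
proof -
  note D = simple_graphD[OF sg]
  obtain w where w: "w \<in> V" using con by (auto simp: connected_graph_def)
  have "separation V E {} (\<lambda>_. w)" by (simp add: separation_def)
  moreover have "card ((\<lambda>_. w) ` (V - {})) = 1" using w by (auto simp: image_constant_conv)
  ultimately have "card E \<le> card V"
    using bd unfolding edge_excess_bound_def by fastforce
  with connected_card_edges[OF sg con] obtain \<delta> where \<delta>: "\<delta> \<le> 1" "card E + 1 = card V + \<delta>"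
    using that[of "card E + 1 - card V"] by auto
  have "card (c ` (V - T)) + \<delta> \<le> card T + 2" if "separation V E T c" for T and c :: "'a \<Rightarrow> 'a"
    using bd that \<delta> unfolding edge_excess_bound_def by fastforce
  from sparse_graph_path_cover[OF sg con bip \<delta> this]
  consider (one) vs where "vs \<noteq> []" "distinct vs" "set vs = V" "path_edges vs \<subseteq> E"
    | (two) vs ws u v where "\<delta> = 0" "vs \<noteq> []" "ws \<noteq> []" "distinct vs" "distinct ws" "set vs \<inter> set ws = {}"
       "V = set vs \<union> set ws" "u \<in> set vs" "v \<in> set ws" "{u, v} \<in> E" "path_edges vs \<union> path_edges ws \<subseteq> E"
    by blast
  then show ?thesis
  proof cases
    case one
    have pg: "path_graph V (path_edges vs)" using one unfolding path_graph_def by blast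
    have "Suc (card (path_edges vs)) = card V"
      using card_path_edges[OF one(2,1)] one(2,3) distinct_card by metis
    then have c: "card (E - path_edges vs) = \<delta>" using \<delta> D(2) one(4) by (simp add: card_Diff_subset)
    have "E \<noteq> path_edges vs" using pg npath by auto
    then have "E - path_edges vs \<noteq> {}" using one(4) by blast
    then have "card (E - path_edges vs) = 1" using c \<delta>(1) D(2) by (metis card_0_eq finite_Diff le_neq_implies_less less_one)
    then obtain e where e: "E - path_edges vs = {e}" by (auto simp: card_1_singleton_iff)
    then obtain u v where uv: "e = {u, v}" "u \<in> V" "v \<in> V" "u \<noteq> v" using D(3)[of e] by blast
    have "E = insert {u, v} (path_edges vs)" "{u, v} \<notin> path_edges vs" using e one(4) uv(1) by blast+
    then show ?thesis using pg uv unfolding edge_within_path_def by blast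
  next
    case two
    let ?F = "insert {u, v} (path_edges vs \<union> path_edges ws)"
    have "path_edges vs \<inter> path_edges ws = {}"
      using two(6) by (rule disjoint_path_edges)
    moreover have "{u, v} \<notin> path_edges vs \<union> path_edges ws"
      using path_edges_subset_Pow[of vs] path_edges_subset_Pow[of ws] two(6,8,9) by blast
    ultimately have "card ?F = Suc (card (path_edges vs) + card (path_edges ws))"
      by (simp add: card_Un_disjoint)
    moreover have "card V = length vs + length ws"
      using two by (simp add: card_Un_disjoint distinct_card)
    ultimately have "card ?F = card E"
      using card_path_edges[OF two(4,2)] card_path_edges[OF two(5,3)] \<delta> two(1) by simp
    moreover have "?F \<subseteq> E" using two by blast
    ultimately have "E = ?F" using D(2) by (metis card_subset_eq)
    moreover have "path_graph (set vs) (path_edges vs)" "path_graph (set ws) (path_edges ws)"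
      using two unfolding path_graph_def by blast+
    ultimately show ?thesis using two(6-9) unfolding edge_between_paths_def by blast
  qed
qed

text \<open>The Hamiltonian path alone limits the classes to \<open>card T + 1\<close>, and the
  chord makes \<open>card E = card V\<close>. Equality occurs for \<open>T = {}\<close>.\<close>

lemma edge_within_path_excess:
  assumes "edge_within_path V E"
  shows "edge_excess_bound V E" "edge_excess_attained V E"
proof -
  obtain ws u v where ws: "ws \<noteq> []" "distinct ws" "set ws = V" and uv: "u \<in> V" "v \<in> V" "u \<noteq> v" "{u, v} \<notin> path_edges ws"
    and E: "E = insert {u, v} (path_edges ws)"
    using assms by (auto simp: edge_within_path_def path_graph_def)
  have cE: "card E = card V"
    using card_path_edges[OF ws(2,1)] uv(4) distinct_card[OF ws(2)] ws(3) by (simp add: E)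
  show "edge_excess_bound V E"
    unfolding edge_excess_bound_def
  proof (intro allI impI)
    fix T and c :: "'a \<Rightarrow> 'a"
    assume sep: "separation V E T c"
    have "card (c ` (V - T)) \<le> card (V \<inter> T) + 1"
      using path_separation_card[OF sep, of ws] ws E by auto
    moreover have "V \<inter> T = T" using sep by (auto simp: separation_def)
    ultimately show "card E + card (c ` (V - T)) \<le> card V + card T + 1" using cE by simp
  qed
  have "separation V E {} (\<lambda>_. u)" by (simp add: separation_def)
  moreover have "card ((\<lambda>_. u) ` (V - {})) = 1" using uv by (auto simp: image_constant_conv)
  ultimately show "edge_excess_attained V E"
    unfolding edge_excess_attained_def using cE by (intro exI[of _ "{}"] exI[of _ "\<lambda>_. u"]) simp
qed

text \<open>The two paths limit the classes to \<open>card T + 2\<close>, and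
  \<open>card E + 1 = card V\<close>. Equality requires a vertex whose deletion leaves three
  classes: an end of the joining edge that is interior to its path. If neither end is interior, the
  whole graph is a path.\<close>

lemma edge_between_paths_excess:
  assumes "edge_between_paths V E" "\<not> path_graph V E"
  shows "edge_excess_bound V E" "edge_excess_attained V E"
proof -
  obtain vs ws u v where vs: "vs \<noteq> []" "distinct vs" and ws: "ws \<noteq> []" "distinct ws"
    and disj: "set vs \<inter> set ws = {}" and V: "V = set vs \<union> set ws" and uv: "u \<in> set vs" "v \<in> set ws"
    and E: "E = insert {u, v} (path_edges vs \<union> path_edges ws)"
    using assms(1) unfolding edge_between_paths_def path_graph_def by blast
  have "path_edges vs \<inter> path_edges ws = {}"
    using disj by (rule disjoint_path_edges)
  moreover have "{u, v} \<notin> path_edges vs \<union> path_edges ws"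
    using path_edges_subset_Pow[of vs] path_edges_subset_Pow[of ws] disj uv by blast
  ultimately have "card E = Suc (card (path_edges vs) + card (path_edges ws))"
    by (simp add: card_Un_disjoint E)
  moreover have "card V = length vs + length ws"
    using vs ws disj by (simp add: card_Un_disjoint distinct_card V)
  ultimately have cE: "card E + 1 = card V"
    using card_path_edges[OF vs(2,1)] card_path_edges[OF ws(2,1)] by simp
  show "edge_excess_bound V E"
    unfolding edge_excess_bound_def
  proof (intro allI impI)
    fix T and c :: "'a \<Rightarrow> 'a"
    assume sep: "separation V E T c"
    have "card (c ` (set vs - T)) \<le> card (set vs \<inter> T) + 1" "card (c ` (set ws - T)) \<le> card (set ws \<inter> T) + 1"
      using path_separation_card[OF sep, of vs] path_separation_card[OF sep, of ws] vs ws E V by auto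
    moreover have "c ` (V - T) = c ` (set vs - T) \<union> c ` (set ws - T)" by (auto simp: V)
    then have "card (c ` (V - T)) \<le> card (c ` (set vs - T)) + card (c ` (set ws - T))"
      by (simp only: card_Un_le)
    moreover have "T = (set vs \<inter> T) \<union> (set ws \<inter> T)" using sep V by (auto simp: separation_def)
    then have "card T = card (set vs \<inter> T) + card (set ws \<inter> T)"
      using disj card_Un_disjoint[of "set vs \<inter> T" "set ws \<inter> T"] by auto
    ultimately show "card E + card (c ` (V - T)) \<le> card V + card T + 1"
      using cE by linarith
  qed
  obtain xs ys where xy: "vs = xs @ u # ys" using uv(1) by (metis split_list)
  obtain xs' ys' where xy': "ws = xs' @ v # ys'" using uv(2) by (metis split_list)
  have attained: "edge_excess_attained V E"
    if "separation V E {z} c" "card (c ` (V - {z})) = 3" for z and c :: "'a \<Rightarrow> 'a"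
    unfolding edge_excess_attained_def using that cE by (intro exI[of _ "{z}"] exI[of _ c]) simp
  show "edge_excess_attained V E"
  proof (cases "xs \<noteq> [] \<and> ys \<noteq> []")
    case True
    have "\<exists>c :: 'a \<Rightarrow> 'a. separation V E {u} c \<and> card (c ` (V - {u})) = 3"
    proof (rule three_classes[of V "set vs" "set ws" v xs u ys E "path_edges ws"])
      show "path_edges ws \<subseteq> Pow (set ws)" by (rule path_edges_subset_Pow)
    qed (use True V disj uv E vs xy in auto)
    then show ?thesis using attained by blast
  next
    case False
    show ?thesis
    proof (cases "xs' \<noteq> [] \<and> ys' \<noteq> []")
      case True
      have "\<exists>c :: 'a \<Rightarrow> 'a. separation V E {v} c \<and> card (c ` (V - {v})) = 3"
      proof (rule three_classes[of V "set ws" "set vs" u xs' v ys' E "path_edges vs"])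
        show "path_edges vs \<subseteq> Pow (set vs)" by (rule path_edges_subset_Pow)
      qed (use True V disj uv E ws xy' in \<open>auto simp: insert_commute\<close>)
      then show ?thesis using attained by blast
    next
      case F': False
      \<comment> \<open>Up to reversal \<open>u\<close> is the last vertex of its path, and below
        \<open>v\<close> the first of the other, so that the two lists can be concatenated.\<close>
      obtain vs' where vs': "vs' \<noteq> []" "distinct vs'" "set vs' = set vs" "path_edges vs' = path_edges vs" "last vs' = u"
      proof (cases "ys = []")
        case True
        then show ?thesis using that[of vs] vs xy by simp
      next
        case ys: False
        then have "last (rev vs) = u" using False xy by simp
        then show ?thesis using that[of "rev vs"] vs by simp
      qed
      obtain ws' where ws': "ws' \<noteq> []" "distinct ws'" "set ws' = set ws" "path_edges ws' = path_edges ws" "hd ws' = v"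
      proof (cases "xs' = []")
        case True
        then show ?thesis using that[of ws] ws xy' by simp
      next
        case xs: False
        then have "hd (rev ws) = v" using F' xy' by simp
        then show ?thesis using that[of "rev ws"] ws by simp
      qed
      have "path_edges (vs' @ ws') = E" using path_edges_append[OF vs'(1) ws'(1)] vs' ws' E by simp
      moreover have "distinct (vs' @ ws')" "set (vs' @ ws') = V" using vs' ws' disj V by auto
      ultimately have "path_graph V E" using vs'(1) unfolding path_graph_def
        by (intro exI[of _ "vs' @ ws'"]) simp
      then show ?thesis using assms(2) by blast
    qed
  qed
qed

text \<open>The girth condition comes from bipartiteness once the chord has created a cycle.\<close>

lemma excess_characterization:
  assumes "simple_graph V E" "connected_graph V E" "bipartite_graph V E" "\<not> path_graph V E"
  shows "edge_excess_bound V E \<and> edge_excess_attained V E \<longleftrightarrow>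
    edge_between_paths V E \<or> edge_within_path V E \<and> (\<exists>g. girth E = enat g \<and> even g)"
proof
  assume "edge_excess_bound V E \<and> edge_excess_attained V E"
  then show "edge_between_paths V E \<or> edge_within_path V E \<and> (\<exists>g. girth E = enat g \<and> even g)"
    using excess_bound_imp_shape[OF assms] edge_within_path_cycle bipartite_girth_even[OF assms(3)] by metis
next
  assume "edge_between_paths V E \<or> edge_within_path V E \<and> (\<exists>g. girth E = enat g \<and> even g)"
  then show "edge_excess_bound V E \<and> edge_excess_attained V E"
    using edge_within_path_excess edge_between_paths_excess assms(4) by blast
qed

section \<open>Localization of a subring of a domain\<close>

text \<open>Mediates between the type, in which polynomials are computed with, and the ring records,
  in which ideals, heights and localizations are defined.\<close>

definition class_ring :: "'a::comm_ring_1 set \<Rightarrow> 'a ring" where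
  "class_ring S = \<lparr>carrier = S, mult = (*), one = 1, zero = 0, add = (+)\<rparr>"

lemma class_ring_simps [simp]:
  "carrier (class_ring S) = S" "x \<otimes>\<^bsub>class_ring S\<^esub> y = x * y" "\<one>\<^bsub>class_ring S\<^esub> = 1"
  "\<zero>\<^bsub>class_ring S\<^esub> = 0" "x \<oplus>\<^bsub>class_ring S\<^esub> y = x + y"
  by (simp_all add: class_ring_def)

locale subdomain_carrier =
  fixes S :: "'a::idom set"
  assumes zero_S [simp]: "0 \<in> S" and one_S [simp]: "1 \<in> S"
    and add_S [simp]: "\<And>x y. x \<in> S \<Longrightarrow> y \<in> S \<Longrightarrow> x + y \<in> S"
    and mult_S [simp]: "\<And>x y. x \<in> S \<Longrightarrow> y \<in> S \<Longrightarrow> x * y \<in> S"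
    and uminus_S [simp]: "\<And>x. x \<in> S \<Longrightarrow> - x \<in> S"
begin

abbreviation R where "R \<equiv> class_ring S"

lemma diff_S [simp]: "x \<in> S \<Longrightarrow> y \<in> S \<Longrightarrow> x - y \<in> S"
  using add_S[of x "- y"] by simp

lemma sum_S: "(\<And>i. i \<in> A \<Longrightarrow> f i \<in> S) \<Longrightarrow> sum f A \<in> S"
  by (induction A rule: infinite_finite_induct) auto

lemma cring_R: "cring R"
proof (intro cringI abelian_groupI comm_monoidI)
  fix x assume "x \<in> carrier R"
  then show "\<exists>y\<in>carrier R. y \<oplus>\<^bsub>R\<^esub> x = \<zero>\<^bsub>R\<^esub>"
    by (auto intro!: bexI[of _ "- x"])
qed (auto simp: algebra_simps)

sublocale R: cring R by (rule cring_R)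

lemma a_inv_R [simp]: "x \<in> S \<Longrightarrow> \<ominus>\<^bsub>R\<^esub> x = - x"
  using R.minus_equality[of "- x" x] by simp

lemma a_minus_R [simp]: "x \<in> S \<Longrightarrow> y \<in> S \<Longrightarrow> x \<ominus>\<^bsub>R\<^esub> y = x - y"
  by (simp add: a_minus_def)

lemma ideal_R_iff:
  "ideal I R \<longleftrightarrow> I \<subseteq> S \<and> 0 \<in> I \<and> (\<forall>x\<in>I. \<forall>y\<in>I. x + y \<in> I) \<and> (\<forall>x\<in>S. \<forall>y\<in>I. x * y \<in> I)"
proof
  assume "ideal I R"
  then interpret ideal I R .
  show "I \<subseteq> S \<and> 0 \<in> I \<and> (\<forall>x\<in>I. \<forall>y\<in>I. x + y \<in> I) \<and> (\<forall>x\<in>S. \<forall>y\<in>I. x * y \<in> I)"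
    using a_subset zero_closed a_closed I_l_closed by auto
next
  assume I: "I \<subseteq> S \<and> 0 \<in> I \<and> (\<forall>x\<in>I. \<forall>y\<in>I. x + y \<in> I) \<and> (\<forall>x\<in>S. \<forall>y\<in>I. x * y \<in> I)"
  show "ideal I R"
  proof (rule idealI[OF R.ring_axioms])
    show "subgroup I (add_monoid R)"
    proof (rule R.add.subgroupI)
      fix a assume "a \<in> I"
      then have "a \<in> S" "(-1) * a \<in> I" using I uminus_S[OF one_S] by blast+
      then show "\<ominus>\<^bsub>R\<^esub> a \<in> I" by simp
    qed (use I in auto)
  next
    fix a x assume "a \<in> I" "x \<in> carrier R"
    then show "x \<otimes>\<^bsub>R\<^esub> a \<in> I" "a \<otimes>\<^bsub>R\<^esub> x \<in> I" using I by (auto simp: mult.commute)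
  qed
qed

lemma primeideal_R_iff:
  "primeideal P R \<longleftrightarrow> ideal P R \<and> 1 \<notin> P \<and> (\<forall>a\<in>S. \<forall>b\<in>S. a * b \<in> P \<longrightarrow> a \<in> P \<or> b \<in> P)"
proof
  assume "primeideal P R"
  then interpret primeideal P R .
  show "ideal P R \<and> 1 \<notin> P \<and> (\<forall>a\<in>S. \<forall>b\<in>S. a * b \<in> P \<longrightarrow> a \<in> P \<or> b \<in> P)"
    using is_ideal I_notcarr I_prime one_imp_carrier by auto
next
  assume P: "ideal P R \<and> 1 \<notin> P \<and> (\<forall>a\<in>S. \<forall>b\<in>S. a * b \<in> P \<longrightarrow> a \<in> P \<or> b \<in> P)"
  show "primeideal P R"
    by (rule primeidealI) (use P cring_R in auto)
qed

lemma Idl_subset_iff: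
  assumes "A \<subseteq> S" "ideal J R"
  shows "Idl\<^bsub>R\<^esub> A \<subseteq> J \<longleftrightarrow> A \<subseteq> J"
  using R.Idl_subset_ideal[of J A] assms by simp

end

text \<open>The operations on fractions are unions over all representatives; such a union collapses
  to a single fraction once all its members agree.\<close>

lemma UN_pairs_const:
  assumes "x \<in> X" "y \<in> Y" "\<And>a s b t. (a, s) \<in> X \<Longrightarrow> (b, t) \<in> Y \<Longrightarrow> f a s b t = v"
  shows "(\<Union>(a, s)\<in>X. \<Union>(b, t)\<in>Y. f a s b t) = v"
proof -
  have "(\<Union>(b, t)\<in>Y. f a s b t) = v" if "(a, s) \<in> X" for a s
    using assms(2) assms(3)[OF that] by (force split: prod.splits)
  then show ?thesis using assms(1) by (force split: prod.splits)
qed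

locale prime_localization = subdomain_carrier +
  fixes P assumes prime_P: "primeideal P R"
begin

definition M where "M = S - P"

abbreviation L where "L \<equiv> localization R P"
abbreviation fr where "fr \<equiv> frac R (S - P)"
abbreviation ext where "ext \<equiv> localized_ideal R P"

definition contraction where "contraction J = {a \<in> S. fr a 1 \<in> J}"

lemma ideal_P: "ideal P R" and one_notin_P: "1 \<notin> P"
  and P_prime: "a \<in> S \<Longrightarrow> b \<in> S \<Longrightarrow> a * b \<in> P \<Longrightarrow> a \<in> P \<or> b \<in> P"
  using prime_P by (auto simp: primeideal_R_iff)

lemma M_one [simp]: "1 \<in> M" and M_mult [simp]: "s \<in> M \<Longrightarrow> t \<in> M \<Longrightarrow> s * t \<in> M"
  and M_S [simp]: "s \<in> M \<Longrightarrow> s \<in> S" and M_nonzero: "s \<in> M \<Longrightarrow> s \<noteq> 0"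
  using one_notin_P P_prime ideal_P by (auto simp: M_def ideal_R_iff)

text \<open>In a domain the multiplier \<open>u\<close> of the definition cancels because
  \<open>M\<close> avoids 0, and equality of fractions becomes cross-multiplication.\<close>

lemma frac_rel_iff:
  assumes "a \<in> S" "s \<in> M"
  shows "((a, s), (b, t)) \<in> frac_rel R (S - P) \<longleftrightarrow> b \<in> S \<and> t \<in> M \<and> a * t = b * s"
proof -
  have "(\<exists>u\<in>M. u * (a * t - b * s) = 0) \<longleftrightarrow> a * t = b * s"
    using M_nonzero by (auto intro: exI[of "\<lambda>u. u \<in> M" 1])
  then show ?thesis using assms by (auto simp: frac_rel_def M_def[symmetric])
qed

lemma mem_frac_iff: "a \<in> S \<Longrightarrow> s \<in> M \<Longrightarrow> (b, t) \<in> fr a s \<longleftrightarrow> b \<in> S \<and> t \<in> M \<and> a * t = b * s"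
  by (simp add: frac_def frac_rel_iff)

lemma frac_self: "a \<in> S \<Longrightarrow> s \<in> M \<Longrightarrow> (a, s) \<in> fr a s"
  by (simp add: mem_frac_iff)

lemma frac_eq_iff:
  assumes "a \<in> S" "s \<in> M" "b \<in> S" "t \<in> M"
  shows "fr a s = fr b t \<longleftrightarrow> a * t = b * s"
proof
  assume "fr a s = fr b t"
  then have "(b, t) \<in> fr a s" using frac_self assms by simp
  then show "a * t = b * s" using assms by (simp add: mem_frac_iff)
next
  assume eq: "a * t = b * s"
  have "(a * t' = c * s) = (b * t' = c * t)" for c t'
  proof -
    have "(a * t' - c * s) * t = (a * t) * t' - c * s * t" by (simp add: algebra_simps)
    also have "\<dots> = (b * t' - c * t) * s" unfolding eq by (simp add: algebra_simps)
    finally have "(a * t' - c * s) * t = (b * t' - c * t) * s" .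
    then show ?thesis using M_nonzero assms by (metis eq_iff_diff_eq_0 mult_eq_0_iff)
  qed
  then show "fr a s = fr b t" using assms by (auto simp: mem_frac_iff)
qed

lemma L_carrier: "carrier L = {fr a s | a s. a \<in> S \<and> s \<in> M}"
  by (simp add: localization_def fraction_ring_def M_def)

lemma frac_carrier [simp]: "a \<in> S \<Longrightarrow> s \<in> M \<Longrightarrow> fr a s \<in> carrier L"
  by (auto simp: L_carrier)

lemma L_cases [elim?]:
  assumes "x \<in> carrier L" obtains a s where "a \<in> S" "s \<in> M" "x = fr a s"
  using assms by (auto simp: L_carrier)

lemma L_one: "\<one>\<^bsub>L\<^esub> = fr 1 1" and L_zero: "\<zero>\<^bsub>L\<^esub> = fr 0 1"
  by (simp_all add: localization_def fraction_ring_def)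

lemma L_mult:
  assumes "a \<in> S" "s \<in> M" "b \<in> S" "t \<in> M"
  shows "fr a s \<otimes>\<^bsub>L\<^esub> fr b t = fr (a * b) (s * t)"
proof -
  have "fr (a' * b') (s' * t') = fr (a * b) (s * t)"
    if "(a', s') \<in> fr a s" "(b', t') \<in> fr b t" for a' s' b' t'
  proof -
    have mem: "a' \<in> S" "b' \<in> S" "s' \<in> M" "t' \<in> M" and eq: "a * s' = a' * s" "b * t' = b' * t"
      using that assms by (auto simp: mem_frac_iff)
    have "a' * b' * (s * t) = (a' * s) * (b' * t)" by (simp add: algebra_simps)
    also have "\<dots> = a * b * (s' * t')" unfolding eq[symmetric] by (simp add: algebra_simps)
    finally show ?thesis using mem assms by (subst frac_eq_iff) auto
  qed
  then have "(\<Union>(a', s')\<in>fr a s. \<Union>(b', t')\<in>fr b t. fr (a' * b') (s' * t')) = fr (a * b) (s * t)"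
    by (rule UN_pairs_const[OF frac_self[OF assms(1,2)] frac_self[OF assms(3,4)]])
  then show ?thesis by (simp add: localization_def fraction_ring_def)
qed

lemma L_add:
  assumes "a \<in> S" "s \<in> M" "b \<in> S" "t \<in> M"
  shows "fr a s \<oplus>\<^bsub>L\<^esub> fr b t = fr (a * t + b * s) (s * t)"
proof -
  have "fr (a' * t' + b' * s') (s' * t') = fr (a * t + b * s) (s * t)"
    if "(a', s') \<in> fr a s" "(b', t') \<in> fr b t" for a' s' b' t'
  proof -
    have mem: "a' \<in> S" "b' \<in> S" "s' \<in> M" "t' \<in> M" and eq: "a * s' = a' * s" "b * t' = b' * t"
      using that assms by (auto simp: mem_frac_iff)
    have "(a' * t' + b' * s') * (s * t) = (a' * s) * (t * t') + (b' * t) * (s * s')" by (simp add: algebra_simps)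
    also have "\<dots> = (a * t + b * s) * (s' * t')" unfolding eq[symmetric] by (simp add: algebra_simps)
    finally show ?thesis using mem assms by (subst frac_eq_iff) auto
  qed
  then have "(\<Union>(a', s')\<in>fr a s. \<Union>(b', t')\<in>fr b t. fr (a' * t' + b' * s') (s' * t')) = fr (a * t + b * s) (s * t)"
    by (rule UN_pairs_const[OF frac_self[OF assms(1,2)] frac_self[OF assms(3,4)]])
  then show ?thesis by (simp add: localization_def fraction_ring_def)
qed

lemma cring_L: "cring L"
proof (intro cringI abelian_groupI comm_monoidI)
  fix x assume "x \<in> carrier L"
  then obtain a s where x: "a \<in> S" "s \<in> M" "x = fr a s" by (rule L_cases)
  show "\<exists>y\<in>carrier L. y \<oplus>\<^bsub>L\<^esub> x = \<zero>\<^bsub>L\<^esub>"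
    using x by (intro bexI[of _ "fr (- a) s"]) (simp_all add: L_add L_zero frac_eq_iff)
  show "\<one>\<^bsub>L\<^esub> \<otimes>\<^bsub>L\<^esub> x = x" "\<zero>\<^bsub>L\<^esub> \<oplus>\<^bsub>L\<^esub> x = x"
    using x by (simp_all add: L_one L_zero L_mult L_add)
next
  show "\<one>\<^bsub>L\<^esub> \<in> carrier L" "\<zero>\<^bsub>L\<^esub> \<in> carrier L" by (simp_all add: L_one L_zero)
next
  fix x y assume "x \<in> carrier L" "y \<in> carrier L"
  then obtain a s b t where x: "a \<in> S" "s \<in> M" "x = fr a s" and y: "b \<in> S" "t \<in> M" "y = fr b t"
    by (meson L_cases)
  show "x \<otimes>\<^bsub>L\<^esub> y \<in> carrier L" "x \<oplus>\<^bsub>L\<^esub> y \<in> carrier L" using x y by (simp_all add: L_mult L_add)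
  show "x \<otimes>\<^bsub>L\<^esub> y = y \<otimes>\<^bsub>L\<^esub> x" "x \<oplus>\<^bsub>L\<^esub> y = y \<oplus>\<^bsub>L\<^esub> x"
    using x y by (simp_all add: L_mult L_add algebra_simps)
next
  fix x y z assume "x \<in> carrier L" "y \<in> carrier L" "z \<in> carrier L"
  then obtain a s b t c u where x: "a \<in> S" "s \<in> M" "x = fr a s" and y: "b \<in> S" "t \<in> M" "y = fr b t"
    and z: "c \<in> S" "u \<in> M" "z = fr c u"
    by (meson L_cases)
  show "x \<otimes>\<^bsub>L\<^esub> y \<otimes>\<^bsub>L\<^esub> z = x \<otimes>\<^bsub>L\<^esub> (y \<otimes>\<^bsub>L\<^esub> z)" "x \<oplus>\<^bsub>L\<^esub> y \<oplus>\<^bsub>L\<^esub> z = x \<oplus>\<^bsub>L\<^esub> (y \<oplus>\<^bsub>L\<^esub> z)"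
    "(x \<oplus>\<^bsub>L\<^esub> y) \<otimes>\<^bsub>L\<^esub> z = x \<otimes>\<^bsub>L\<^esub> z \<oplus>\<^bsub>L\<^esub> y \<otimes>\<^bsub>L\<^esub> z"
    using x y z by (simp_all add: L_mult L_add frac_eq_iff algebra_simps)
qed

sublocale L: cring L by (rule cring_L)

text \<open>Denominators are units of the localization, so only the numerator decides
  membership.\<close>

lemma frac_in_ideal_iff:
  assumes "ideal J L" "a \<in> S" "s \<in> M"
  shows "fr a s \<in> J \<longleftrightarrow> a \<in> contraction J"
proof -
  interpret J: ideal J L by fact
  have "fr s 1 \<otimes>\<^bsub>L\<^esub> fr a s = fr a 1" "fr 1 s \<otimes>\<^bsub>L\<^esub> fr a 1 = fr a s"
    using assms(2,3) by (simp_all add: L_mult frac_eq_iff)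
  then have "fr a s \<in> J \<longleftrightarrow> fr a 1 \<in> J"
    using J.I_l_closed frac_carrier assms by (metis M_S M_one one_S)
  then show ?thesis using assms by (simp add: contraction_def)
qed

lemma ideal_contraction:
  assumes "ideal J L" shows "ideal (contraction J) R"
proof -
  interpret J: ideal J L by fact
  show ?thesis
    unfolding ideal_R_iff
  proof (intro conjI ballI)
    show "0 \<in> contraction J" using J.zero_closed by (simp add: contraction_def L_zero)
    fix x y assume y: "y \<in> contraction J"
    { assume x: "x \<in> contraction J"
      then have "fr x 1 \<oplus>\<^bsub>L\<^esub> fr y 1 \<in> J" using y by (intro J.a_closed) (auto simp: contraction_def)
      then show "x + y \<in> contraction J" using x y by (simp add: contraction_def L_add) }
    { assume x: "x \<in> S"
      then have "fr x 1 \<otimes>\<^bsub>L\<^esub> fr y 1 \<in> J" using y by (intro J.I_l_closed) (auto simp: contraction_def)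
      then show "x * y \<in> contraction J" using x y by (simp add: contraction_def L_mult) }
  qed (auto simp: contraction_def)
qed

lemma mem_ext: "x \<in> ext I \<longleftrightarrow> (\<exists>a s. a \<in> I \<and> s \<in> M \<and> x = fr a s)"
  by (auto simp: localized_ideal_def M_def)

text \<open>The multiplier \<open>t\<close> accounts for ideals that are not prime; for primes
  inside \<open>P\<close> it can be cancelled, as in \<open>contraction_ext\<close>.\<close>

lemma frac_mem_ext_iff:
  assumes "ideal I R" "a \<in> S" "s \<in> M"
  shows "fr a s \<in> ext I \<longleftrightarrow> (\<exists>t\<in>M. t * a \<in> I)"
proof
  have I: "I \<subseteq> S" and I_mult: "\<And>x y. x \<in> S \<Longrightarrow> y \<in> I \<Longrightarrow> x * y \<in> I"
    using assms(1) by (auto simp: ideal_R_iff)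
  { assume "fr a s \<in> ext I"
    then obtain b t where bt: "b \<in> I" "t \<in> M" "fr a s = fr b t" by (auto simp: mem_ext)
    then have "a * t = b * s" using assms I by (subst (asm) frac_eq_iff) auto
    then have "t * a = s * b" by (simp add: algebra_simps)
    then show "\<exists>t\<in>M. t * a \<in> I" using bt I_mult assms(3) by (metis M_S) }
  { assume "\<exists>t\<in>M. t * a \<in> I"
    then obtain t where t: "t \<in> M" "t * a \<in> I" by blast
    then have "fr a s = fr (t * a) (t * s)" using assms by (subst frac_eq_iff) auto
    then show "fr a s \<in> ext I" using t assms(3) M_mult unfolding mem_ext by blast }
qed

lemma ideal_ext:
  assumes "ideal I R" shows "ideal (ext I) L"
proof (rule idealI[OF L.ring_axioms])
  have I: "I \<subseteq> S" "0 \<in> I" and I_add: "\<And>x y. x \<in> I \<Longrightarrow> y \<in> I \<Longrightarrow> x + y \<in> I"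
    and I_mult: "\<And>x y. x \<in> S \<Longrightarrow> y \<in> I \<Longrightarrow> x * y \<in> I"
    using assms by (auto simp: ideal_R_iff)
  have mult: "x \<otimes>\<^bsub>L\<^esub> y \<in> ext I" if xy: "x \<in> carrier L" "y \<in> ext I" for x y
  proof -
    obtain a s b t where "a \<in> S" "s \<in> M" "x = fr a s" "b \<in> I" "t \<in> M" "y = fr b t"
      using xy by (meson L_cases mem_ext)
    then have "x \<otimes>\<^bsub>L\<^esub> y = fr (a * b) (s * t)" "a * b \<in> I" "s * t \<in> M"
      using I I_mult by (auto simp: L_mult subset_iff)
    then show ?thesis unfolding mem_ext by blast
  qed
  have sub: "ext I \<subseteq> carrier L"
  proof
    fix x assume "x \<in> ext I"
    then obtain a s where "a \<in> I" "s \<in> M" "x = fr a s" unfolding mem_ext by blast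
    then show "x \<in> carrier L" using I(1) frac_carrier by blast
  qed
  show "subgroup (ext I) (add_monoid L)"
  proof (rule L.add.subgroupI[OF sub])
    show "ext I \<noteq> {}" using I(2) M_one mem_ext by blast
    fix x assume x: "x \<in> ext I"
    have "\<ominus>\<^bsub>L\<^esub> x = (\<ominus>\<^bsub>L\<^esub> \<one>\<^bsub>L\<^esub>) \<otimes>\<^bsub>L\<^esub> x" using x sub by (subst L.l_minus) auto
    then show "\<ominus>\<^bsub>L\<^esub> x \<in> ext I" using mult x by simp
    fix y assume y: "y \<in> ext I"
    obtain a s b t where ab: "a \<in> I" "s \<in> M" "x = fr a s" "b \<in> I" "t \<in> M" "y = fr b t"
      using x y unfolding mem_ext by blast
    then have "a * t + b * s \<in> I"
      using I_add I_mult M_S by (metis mult.commute)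
    moreover have "x \<oplus>\<^bsub>L\<^esub> y = fr (a * t + b * s) (s * t)" "s * t \<in> M"
      using ab I(1) by (auto simp: L_add subset_iff)
    ultimately show "x \<oplus>\<^bsub>L\<^esub> y \<in> ext I" unfolding mem_ext by blast
  qed
  fix a x assume "a \<in> ext I" "x \<in> carrier L"
  then show "x \<otimes>\<^bsub>L\<^esub> a \<in> ext I" "a \<otimes>\<^bsub>L\<^esub> x \<in> ext I"
    using mult L.m_comm[of a x] sub by auto
qed

lemma ext_contraction:
  assumes "ideal J L" shows "ext (contraction J) = J"
proof
  interpret J: ideal J L by fact
  show "ext (contraction J) \<subseteq> J"
  proof
    fix x assume "x \<in> ext (contraction J)"
    then obtain a s where x: "a \<in> contraction J" "s \<in> M" "x = fr a s" unfolding mem_ext by blast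
    then have "a \<in> S" by (simp add: contraction_def)
    then show "x \<in> J" using x frac_in_ideal_iff[OF assms] by simp
  qed
  show "J \<subseteq> ext (contraction J)"
  proof
    fix x assume x: "x \<in> J"
    from J.Icarr[OF this] obtain a s where as: "a \<in> S" "s \<in> M" "x = fr a s" by (rule L_cases)
    then have "a \<in> contraction J" using x frac_in_ideal_iff[OF assms] by simp
    then show "x \<in> ext (contraction J)" using as mem_ext by blast
  qed
qed

lemma prime_contraction:
  assumes "primeideal J L"
  shows "primeideal (contraction J) R" "contraction J \<subseteq> P"
proof -
  interpret J: primeideal J L by fact
  have one: "fr 1 1 \<notin> J" using J.one_imp_carrier J.I_notcarr by (auto simp: L_one)
  show "primeideal (contraction J) R"
    unfolding primeideal_R_iff
  proof (intro conjI ballI impI)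
    show "ideal (contraction J) R" using J.is_ideal by (rule ideal_contraction)
    show "1 \<notin> contraction J" using one by (simp add: contraction_def)
    fix a b assume ab: "a \<in> S" "b \<in> S" "a * b \<in> contraction J"
    then have "fr a 1 \<otimes>\<^bsub>L\<^esub> fr b 1 \<in> J" by (simp add: contraction_def L_mult)
    then have "fr a 1 \<in> J \<or> fr b 1 \<in> J" using ab by (intro J.I_prime) auto
    then show "a \<in> contraction J \<or> b \<in> contraction J" using ab by (auto simp: contraction_def)
  qed
  show "contraction J \<subseteq> P"
  proof
    fix s assume s: "s \<in> contraction J"
    show "s \<in> P"
    proof (rule ccontr)
      assume "s \<notin> P"
      then have M: "s \<in> M" using s by (auto simp: M_def contraction_def)
      then have "fr 1 s \<otimes>\<^bsub>L\<^esub> fr s 1 = fr 1 1" by (simp add: L_mult frac_eq_iff)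
      moreover have "fr 1 s \<otimes>\<^bsub>L\<^esub> fr s 1 \<in> J" using s M by (intro J.I_l_closed) (auto simp: contraction_def)
      ultimately show False using one by simp
    qed
  qed
qed

lemma contraction_ext:
  assumes Q: "primeideal Q R" "Q \<subseteq> P"
  shows "contraction (ext Q) = Q"
proof -
  have Q': "Q \<subseteq> S" "ideal Q R" using Q by (auto simp: primeideal_R_iff ideal_R_iff)
  have "(\<exists>t\<in>M. t * a \<in> Q) \<longleftrightarrow> a \<in> Q" if "a \<in> S" for a
    using Q that M_one unfolding primeideal_R_iff by (metis DiffD2 M_S M_def mult_1 subsetD)
  then have "fr a 1 \<in> ext Q \<longleftrightarrow> a \<in> Q" if "a \<in> S" for a
    using frac_mem_ext_iff[OF Q'(2) that M_one] that by simp
  then show ?thesis using Q'(1) unfolding contraction_def by blast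
qed

lemma prime_ext:
  assumes Q: "primeideal Q R" "Q \<subseteq> P"
  shows "primeideal (ext Q) L"
proof (rule primeidealI)
  have Q': "ideal Q R" "1 \<notin> Q" and Q_prime: "\<And>a b. a \<in> S \<Longrightarrow> b \<in> S \<Longrightarrow> a * b \<in> Q \<Longrightarrow> a \<in> Q \<or> b \<in> Q"
    using Q by (auto simp: primeideal_R_iff)
  show I: "ideal (ext Q) L" using Q'(1) by (rule ideal_ext)
  show "cring L" by (rule cring_L)
  have mem: "fr a s \<in> ext Q \<longleftrightarrow> a \<in> Q" if "a \<in> S" "s \<in> M" for a s
    using frac_in_ideal_iff[OF I that] contraction_ext[OF Q] by simp
  have "fr 1 1 \<notin> ext Q" "fr 1 1 \<in> carrier L" using mem[OF one_S M_one] Q'(2) by simp_all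
  then show "carrier L \<noteq> ext Q" by metis
  fix x y assume xy: "x \<in> carrier L" "y \<in> carrier L" "x \<otimes>\<^bsub>L\<^esub> y \<in> ext Q"
  then obtain a s b t where "a \<in> S" "s \<in> M" "x = fr a s" "b \<in> S" "t \<in> M" "y = fr b t"
    by (meson L_cases)
  then show "x \<in> ext Q \<or> y \<in> ext Q" using xy(3) mem Q_prime by (simp add: L_mult)
qed

lemma chain_mono:
  assumes "\<And>i. i < k \<Longrightarrow> C i \<subset> C (Suc i)" "i \<le> k"
  shows "C i \<subseteq> (C k :: 'b set)"
proof -
  have "C i \<subseteq> C j" if "i \<le> j" "j \<le> k" for j
    using that
  proof (induction j rule: dec_induct)
    case (step j)
    then have "C i \<subseteq> C j" "C j \<subset> C (Suc j)" using assms(1)[of j] by simp_all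
    then show ?case by blast
  qed simp
  then show ?thesis using assms(2) by blast
qed

text \<open>Contraction and extension are inverse to each other between the primes of the
  localization and the primes inside \<open>P\<close>, so they carry strict chains below
  \<open>ext Q\<close> to strict chains below \<open>Q\<close> and back.\<close>

lemma prime_height_ext:
  assumes Q: "primeideal Q R" "Q \<subseteq> P"
  shows "prime_height L (ext Q) = prime_height R Q"
proof -
  have "(\<exists>C. (\<forall>i\<le>k. primeideal (C i) L) \<and> (\<forall>i<k. C i \<subset> C (Suc i)) \<and> C k = ext Q) \<longleftrightarrow>
        (\<exists>C. (\<forall>i\<le>k. primeideal (C i) R) \<and> (\<forall>i<k. C i \<subset> C (Suc i)) \<and> C k = Q)" for k :: nat
  proof
    assume "\<exists>C. (\<forall>i\<le>k. primeideal (C i) L) \<and> (\<forall>i<k. C i \<subset> C (Suc i)) \<and> C k = ext Q"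
    then obtain C where C: "\<And>i. i \<le> k \<Longrightarrow> primeideal (C i) L" "\<And>i. i < k \<Longrightarrow> C i \<subset> C (Suc i)" "C k = ext Q"
      by blast
    have idl: "ideal (C i) L" if "i \<le> k" for i using C(1)[OF that] by (rule primeideal.axioms(1))
    have "contraction (C i) \<subset> contraction (C (Suc i))" if "i < k" for i
    proof -
      have "ext (contraction (C i)) = C i" "ext (contraction (C (Suc i))) = C (Suc i)"
        using ext_contraction[OF idl] that by simp_all
      then have "contraction (C i) = contraction (C (Suc i)) \<Longrightarrow> C i = C (Suc i)" by metis
      then have "contraction (C i) \<noteq> contraction (C (Suc i))" using C(2)[OF that] by blast
      moreover have "contraction (C i) \<subseteq> contraction (C (Suc i))"
        using C(2)[OF that] unfolding contraction_def by blast
      ultimately show ?thesis by blast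
    qed
    moreover have "contraction (C k) = Q" using C(3) contraction_ext[OF Q] by simp
    ultimately show "\<exists>C. (\<forall>i\<le>k. primeideal (C i) R) \<and> (\<forall>i<k. C i \<subset> C (Suc i)) \<and> C k = Q"
      using prime_contraction(1)[OF C(1)] by (intro exI[of _ "\<lambda>i. contraction (C i)"]) blast
  next
    assume "\<exists>C. (\<forall>i\<le>k. primeideal (C i) R) \<and> (\<forall>i<k. C i \<subset> C (Suc i)) \<and> C k = Q"
    then obtain C where C: "\<And>i. i \<le> k \<Longrightarrow> primeideal (C i) R" "\<And>i. i < k \<Longrightarrow> C i \<subset> C (Suc i)" "C k = Q"
      by blast
    have CP: "C i \<subseteq> P" if "i \<le> k" for i using chain_mono[of k C i] C that Q(2) by blast
    have "ext (C i) \<subset> ext (C (Suc i))" if "i < k" for i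
    proof -
      have "contraction (ext (C i)) = C i" "contraction (ext (C (Suc i))) = C (Suc i)"
        using contraction_ext[OF C(1) CP] that by simp_all
      then have "ext (C i) = ext (C (Suc i)) \<Longrightarrow> C i = C (Suc i)" by metis
      then have "ext (C i) \<noteq> ext (C (Suc i))" using C(2)[OF that] by blast
      moreover have "ext (C i) \<subseteq> ext (C (Suc i))"
        using C(2)[OF that] unfolding localized_ideal_def by blast
      ultimately show ?thesis by blast
    qed
    then show "\<exists>C. (\<forall>i\<le>k. primeideal (C i) L) \<and> (\<forall>i<k. C i \<subset> C (Suc i)) \<and> C k = ext Q"
      using prime_ext[OF C(1) CP] C(3) by (intro exI[of _ "\<lambda>i. ext (C i)"]) blast
  qed
  then show ?thesis unfolding prime_height_def by simp
qed

text \<open>A prime over \<open>ext I\<close> contracts to a prime between \<open>I\<close> and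
  \<open>P\<close>, hence to \<open>P\<close> itself. The infimum defining the height therefore runs
  over a single value.\<close>

lemma height_ext_minimal_prime:
  assumes "ideal I R" "P \<in> minimal_primes R I"
  shows "height L (ext I) = prime_height R P"
proof -
  have IP: "I \<subseteq> P" and min: "\<And>Q. primeideal Q R \<Longrightarrow> I \<subseteq> Q \<Longrightarrow> Q \<subseteq> P \<Longrightarrow> Q = P"
    using assms(2) by (auto simp: minimal_primes_def)
  have "primeideal J L \<and> ext I \<subseteq> J \<longleftrightarrow> J = ext P" for J
  proof
    assume J: "primeideal J L \<and> ext I \<subseteq> J"
    then have "a \<in> contraction J" if "a \<in> I" for a
    proof -
      have "fr a 1 \<in> ext I" using that M_one mem_ext by blast
      then show ?thesis using that J assms(1) unfolding contraction_def ideal_R_iff by blast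
    qed
    then have "I \<subseteq> contraction J" by blast
    then have "contraction J = P" using prime_contraction[of J] J min by blast
    then show "J = ext P" using ext_contraction[of J] J primeideal.axioms(1)[of J L] by simp
  next
    assume "J = ext P"
    then show "primeideal J L \<and> ext I \<subseteq> J"
      using prime_ext[OF prime_P] IP unfolding localized_ideal_def by blast
  qed
  then have "{prime_height L J | J. primeideal J L \<and> ext I \<subseteq> J} = {prime_height L (ext P)}" by auto
  then show ?thesis using prime_height_ext[OF prime_P] by (simp add: height_def)
qed

text \<open>The multipliers become units, so each set lies in the extended ideal of the other. In
  the application \<open>F\<close> consists of the edge generators and \<open>G\<close> of the
  generators of a kernel.\<close>

lemma Idl_fractions_eq_ext:
  assumes G: "G \<subseteq> S" "\<And>g. g \<in> G \<Longrightarrow> \<exists>s\<in>M. s * g \<in> Idl\<^bsub>R\<^esub> F"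
    and F: "F \<subseteq> S" "\<And>f. f \<in> F \<Longrightarrow> \<exists>s\<in>M. s * f \<in> Idl\<^bsub>R\<^esub> G"
  shows "Idl\<^bsub>L\<^esub> ((\<lambda>g. fr g 1) ` G) = ext (Idl\<^bsub>R\<^esub> F)"
proof
  have idF: "ideal (Idl\<^bsub>R\<^esub> F) R" using R.genideal_ideal F(1) by simp
  have sub: "(\<lambda>g. fr g 1) ` G \<subseteq> carrier L" using G(1) by auto
  have "(\<lambda>g. fr g 1) ` G \<subseteq> ext (Idl\<^bsub>R\<^esub> F)"
    using G frac_mem_ext_iff[OF idF _ M_one] by blast
  then show "Idl\<^bsub>L\<^esub> ((\<lambda>g. fr g 1) ` G) \<subseteq> ext (Idl\<^bsub>R\<^esub> F)"
    using L.genideal_minimal[OF ideal_ext[OF idF]] by blast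
  define J where "J = Idl\<^bsub>L\<^esub> ((\<lambda>g. fr g 1) ` G)"
  have J: "ideal J L" unfolding J_def using sub by (rule L.genideal_ideal)
  have "(\<lambda>g. fr g 1) ` G \<subseteq> J" unfolding J_def using sub by (rule L.genideal_self)
  then have "G \<subseteq> contraction J" using G(1) by (auto simp: contraction_def)
  then have GJ: "Idl\<^bsub>R\<^esub> G \<subseteq> contraction J" using Idl_subset_iff[OF G(1) ideal_contraction[OF J]] by simp
  have "F \<subseteq> contraction J"
  proof
    fix f assume f: "f \<in> F"
    then have fS: "f \<in> S" using F(1) by auto
    obtain s where s: "s \<in> M" "s * f \<in> contraction J" using F(2)[OF f] GJ by blast
    have "fr f 1 = fr (s * f) s" using s fS by (simp add: frac_eq_iff)
    then have "fr f 1 \<in> J" using frac_in_ideal_iff[OF J, of "s * f" s] s fS by simp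
    then show "f \<in> contraction J" using fS by (simp add: contraction_def)
  qed
  then have "Idl\<^bsub>R\<^esub> F \<subseteq> contraction J" using Idl_subset_iff[OF F(1) ideal_contraction[OF J]] by simp
  then have "ext (Idl\<^bsub>R\<^esub> F) \<subseteq> ext (contraction J)" unfolding localized_ideal_def by blast
  then show "ext (Idl\<^bsub>R\<^esub> F) \<subseteq> Idl\<^bsub>L\<^esub> ((\<lambda>g. fr g 1) ` G)" using ext_contraction[OF J] by (simp add: J_def)
qed

text \<open>Brings generation in the localization back to polynomials by taking numerators and
  clearing denominators. In this form a generating set can be differentiated, which is how its size
  is bounded from below.\<close>

lemma generators_of_ext:
  assumes I: "ideal I R" and A: "finite A" "A \<subseteq> carrier L" "Idl\<^bsub>L\<^esub> A = ext I"
  obtains a where "\<And>\<alpha>. \<alpha> \<in> A \<Longrightarrow> a \<alpha> \<in> I"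
    "\<And>f. f \<in> S \<Longrightarrow> (\<exists>s\<in>M. s * f \<in> I) \<Longrightarrow>
       \<exists>s\<in>M. \<exists>c. (\<forall>\<alpha>\<in>A. c \<alpha> \<in> S) \<and> s * f = (\<Sum>\<alpha>\<in>A. c \<alpha> * a \<alpha>)"
proof -
  have IS: "I \<subseteq> S" using I by (simp add: ideal_R_iff)
  have "A \<subseteq> ext I" using L.genideal_self[OF A(2)] A(3) by simp
  then have "\<forall>\<alpha>\<in>A. \<exists>x s. x \<in> I \<and> s \<in> M \<and> \<alpha> = fr x s" using mem_ext by blast
  then obtain a s where as: "\<And>\<alpha>. \<alpha> \<in> A \<Longrightarrow> a \<alpha> \<in> I \<and> s \<alpha> \<in> M \<and> \<alpha> = fr (a \<alpha>) (s \<alpha>)" by metis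
  \<comment> \<open>The polynomials that are combinations of the numerators up to a multiplier form
    an ideal; its extension contains all generators, hence all of \<open>ext I\<close>.\<close>
  define N where "N = {f \<in> S. \<exists>s\<in>M. \<exists>c. (\<forall>\<alpha>\<in>A. c \<alpha> \<in> S) \<and> s * f = (\<Sum>\<alpha>\<in>A. c \<alpha> * a \<alpha>)}"
  have N: "ideal N R"
    unfolding ideal_R_iff
  proof (intro conjI ballI)
    show "N \<subseteq> S" by (auto simp: N_def)
    show "0 \<in> N" unfolding N_def by (intro CollectI conjI bexI[OF _ M_one] exI[of _ "\<lambda>_. 0"]) auto
    fix x y assume y: "y \<in> N"
    then obtain t d where td: "y \<in> S" "t \<in> M" "\<forall>\<alpha>\<in>A. d \<alpha> \<in> S" "t * y = (\<Sum>\<alpha>\<in>A. d \<alpha> * a \<alpha>)"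
      by (auto simp: N_def)
    { assume x: "x \<in> N"
      then obtain s c where sc: "x \<in> S" "s \<in> M" "\<forall>\<alpha>\<in>A. c \<alpha> \<in> S" "s * x = (\<Sum>\<alpha>\<in>A. c \<alpha> * a \<alpha>)"
        by (auto simp: N_def)
      have "(s * t) * (x + y) = t * (s * x) + s * (t * y)" by (simp add: algebra_simps)
      also have "\<dots> = (\<Sum>\<alpha>\<in>A. (t * c \<alpha> + s * d \<alpha>) * a \<alpha>)"
        unfolding sc(4) td(4) by (simp add: sum_distrib_left sum.distrib[symmetric] algebra_simps)
      finally show "x + y \<in> N"
        using sc td unfolding N_def
        by (intro CollectI conjI bexI[of _ "s * t"] exI[of _ "\<lambda>\<alpha>. t * c \<alpha> + s * d \<alpha>"]) simp_all }
    { assume x: "x \<in> S"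
      have "t * (x * y) = (\<Sum>\<alpha>\<in>A. (x * d \<alpha>) * a \<alpha>)"
        using td(4) by (simp add: mult.left_commute[of t x] sum_distrib_left algebra_simps)
      then show "x * y \<in> N"
        using td x unfolding N_def
        by (intro CollectI conjI bexI[of _ t] exI[of _ "\<lambda>\<alpha>. x * d \<alpha>"]) simp_all }
  qed
  have "a \<alpha> \<in> N" if \<alpha>: "\<alpha> \<in> A" for \<alpha>
  proof -
    have "1 * a \<alpha> = (\<Sum>\<beta>\<in>A. (if \<beta> = \<alpha> then 1 else 0) * a \<beta>)"
      using \<alpha> A(1) by (simp add: if_distrib[of "\<lambda>x. x * _"] cong: if_cong)
    then show ?thesis unfolding N_def using as[OF \<alpha>] IS
      by (intro CollectI conjI bexI[of _ 1] exI[of _ "\<lambda>\<beta>. if \<beta> = \<alpha> then 1 else 0"]) auto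
  qed
  then have aN: "\<And>\<alpha>. \<alpha> \<in> A \<Longrightarrow> a \<alpha> \<in> N" .
  have "A \<subseteq> ext N"
  proof
    fix \<alpha> assume "\<alpha> \<in> A"
    then have "a \<alpha> \<in> N \<and> s \<alpha> \<in> M \<and> \<alpha> = fr (a \<alpha>) (s \<alpha>)" using as aN by simp
    then show "\<alpha> \<in> ext N" unfolding mem_ext by (intro exI[of _ "a \<alpha>"] exI[of _ "s \<alpha>"])
  qed
  then have sub: "ext I \<subseteq> ext N" using L.genideal_minimal[OF ideal_ext[OF N]] A(3) by blast
  show thesis
  proof (rule that)
    show "a \<alpha> \<in> I" if "\<alpha> \<in> A" for \<alpha> using as that by blast
    fix f assume f: "f \<in> S" "\<exists>s\<in>M. s * f \<in> I"
    then have "fr f 1 \<in> ext N" using frac_mem_ext_iff[OF I f(1) M_one] sub by blast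
    then obtain t where t: "t \<in> M" "t * f \<in> N" using frac_mem_ext_iff[OF N f(1) M_one] by blast
    then obtain u c where "u \<in> M" "\<forall>\<alpha>\<in>A. c \<alpha> \<in> S" "u * (t * f) = (\<Sum>\<alpha>\<in>A. c \<alpha> * a \<alpha>)"
      by (auto simp: N_def)
    then show "\<exists>s\<in>M. \<exists>c. (\<forall>\<alpha>\<in>A. c \<alpha> \<in> S) \<and> s * f = (\<Sum>\<alpha>\<in>A. c \<alpha> * a \<alpha>)"
      using t(1) by (intro bexI[of _ "u * t"] exI[of _ c]) (auto simp: mult.assoc)
  qed
qed

end

section \<open>Polynomials\<close>

text \<open>An order on the variables induces one on the monomials, and comparing leading monomials
  excludes zero divisors. This makes the polynomial type an \<open>idom\<close>, as the locale
  \<open>subdomain_carrier\<close> requires.\<close>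

instantiation lss_var :: linorder
begin

fun var_code :: "lss_var \<Rightarrow> nat" where
  "var_code (VX i) = 2 * i"
| "var_code (VY i) = 2 * i + 1"

definition less_eq_lss_var :: "lss_var \<Rightarrow> lss_var \<Rightarrow> bool" where
  "less_eq_lss_var v w \<longleftrightarrow> var_code v \<le> var_code w"

definition less_lss_var :: "lss_var \<Rightarrow> lss_var \<Rightarrow> bool" where
  "less_lss_var v w \<longleftrightarrow> var_code v < var_code w"

instance
proof
  fix u v w :: lss_var
  have inj: "v = w" if "var_code v = var_code w"
    using that by (cases v; cases w) (simp_all, presburger+)
  show "v \<le> w \<Longrightarrow> w \<le> v \<Longrightarrow> v = w"
    unfolding less_eq_lss_var_def by (rule inj) (rule le_antisym)
  show "v < w \<longleftrightarrow> v \<le> w \<and> \<not> w \<le> v" "v \<le> v" "v \<le> w \<or> w \<le> v"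
    unfolding less_eq_lss_var_def less_lss_var_def by linarith+
  show "u \<le> v \<Longrightarrow> v \<le> w \<Longrightarrow> u \<le> w"
    unfolding less_eq_lss_var_def by linarith
qed

end

abbreviation lookup where "lookup \<equiv> Poly_Mapping.lookup"
abbreviation keys where "keys \<equiv> Poly_Mapping.keys"
abbreviation single where "single \<equiv> Poly_Mapping.single"

definition Const :: "'k::field \<Rightarrow> 'k lss_poly" where
  "Const c = single 0 c"

lemma Const_simps [simp]: "Const 0 = 0" "Const 1 = 1" "Const (a + b) = Const a + Const b"
  "Const (a * b) = Const a * Const b" "Const (- a) = - Const a"
  by (simp_all add: Const_def single_add mult_single single_uminus)

lemma Const_sum: "Const (sum f A) = (\<Sum>i\<in>A. Const (f i))"
  by (induction A rule: infinite_finite_induct) auto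

lemma Const_eq_0_iff [simp]: "Const c = 0 \<longleftrightarrow> c = 0"
  by (metis Const_def lookup_single_eq lookup_zero single_zero)

lemma poly_mapping_expand: "p = (\<Sum>m\<in>keys p. single m (lookup p m))"
proof (rule poly_mapping_eqI)
  fix m
  have "lookup (\<Sum>m\<in>keys p. single m (lookup p m)) m = (\<Sum>m'\<in>keys p. if m' = m then lookup p m' else 0)"
    by (simp add: lookup_sum lookup_single when_def)
  also have "\<dots> = lookup p m" by (simp add: in_keys_iff)
  finally show "lookup p m = lookup (\<Sum>m\<in>keys p. single m (lookup p m)) m" ..
qed

lemma lookup_Const_mult: "lookup (Const a * p) m = a * lookup p m"
proof -
  have "Const a * p = (\<Sum>m\<in>keys p. single m (a * lookup p m))"
    by (subst (1) poly_mapping_expand[of p]) (simp add: Const_def sum_distrib_left mult_single)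
  then have "lookup (Const a * p) m = (\<Sum>m'\<in>keys p. if m' = m then a * lookup p m' else 0)"
    by (simp add: lookup_sum lookup_single when_def)
  also have "\<dots> = a * lookup p m" by (simp add: in_keys_iff)
  finally show ?thesis .
qed

section \<open>Substitution homomorphisms\<close>

definition monom_val :: "('v \<Rightarrow> 'b::comm_ring_1) \<Rightarrow> ('v \<Rightarrow>\<^sub>0 nat) \<Rightarrow> 'b" where
  "monom_val \<sigma> m = (\<Prod>v\<in>keys m. \<sigma> v ^ lookup m v)"

lemma monom_val_superset:
  "finite A \<Longrightarrow> keys m \<subseteq> A \<Longrightarrow> monom_val \<sigma> m = (\<Prod>v\<in>A. \<sigma> v ^ lookup m v)"
  unfolding monom_val_def by (rule prod.mono_neutral_left) (auto simp: in_keys_iff)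

lemma monom_val_add: "monom_val \<sigma> (m + m') = monom_val \<sigma> m * monom_val \<sigma> m'"
proof -
  let ?A = "keys m \<union> keys m'"
  have "keys (m + m') \<subseteq> ?A" by (rule keys_add)
  then show ?thesis
    by (simp add: monom_val_superset[of ?A] lookup_add power_add prod.distrib)
qed

lemma monom_val_0 [simp]: "monom_val \<sigma> 0 = 1" by (simp add: monom_val_def)

lemma monom_val_single [simp]: "monom_val \<sigma> (single v k) = \<sigma> v ^ k"
  by (simp add: monom_val_def)

text \<open>The coefficient map \<open>h\<close> is a parameter because there are two kinds of
  target: the polynomial type itself for parametrizations, and a polynomial ring over it for
  derivatives.\<close>

definition subst :: "('k::field \<Rightarrow> 'b::comm_ring_1) \<Rightarrow> (lss_var \<Rightarrow> 'b) \<Rightarrow> 'k lss_poly \<Rightarrow> 'b" where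
  "subst h \<sigma> p = (\<Sum>m\<in>keys p. h (lookup p m) * monom_val \<sigma> m)"

locale coeff_hom =
  fixes h :: "'k::field \<Rightarrow> 'b::comm_ring_1"
  assumes h_0 [simp]: "h 0 = 0" and h_1 [simp]: "h 1 = 1" and h_add: "h (a + b) = h a + h b"
    and h_mult: "h (a * b) = h a * h b"
begin

lemma subst_superset:
  "finite A \<Longrightarrow> keys p \<subseteq> A \<Longrightarrow> subst h \<sigma> p = (\<Sum>m\<in>A. h (lookup p m) * monom_val \<sigma> m)"
  unfolding subst_def by (rule sum.mono_neutral_left) (auto simp: in_keys_iff)

lemma subst_0 [simp]: "subst h \<sigma> 0 = 0" by (simp add: subst_def)

lemma subst_add [simp]: "subst h \<sigma> (p + q) = subst h \<sigma> p + subst h \<sigma> q"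
proof -
  let ?A = "keys p \<union> keys q"
  have "keys (p + q) \<subseteq> ?A" by (rule keys_add)
  then show ?thesis
    by (simp add: subst_superset[of ?A] lookup_add h_add distrib_right sum.distrib)
qed

lemma subst_sum [simp]: "subst h \<sigma> (sum f A) = (\<Sum>i\<in>A. subst h \<sigma> (f i))"
  by (induction A rule: infinite_finite_induct) auto

lemma subst_single [simp]: "subst h \<sigma> (single m a) = h a * monom_val \<sigma> m"
  by (simp add: subst_def)

lemma subst_mult [simp]: "subst h \<sigma> (p * q) = subst h \<sigma> p * subst h \<sigma> q"
proof -
  have "p * q = (\<Sum>m\<in>keys p. \<Sum>m'\<in>keys q. single (m + m') (lookup p m * lookup q m'))"
    by (subst poly_mapping_expand[of p], subst poly_mapping_expand[of q])
      (simp only: sum_product mult_single)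
  then have "subst h \<sigma> (p * q) = (\<Sum>m\<in>keys p. \<Sum>m'\<in>keys q. h (lookup p m * lookup q m') * monom_val \<sigma> (m + m'))"
    by simp
  also have "\<dots> = subst h \<sigma> p * subst h \<sigma> q"
    unfolding subst_def sum_product by (simp add: h_mult monom_val_add algebra_simps)
  finally show ?thesis .
qed

lemma subst_Const [simp]: "subst h \<sigma> (Const c) = h c" by (simp add: Const_def)

lemma subst_var [simp]: "subst h \<sigma> (var_poly v) = \<sigma> v" by (simp add: var_poly_def)

lemma subst_1 [simp]: "subst h \<sigma> 1 = 1" using subst_Const[of \<sigma> 1] by simp

lemma subst_uminus [simp]: "subst h \<sigma> (- p) = - subst h \<sigma> p"
  using subst_add[of \<sigma> p "- p"] by (simp add: eq_neg_iff_add_eq_0 add.commute)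

lemma subst_diff [simp]: "subst h \<sigma> (p - q) = subst h \<sigma> p - subst h \<sigma> q"
  using subst_add[of \<sigma> p "- q"] by simp

end

interpretation Const: coeff_hom Const by unfold_locales simp_all

lemma monom_val_var: "monom_val var_poly m = single m 1"
proof -
  have *: "var_poly v ^ k = single (single v k) 1" for v and k
    by (induction k) (simp_all add: var_poly_def mult_single single_add[symmetric])
  have "(\<Prod>v\<in>A. var_poly v ^ lookup m v) = single (\<Sum>v\<in>A. single v (lookup m v)) 1" if "finite A" for A
    using that by (induction A) (simp_all add: * mult_single)
  from this[of "keys m"] show ?thesis
    unfolding monom_val_def using poly_mapping_expand[of m] by simp
qed

lemma subst_var_poly: "subst Const var_poly p = p"
  by (simp add: subst_def Const_def monom_val_var mult_single poly_mapping_expand[symmetric])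

section \<open>The polynomial ring as a subring\<close>

abbreviation S where "S n \<equiv> carrier (poly_S n)"

lemma S_iff: "p \<in> S n \<longleftrightarrow> (\<forall>m\<in>keys p. \<forall>v\<in>keys m. var_index v \<in> {1..n})"
  by (simp add: poly_S_def)

lemma class_ring_S [simp]: "class_ring (S n) = poly_S n"
  by (simp add: poly_S_def class_ring_def)

lemma Const_S [simp]: "Const c \<in> S n"
  by (simp add: S_iff Const_def)

lemma var_S [simp]: "var_poly v \<in> S n \<longleftrightarrow> var_index v \<in> {1..n}"
  by (simp add: S_iff var_poly_def)

interpretation S: subdomain_carrier "S n :: 'k::field lss_poly set" for n
proof
  show "0 \<in> S n" "1 \<in> S n" by (simp_all add: S_iff)
  fix p q :: "'k lss_poly" assume pq: "p \<in> S n" "q \<in> S n"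
  show "p + q \<in> S n" using pq keys_add[of p q] unfolding S_iff by blast
  show "- p \<in> S n" using pq by (simp add: S_iff)
  show "p * q \<in> S n"
    unfolding S_iff
  proof (intro ballI)
    fix m v assume m: "m \<in> keys (p * q)" and v: "v \<in> keys m"
    obtain a b where "m = a + b" "a \<in> keys p" "b \<in> keys q" using m keys_mult[of p q] by blast
    then show "var_index v \<in> {1..n}" using pq v keys_add[of a b] unfolding S_iff by blast
  qed
qed

lemmas ideal_S_iff = S.ideal_R_iff[unfolded class_ring_S]
  and primeideal_S_iff = S.primeideal_R_iff[unfolded class_ring_S]
  and Idl_S_subset_iff = S.Idl_subset_iff[unfolded class_ring_S]

lemma ideal_sum:
  "ideal I (poly_S n) \<Longrightarrow> (\<And>i. i \<in> A \<Longrightarrow> f i \<in> I) \<Longrightarrow> sum f A \<in> I"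
  unfolding ideal_S_iff by (induction A rule: infinite_finite_induct) auto

lemma S_induct [consumes 1, case_names Const var add mult]:
  fixes p :: "'k::field lss_poly"
  assumes p: "p \<in> S n" and c: "\<And>c. Q (Const c)" and v: "\<And>v. var_index v \<in> {1..n} \<Longrightarrow> Q (var_poly v)"
    and a: "\<And>p q. p \<in> S n \<Longrightarrow> q \<in> S n \<Longrightarrow> Q p \<Longrightarrow> Q q \<Longrightarrow> Q (p + q)"
    and m: "\<And>p q. p \<in> S n \<Longrightarrow> q \<in> S n \<Longrightarrow> Q p \<Longrightarrow> Q q \<Longrightarrow> Q (p * q)"
  shows "Q p"
proof -
  have one: "Q 1" using c[of 1] by simp
  have pow: "Q (var_poly v ^ k) \<and> (var_poly v ^ k :: 'k lss_poly) \<in> S n" if "var_index v \<in> {1..n}" for v k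
  proof (induction k)
    case (Suc k)
    have "Q (var_poly v * var_poly v ^ k)" by (rule m) (use Suc v that in simp_all)
    then show ?case using Suc that by simp
  qed (use one in simp)
  have mon: "Q (monom_val var_poly m) \<and> (monom_val var_poly m :: 'k lss_poly) \<in> S n" if mv: "\<forall>v\<in>keys m. var_index v \<in> {1..n}" for m
  proof -
    have "Q (\<Prod>v\<in>A. var_poly v ^ lookup m v) \<and> (\<Prod>v\<in>A. var_poly v ^ lookup m v :: 'k lss_poly) \<in> S n" if "finite A" "A \<subseteq> keys m" for A
      using that
    proof (induction A)
      case (insert x A)
      then have "Q (var_poly x ^ lookup m x) \<and> (var_poly x ^ lookup m x :: 'k lss_poly) \<in> S n"
        using pow[of x "lookup m x"] mv by blast
      moreover from insert have "Q (\<Prod>v\<in>A. var_poly v ^ lookup m v) \<and> (\<Prod>v\<in>A. var_poly v ^ lookup m v :: 'k lss_poly) \<in> S n"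
        by simp
      ultimately show ?case using insert(1,2) by (simp add: m)
    qed (use one in simp)
    then show ?thesis by (simp add: monom_val_def)
  qed
  have "Q (\<Sum>m\<in>A. Const (lookup p m) * monom_val var_poly m) \<and> (\<Sum>m\<in>A. Const (lookup p m) * monom_val var_poly m) \<in> S n"
    if "finite A" "A \<subseteq> keys p" for A
    using that
  proof (induction A)
    case empty
    then show ?case using c[of 0] by simp
  next
    case (insert x A)
    have "\<forall>v\<in>keys x. var_index v \<in> {1..n}" using p insert(4) unfolding S_iff by blast
    then have "Q (monom_val var_poly x) \<and> (monom_val var_poly x :: 'k lss_poly) \<in> S n" by (rule mon)
    then have "Q (Const (lookup p x) * monom_val var_poly x) \<and> Const (lookup p x) * monom_val var_poly x \<in> S n"
      using m[OF Const_S _ c] by simp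
    then show ?case using insert a by simp
  qed
  from this[of "keys p"] show ?thesis using subst_var_poly[of p] by (simp add: subst_def)
qed

text \<open>A substitution that factors through another one has the larger kernel; inclusions
  between kernels are obtained in this way.\<close>

lemma subst_comp:
  assumes "\<And>v. \<tau> v = subst Const \<rho> (\<sigma> v)"
  shows "subst Const \<tau> p = subst Const \<rho> (subst Const \<sigma> p)"
proof -
  have "monom_val \<tau> m = subst Const \<rho> (monom_val \<sigma> m)" for m
  proof -
    have pow: "subst Const \<rho> (q ^ k) = subst Const \<rho> q ^ k" for q k by (induction k) auto
    have "subst Const \<rho> (\<Prod>v\<in>A. \<sigma> v ^ lookup m v) = (\<Prod>v\<in>A. \<tau> v ^ lookup m v)" for A
      by (induction A rule: infinite_finite_induct) (auto simp: pow assms)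
    then show ?thesis by (simp add: monom_val_def)
  qed
  then show ?thesis by (simp add: subst_def[of Const \<tau>] subst_def[of Const \<sigma>])
qed

definition ker :: "nat \<Rightarrow> (lss_var \<Rightarrow> 'k::field lss_poly) \<Rightarrow> 'k lss_poly set" where
  "ker n \<sigma> = {p \<in> S n. subst Const \<sigma> p = 0}"

text \<open>The target of the substitution is a domain.\<close>

lemma primeideal_ker: "primeideal (ker n \<sigma>) (poly_S n)"
  unfolding primeideal_S_iff ideal_S_iff by (auto simp: ker_def)

section \<open>Linear systems over a domain\<close>

text \<open>Gaussian elimination without division: cross-multiplication with a pivot removes one
  unknown and one equation. All dimension counts below rest on it, over the field for generators and
  growth, over the polynomials for the Jacobian.\<close>

lemma underdetermined_system:
  fixes C :: "'i \<Rightarrow> 'j \<Rightarrow> 'd::idom"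
  assumes "finite J" "finite I" "card J < card I"
  shows "\<exists>w. (\<exists>i\<in>I. w i \<noteq> 0) \<and> (\<forall>j\<in>J. (\<Sum>i\<in>I. w i * C i j) = 0)"
  using assms
proof (induction J arbitrary: I C rule: finite_induct)
  case empty
  then have "I \<noteq> {}" by auto
  then show ?case by (intro exI[of _ "\<lambda>_. 1"]) auto
next
  case (insert j J)
  show ?case
  proof (cases "\<forall>i\<in>I. C i j = 0")
    case True
    obtain w where "\<exists>i\<in>I. w i \<noteq> 0" "\<forall>j\<in>J. (\<Sum>i\<in>I. w i * C i j) = 0"
      using insert.IH[of I C] insert.prems insert.hyps by auto
    then show ?thesis using True by (intro exI[of _ w]) auto
  next
    case False
    then obtain k where k: "k \<in> I" "C k j \<noteq> 0" by auto
    let ?I = "I - {k}"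
    have "card J < card ?I" using insert.prems insert.hyps k by simp
    then obtain w where w: "\<exists>i\<in>?I. w i \<noteq> 0"
      "\<forall>j'\<in>J. (\<Sum>i\<in>?I. w i * (C k j * C i j' - C i j * C k j')) = 0"
      using insert.IH[of ?I "\<lambda>i j'. C k j * C i j' - C i j * C k j'"] insert.prems by auto
    define u where "u i = (if i = k then - (\<Sum>i\<in>?I. w i * C i j) else C k j * w i)" for i
    have split: "(\<Sum>i\<in>I. u i * C i l) = (\<Sum>i\<in>?I. w i * (C k j * C i l - C i j * C k l))" for l
    proof -
      have "(\<Sum>i\<in>I. u i * C i l) = u k * C k l + (\<Sum>i\<in>?I. u i * C i l)"
        using insert.prems k by (simp add: sum.remove)
      also have "(\<Sum>i\<in>?I. u i * C i l) = (\<Sum>i\<in>?I. C k j * w i * C i l)"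
        by (rule sum.cong) (auto simp: u_def)
      also have "u k * C k l = - (\<Sum>i\<in>?I. w i * C i j * C k l)"
        by (simp add: u_def sum_distrib_right)
      finally show ?thesis
        by (simp add: sum_subtractf[symmetric] algebra_simps)
    qed
    have "(\<Sum>i\<in>I. u i * C i l) = 0" if "l \<in> insert j J" for l
    proof (cases "l = j")
      case True
      then show ?thesis unfolding split by (simp add: mult.commute)
    next
      case False
      then show ?thesis unfolding split using w(2) that by auto
    qed
    moreover have "\<exists>i\<in>I. u i \<noteq> 0" using w(1) k by (auto simp: u_def)
    ultimately show ?thesis by (intro exI[of _ u]) auto
  qed
qed

section \<open>The number of generators of an ideal of quadrics\<close>

lemma monom_degree_superset:
  "finite A \<Longrightarrow> keys m \<subseteq> A \<Longrightarrow> monom_degree m = (\<Sum>v\<in>A. lookup m v)"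
  unfolding monom_degree_def by (rule sum.mono_neutral_left) (auto simp: in_keys_iff)

lemma monom_degree_add: "monom_degree (m + m') = monom_degree m + monom_degree m'"
proof -
  let ?A = "keys m \<union> keys m'"
  have "keys (m + m') \<subseteq> ?A" by (rule keys_add)
  then show ?thesis by (simp add: monom_degree_superset[of ?A] lookup_add sum.distrib)
qed

lemma monom_degree_eq_0_iff: "monom_degree m = 0 \<longleftrightarrow> m = 0"
proof -
  have "monom_degree m = 0 \<longleftrightarrow> (\<forall>v. lookup m v = 0)"
    by (auto simp: monom_degree_def in_keys_iff)
  then show ?thesis by (auto intro: poly_mapping_eqI)
qed

text \<open>Every term of \<open>c\<close> except the constant one raises the degree, and
  \<open>p\<close> has no terms below degree \<open>d\<close>.\<close>

lemma lookup_mult_lowest: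
  fixes c p :: "'k::field lss_poly"
  assumes p: "\<And>m. monom_degree m < d \<Longrightarrow> lookup p m = 0" and m: "monom_degree m \<le> d"
  shows "lookup (c * p) m = lookup c 0 * lookup p m"
proof -
  have *: "lookup (single k a * p) m = (if k = 0 then a * lookup p m else 0)" for k a
  proof (cases "k = 0")
    case True
    then show ?thesis using lookup_Const_mult[of a p m] by (simp add: Const_def)
  next
    case False
    have "m \<notin> keys (single k a * p)"
    proof
      assume "m \<in> keys (single k a * p)"
      then obtain x y where xy: "m = x + y" "x \<in> keys (single k a)" "y \<in> keys p"
        using keys_mult[of "single k a" p] by blast
      then have "x = k" by (auto split: if_splits)
      then have "monom_degree y < d" using xy(1) m False monom_degree_eq_0_iff[of k]
        by (simp add: monom_degree_add)
      then show False using p xy(3) by (simp add: in_keys_iff)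
    qed
    then show ?thesis using False by (simp add: in_keys_iff)
  qed
  have "lookup (c * p) m = (\<Sum>k\<in>keys c. lookup (single k (lookup c k) * p) m)"
    by (subst poly_mapping_expand[of c]) (simp add: sum_distrib_right lookup_sum)
  also have "\<dots> = (\<Sum>k\<in>keys c. if k = 0 then lookup c k * lookup p m else 0)"
    by (simp only: *)
  also have "\<dots> = lookup c 0 * lookup p m" by (simp add: in_keys_iff)
  finally show ?thesis .
qed

text \<open>Takes the place of Nakayama's lemma in degree 2. A factor \<open>c\<close> acts on the
  quadratic part of such a polynomial only through its constant term, so this is an ideal, and
  comparing it with generated ideals reduces generation to linear algebra over the field.\<close>

definition quad_span :: "nat \<Rightarrow> 'k::field lss_poly set \<Rightarrow> 'k lss_poly set" where
  "quad_span n A = {p \<in> S n. (\<forall>m. monom_degree m < 2 \<longrightarrow> lookup p m = 0) \<and>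
     (\<exists>w. \<forall>m. monom_degree m = 2 \<longrightarrow> lookup p m = (\<Sum>a\<in>A. w a * lookup a m))}"

lemma ideal_quad_span:
  fixes A :: "'k::field lss_poly set"
  shows "ideal (quad_span n A) (poly_S n)"
  unfolding ideal_S_iff
proof (intro conjI ballI)
  show "quad_span n A \<subseteq> S n" by (auto simp: quad_span_def)
  show "0 \<in> quad_span n A" by (auto simp: quad_span_def intro!: exI[of _ "\<lambda>_. 0"])
next
  fix p q :: "'k lss_poly" assume p: "p \<in> quad_span n A" and q: "q \<in> quad_span n A"
  obtain w u where "\<forall>m. monom_degree m = 2 \<longrightarrow> lookup p m = (\<Sum>a\<in>A. w a * lookup a m)"
    "\<forall>m. monom_degree m = 2 \<longrightarrow> lookup q m = (\<Sum>a\<in>A. u a * lookup a m)"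
    using p q unfolding quad_span_def by blast
  then have "\<forall>m. monom_degree m = 2 \<longrightarrow> lookup (p + q) m = (\<Sum>a\<in>A. (w a + u a) * lookup a m)"
    by (simp add: lookup_add distrib_right sum.distrib)
  then show "p + q \<in> quad_span n A"
    using p q unfolding quad_span_def by (auto simp: lookup_add intro!: exI[of _ "\<lambda>a. w a + u a"])
next
  fix c p :: "'k lss_poly" assume c: "c \<in> S n" and p: "p \<in> quad_span n A"
  have low: "monom_degree m < 2 \<Longrightarrow> lookup p m = 0" for m using p by (simp add: quad_span_def)
  obtain w where w: "\<forall>m. monom_degree m = 2 \<longrightarrow> lookup p m = (\<Sum>a\<in>A. w a * lookup a m)"
    using p unfolding quad_span_def by blast
  have "monom_degree m < 2 \<Longrightarrow> lookup (c * p) m = 0" for m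
    using lookup_mult_lowest[of 2 p m c] low by simp
  moreover have "lookup (c * p) m = (\<Sum>a\<in>A. (lookup c 0 * w a) * lookup a m)" if "monom_degree m = 2" for m
    using lookup_mult_lowest[of 2 p m c] low w that by (simp add: sum_distrib_left mult.assoc)
  ultimately show "c * p \<in> quad_span n A"
    using c p unfolding quad_span_def by (auto intro!: exI[of _ "\<lambda>a. lookup c 0 * w a"])
qed

lemma generator_in_quad_span:
  assumes "finite A" "a \<in> A" "a \<in> S n" "\<And>m. monom_degree m < 2 \<Longrightarrow> lookup a m = 0"
  shows "a \<in> quad_span n A"
proof -
  have "lookup a m = (\<Sum>b\<in>A. (if b = a then 1 else 0) * lookup b m)" for m
    using assms(1,2) by (simp add: if_distrib[of "\<lambda>x. x * _"] cong: if_cong)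
  then show ?thesis using assms(3,4) unfolding quad_span_def
    by (auto intro!: exI[of _ "\<lambda>b. if b = a then 1 else 0"])
qed

lemma mu_quadrics:
  fixes F :: "'k::field lss_poly set"
  assumes fin: "finite F" and FS: "F \<subseteq> S n" and deg: "\<And>f m. f \<in> F \<Longrightarrow> m \<in> keys f \<Longrightarrow> monom_degree m = 2"
    and indep: "\<And>c. (\<Sum>f\<in>F. Const (c f) * f) = 0 \<Longrightarrow> \<forall>f\<in>F. c f = 0"
  shows "mu n (Idl\<^bsub>poly_S n\<^esub> F) = card F"
proof -
  let ?I = "Idl\<^bsub>poly_S n\<^esub> F"
  have genI: "ideal (Idl\<^bsub>poly_S n\<^esub> A) (poly_S n)" "A \<subseteq> Idl\<^bsub>poly_S n\<^esub> A" if "A \<subseteq> S n" for A :: "'k lss_poly set"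
    using S.R.genideal_ideal[of A] S.R.genideal_self[of A] that by simp_all
  have low: "lookup f m = 0" if "f \<in> F" "monom_degree m < 2" for f m
    using deg[of f m] that by (force simp: in_keys_iff)
  have "?I \<subseteq> quad_span n F"
    using Idl_S_subset_iff[OF FS ideal_quad_span] generator_in_quad_span[OF fin] FS low by blast
  then have Iq: "\<And>p. p \<in> ?I \<Longrightarrow> p \<in> quad_span n F" by blast
  define quads where "quads A = {a \<in> A. \<forall>m\<in>keys a. monom_degree m = 2}" for A :: "'k lss_poly set"
  have quads_zero: "lookup a m = 0" if "homogeneous a" "a \<in> A - quads A" "monom_degree m = 2" for a A and m
    using that unfolding homogeneous_def quads_def by (force simp: in_keys_iff)
  have comb: "\<exists>w. f = (\<Sum>a\<in>quads A. Const (w a) * a)"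
    if A: "finite A" "\<And>a. a \<in> A \<Longrightarrow> homogeneous a" and f: "f \<in> quad_span n A" "\<And>m. m \<in> keys f \<Longrightarrow> monom_degree m = 2"
    for A f
  proof -
    obtain w where w: "\<forall>m. monom_degree m = 2 \<longrightarrow> lookup f m = (\<Sum>a\<in>A. w a * lookup a m)"
      using f(1) unfolding quad_span_def by blast
    have "f = (\<Sum>a\<in>quads A. Const (w a) * a)"
    proof (rule poly_mapping_eqI)
      fix m
      have r: "lookup (\<Sum>a\<in>quads A. Const (w a) * a) m = (\<Sum>a\<in>quads A. w a * lookup a m)"
        by (simp add: lookup_sum lookup_Const_mult)
      show "lookup f m = lookup (\<Sum>a\<in>quads A. Const (w a) * a) m"
      proof (cases "monom_degree m = 2")
        case True
        have "(\<Sum>a\<in>quads A. w a * lookup a m) = (\<Sum>a\<in>A. w a * lookup a m)"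
        proof (rule sum.mono_neutral_left[OF A(1)])
          show "quads A \<subseteq> A" by (auto simp: quads_def)
          show "\<forall>a\<in>A - quads A. w a * lookup a m = 0" using quads_zero[OF A(2)] True by simp
        qed
        then show ?thesis using w True r by simp
      next
        case False
        then have "lookup f m = 0" using f(2) by (auto simp: in_keys_iff)
        moreover have "lookup a m = 0" if "a \<in> quads A" for a
          using that False by (auto simp: quads_def in_keys_iff)
        ultimately show ?thesis using r by simp
      qed
    qed
    then show ?thesis by blast
  qed
  have combA: "\<exists>w. \<forall>f\<in>F. f = (\<Sum>a\<in>quads A. Const (w f a) * a)"
    if "finite A" "hom_generating_set n A ?I" for A
  proof -
    have A: "A \<subseteq> S n" "\<And>a. a \<in> A \<Longrightarrow> homogeneous a" "Idl\<^bsub>poly_S n\<^esub> A = ?I"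
      using that(2) by (auto simp: hom_generating_set_def)
    have "A \<subseteq> ?I" using genI(2)[OF A(1)] A(3) by simp
    then have "A \<subseteq> quad_span n A"
      using generator_in_quad_span[OF that(1)] A(1) Iq by (auto simp: quad_span_def[of n F])
    then have "?I \<subseteq> quad_span n A" using Idl_S_subset_iff[OF A(1) ideal_quad_span] A(3) by simp
    then have "F \<subseteq> quad_span n A" using genI(2)[OF FS] by blast
    then have "\<forall>f\<in>F. \<exists>w. f = (\<Sum>a\<in>quads A. Const (w a) * a)"
      using comb[OF \<open>finite A\<close> A(2)] deg by blast
    then show ?thesis by (rule bchoice)
  qed
  have card_le: "card F \<le> card (quads A)" if A: "finite A" "hom_generating_set n A ?I" for A
  proof (rule ccontr)
    assume "\<not> card F \<le> card (quads A)"
    then have lt: "card (quads A) < card F" by simp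
    obtain w where w: "\<forall>f\<in>F. f = (\<Sum>a\<in>quads A. Const (w f a) * a)" using combA[OF A] by blast
    have "finite (quads A)" using A(1) by (simp add: quads_def)
    then obtain u where u: "\<exists>f\<in>F. u f \<noteq> 0" "\<forall>a\<in>quads A. (\<Sum>f\<in>F. u f * w f a) = 0"
      using underdetermined_system[of "quads A" F w] fin lt by auto
    have "(\<Sum>f\<in>F. Const (u f) * f) = (\<Sum>f\<in>F. \<Sum>a\<in>quads A. Const (u f * w f a) * a)"
    proof (rule sum.cong)
      fix f assume "f \<in> F"
      with w have eq: "f = (\<Sum>a\<in>quads A. Const (w f a) * a)" by blast
      have "Const (u f) * f = Const (u f) * (\<Sum>a\<in>quads A. Const (w f a) * a)"
        by (rule arg_cong[OF eq])
      then show "Const (u f) * f = (\<Sum>a\<in>quads A. Const (u f * w f a) * a)"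
        by (simp add: sum_distrib_left mult.assoc)
    qed simp
    also have "\<dots> = (\<Sum>a\<in>quads A. Const (\<Sum>f\<in>F. u f * w f a) * a)"
      by (subst sum.swap) (simp only: Const_sum sum_distrib_right)
    also have "\<dots> = 0" using u(2) by simp
    finally show False using indep u(1) by blast
  qed
  have hgF: "hom_generating_set n F ?I"
    using FS deg unfolding hom_generating_set_def homogeneous_def by blast
  have minF: "min_hom_generating_set n F ?I"
    unfolding min_hom_generating_set_def
  proof (intro conjI notI)
    assume "\<exists>B. B \<subset> F \<and> hom_generating_set n B ?I"
    then obtain B where B: "B \<subset> F" "hom_generating_set n B ?I" by blast
    then have "finite B" using fin finite_subset by blast
    then have "card F \<le> card B" using card_le[OF _ B(2)] card_mono[of B "quads B"] by (force simp: quads_def)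
    then show False using psubset_card_mono[OF fin B(1)] by simp
  qed (rule hgF)
  have "card A = card F" if A: "min_hom_generating_set n A ?I" "finite A" for A
  proof -
    have hg: "hom_generating_set n A ?I" and min: "\<And>B. B \<subset> A \<Longrightarrow> \<not> hom_generating_set n B ?I"
      using A(1) by (auto simp: min_hom_generating_set_def)
    have AS: "A \<subseteq> S n" and Ah: "\<And>a. a \<in> A \<Longrightarrow> homogeneous a" and AI: "Idl\<^bsub>poly_S n\<^esub> A = ?I"
      using hg by (auto simp: hom_generating_set_def)
    have gen: "hom_generating_set n B ?I" if B: "B \<subseteq> A" "F \<subseteq> Idl\<^bsub>poly_S n\<^esub> B" for B
    proof -
      have BS: "B \<subseteq> S n" using B AS by blast
      have "?I \<subseteq> Idl\<^bsub>poly_S n\<^esub> B" using Idl_S_subset_iff[OF FS genI(1)[OF BS]] B(2) by simp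
      moreover have "Idl\<^bsub>poly_S n\<^esub> B \<subseteq> ?I"
        using Idl_S_subset_iff[OF BS genI(1)[OF FS]] genI(2)[OF AS] AI B(1) by blast
      ultimately show ?thesis using BS Ah B(1) by (auto simp: hom_generating_set_def)
    qed
    obtain w where w: "\<forall>f\<in>F. f = (\<Sum>a\<in>quads A. Const (w f a) * a)" using combA[OF A(2) hg] by blast
    have quads_sub: "quads A \<subseteq> A" by (auto simp: quads_def)
    have "F \<subseteq> Idl\<^bsub>poly_S n\<^esub> (quads A)"
    proof
      fix f assume f: "f \<in> F"
      have qS: "quads A \<subseteq> S n" using quads_sub AS by blast
      have mem: "(\<Sum>a\<in>quads A. Const (w f a) * a) \<in> Idl\<^bsub>poly_S n\<^esub> (quads A)"
        using genI[OF qS] by (intro ideal_sum) (auto simp: ideal_S_iff)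
      have eq: "f = (\<Sum>a\<in>quads A. Const (w f a) * a)" using w f by blast
      show "f \<in> Idl\<^bsub>poly_S n\<^esub> (quads A)" by (subst eq) (rule mem)
    qed
    then have "\<not> quads A \<subset> A" using gen[OF quads_sub] min by blast
    then have qA: "quads A = A" using quads_sub by blast
    have "card A \<le> card F"
    proof (rule ccontr)
      assume "\<not> card A \<le> card F"
      have qF: "quads F = F" using deg by (auto simp: quads_def)
      have "\<exists>w. a = (\<Sum>f\<in>F. Const (w f) * f)" if "a \<in> A" for a
      proof (rule comb[OF fin, unfolded qF])
        show "a \<in> quad_span n F" using Iq genI(2)[OF AS] AI that by blast
        show "\<And>m. m \<in> keys a \<Longrightarrow> monom_degree m = 2" using that qA by (auto simp: quads_def)
        show "\<And>f. f \<in> F \<Longrightarrow> homogeneous f" using hgF by (simp add: hom_generating_set_def)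
      qed
      then have "\<forall>a\<in>A. \<exists>w. a = (\<Sum>f\<in>F. Const (w f) * f)" by blast
      from bchoice[OF this] obtain v where v: "\<forall>a\<in>A. a = (\<Sum>f\<in>F. Const (v a f) * f)" by blast
      obtain u where u: "\<exists>a\<in>A. u a \<noteq> 0" "\<forall>f\<in>F. (\<Sum>a\<in>A. u a * v a f) = 0"
        using underdetermined_system[of F A v] fin A(2) \<open>\<not> card A \<le> card F\<close> by auto
      have "(\<Sum>a\<in>A. Const (u a) * a) = (\<Sum>a\<in>A. \<Sum>f\<in>F. Const (u a * v a f) * f)"
      proof (rule sum.cong)
        fix a assume "a \<in> A"
        with v have eq: "a = (\<Sum>f\<in>F. Const (v a f) * f)" by blast
        have "Const (u a) * a = Const (u a) * (\<Sum>f\<in>F. Const (v a f) * f)"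
          by (rule arg_cong[OF eq])
        then show "Const (u a) * a = (\<Sum>f\<in>F. Const (u a * v a f) * f)"
          by (simp add: sum_distrib_left mult.assoc)
      qed simp
      also have "\<dots> = (\<Sum>f\<in>F. Const (\<Sum>a\<in>A. u a * v a f) * f)"
        by (subst sum.swap) (simp only: Const_sum sum_distrib_right)
      also have "\<dots> = 0" using u(2) by simp
      finally have zero: "(\<Sum>a\<in>A. Const (u a) * a) = 0" .
      \<comment> \<open>The relation has a non-zero coefficient at \<open>b\<close>; dividing by it
        expresses \<open>b\<close> by the other generators, against minimality.\<close>
      obtain b where b: "b \<in> A" "u b \<noteq> 0" using u(1) by blast
      let ?B = "A - {b}"
      have BS: "?B \<subseteq> S n" using AS by blast
      have "(\<Sum>a\<in>?B. Const (- u a) * a) \<in> Idl\<^bsub>poly_S n\<^esub> ?B"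
      proof (rule ideal_sum[OF genI(1)[OF BS]])
        fix a assume "a \<in> ?B"
        then show "Const (- u a) * a \<in> Idl\<^bsub>poly_S n\<^esub> ?B"
          using genI[OF BS] Const_S unfolding ideal_S_iff by blast
      qed
      moreover have "Const (u b) * b = (\<Sum>a\<in>?B. Const (- u a) * a)"
        using zero A(2) b(1) by (simp add: sum.remove eq_neg_iff_add_eq_0 sum_negf)
      ultimately have "Const (u b) * b \<in> Idl\<^bsub>poly_S n\<^esub> ?B" by (simp only:)
      then have "Const (1 / u b) * (Const (u b) * b) \<in> Idl\<^bsub>poly_S n\<^esub> ?B"
        using genI(1)[OF BS] Const_S unfolding ideal_S_iff by blast
      moreover have "Const (1 / u b) * (Const (u b) * b) = b"
        using b(2) Const_simps(4)[of "1 / u b" "u b"] by (simp add: mult.assoc[symmetric] del: Const_simps(4))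
      ultimately have "A \<subseteq> Idl\<^bsub>poly_S n\<^esub> ?B" using genI(2)[OF BS] by auto
      then have "?I \<subseteq> Idl\<^bsub>poly_S n\<^esub> ?B" using Idl_S_subset_iff[OF AS genI(1)[OF BS]] AI by simp
      then have "hom_generating_set n ?B ?I" using gen[of ?B] genI(2)[OF FS] by blast
      then show False using min[of ?B] b(1) by blast
    qed
    then show ?thesis using card_le[OF A(2) hg] qA by simp
  qed
  then have eq: "k = card F" if "\<exists>A. min_hom_generating_set n A ?I \<and> finite A \<and> card A = k" for k
    using that by blast
  show ?thesis
    unfolding mu_def
  proof (rule the_equality)
    show "\<exists>A. min_hom_generating_set n A ?I \<and> finite A \<and> card A = card F"
      using minF fin by blast
  qed (rule eq)
qed

section \<open>Heights of primes in the polynomial ring\<close>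

definition prime_chain :: "('a, 'b) ring_scheme \<Rightarrow> nat \<Rightarrow> 'a set \<Rightarrow> bool" where
  "prime_chain R k P \<longleftrightarrow> (\<exists>C :: nat \<Rightarrow> 'a set.
     (\<forall>i\<le>k. primeideal (C i) R) \<and> (\<forall>i<k. C i \<subset> C (Suc i)) \<and> C k = P)"

lemma prime_height_alt: "prime_height R P = Sup {enat k | k. prime_chain R k P}"
  by (simp add: prime_height_def prime_chain_def)

lemma prime_chain_0: "primeideal P R \<Longrightarrow> prime_chain R 0 P"
  by (auto simp: prime_chain_def intro!: exI[of _ "\<lambda>_. P"])

lemma prime_chain_prime: "prime_chain R k P \<Longrightarrow> primeideal P R"
  by (auto simp: prime_chain_def)

lemma prime_chain_Suc:
  assumes "prime_chain R k P" "primeideal Q R" "P \<subset> Q"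
  shows "prime_chain R (Suc k) Q"
proof -
  obtain C where C: "\<And>i. i \<le> k \<Longrightarrow> primeideal (C i) R" "\<And>i. i < k \<Longrightarrow> C i \<subset> C (Suc i)" "C k = P"
    using assms(1) unfolding prime_chain_def by blast
  define D where "D i = (if i \<le> k then C i else Q)" for i
  have "primeideal (D i) R" if "i \<le> Suc k" for i using C(1) assms(2) by (simp add: D_def)
  moreover have "D i \<subset> D (Suc i)" if "i < Suc k" for i
    using C(2)[of i] C(3) assms(3) that by (cases "i = k") (simp_all add: D_def)
  moreover have "D (Suc k) = Q" by (simp add: D_def)
  ultimately show ?thesis unfolding prime_chain_def by blast
qed

lemma prime_chain_SucD:
  assumes "prime_chain R (Suc k) P"
  obtains Q where "prime_chain R k Q" "Q \<subset> P"
proof -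
  obtain C where C: "\<And>i. i \<le> Suc k \<Longrightarrow> primeideal (C i) R" "\<And>i. i < Suc k \<Longrightarrow> C i \<subset> C (Suc i)" "C (Suc k) = P"
    using assms unfolding prime_chain_def by blast
  have "prime_chain R k (C k)" unfolding prime_chain_def using C(1,2) by (intro exI[of _ C]) simp
  moreover have "C k \<subset> P" using C(2)[of k] C(3) by simp
  ultimately show ?thesis using that by blast
qed

lemma prime_height_ge: "prime_chain R k P \<Longrightarrow> enat k \<le> prime_height R P"
  unfolding prime_height_alt by (rule Sup_upper) blast

lemma prime_height_mono_superset:
  assumes "prime_chain R k P" "primeideal Q R" "P \<subseteq> Q"
  shows "enat k \<le> prime_height R Q"
proof (cases "P = Q")
  case False
  then have "enat (Suc k) \<le> prime_height R Q"
    using assms prime_chain_Suc prime_height_ge by blast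
  then show ?thesis by (meson enat_ord_simps(1) le_SucI order_refl order_trans)
qed (use assms prime_height_ge in auto)

text \<open>Exponents are bounded one by one and not in total degree: the number of monomials is
  then an exact power, and the bounds add up under multiplication.\<close>

definition box :: "nat \<Rightarrow> nat \<Rightarrow> 'k::field lss_poly set" where
  "box n d = {p \<in> S n. \<forall>m\<in>keys p. \<forall>v. lookup m v \<le> d}"

lemma box_mult:
  assumes "p \<in> box n d" "q \<in> box n e" shows "p * q \<in> box n (d + e)"
  unfolding box_def
proof (intro CollectI conjI ballI allI)
  show "p * q \<in> S n" using assms by (auto simp: box_def)
  fix m v assume "m \<in> keys (p * q)"
  then obtain a b where "m = a + b" "a \<in> keys p" "b \<in> keys q" using keys_mult[of p q] by blast
  then show "lookup m v \<le> d + e" using assms by (auto simp: box_def lookup_add intro: add_mono)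
qed

lemma box_mono: "d \<le> e \<Longrightarrow> box n d \<subseteq> box n e"
  unfolding box_def using order_trans by blast

lemma box_pow: "p \<in> box n d \<Longrightarrow> p ^ k \<in> box n (k * d)"
proof (induction k)
  case 0
  show ?case by (auto simp: box_def)
next
  case (Suc k)
  then show ?case using box_mult[of p n d "p ^ k" "k * d"] by simp
qed

lemma box_exhausts:
  assumes "p \<in> S n" obtains d where "p \<in> box n d"
proof -
  let ?A = "\<Union>m\<in>keys p. lookup m ` keys m"
  have fin: "finite ?A" by simp
  have "lookup m v \<le> Max (insert 0 ?A)" if "m \<in> keys p" for m v
  proof (cases "v \<in> keys m")
    case True
    then show ?thesis using that fin by (intro Max_ge) auto
  next
    case False
    then show ?thesis by (simp add: in_keys_iff)
  qed
  then show ?thesis using that assms unfolding box_def by blast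
qed

definition monoms :: "lss_var set \<Rightarrow> nat \<Rightarrow> (lss_var \<Rightarrow>\<^sub>0 nat) set" where
  "monoms U d = {m. keys m \<subseteq> U \<and> (\<forall>v. lookup m v \<le> d)}"

lemma card_monoms:
  assumes "finite U"
  shows "finite (monoms U d)" "card (monoms U d) = (d + 1) ^ card U"
proof -
  let ?F = "U \<rightarrow>\<^sub>E {..d}"
  have "bij_betw (\<lambda>m. restrict (lookup m) U) (monoms U d) ?F"
  proof (rule bij_betwI[where g = "\<lambda>e. \<Sum>v\<in>U. single v (e v)"])
    show "(\<lambda>m. restrict (lookup m) U) \<in> monoms U d \<rightarrow> ?F" by (auto simp: monoms_def)
    have lk: "lookup (\<Sum>v\<in>U. single v (e v)) w = (if w \<in> U then e w else 0)" for e :: "lss_var \<Rightarrow> nat" and w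
      using assms by (simp add: lookup_sum lookup_single when_def)
    show "(\<lambda>e. \<Sum>v\<in>U. single v (e v)) \<in> ?F \<rightarrow> monoms U d"
      by (auto simp: monoms_def lk in_keys_iff PiE_iff split: if_splits)
    show "(\<Sum>v\<in>U. single v (restrict (lookup m) U v)) = m" if "m \<in> monoms U d" for m
    proof (rule poly_mapping_eqI)
      fix w
      show "lookup (\<Sum>v\<in>U. single v (restrict (lookup m) U v)) w = lookup m w"
        using that unfolding lk by (auto simp: monoms_def in_keys_iff)
    qed
    show "restrict (lookup (\<Sum>v\<in>U. single v (e v))) U = e" if "e \<in> ?F" for e
      using that by (auto simp: lk fun_eq_iff PiE_iff extensional_def)
  qed
  then show "finite (monoms U d)" "card (monoms U d) = (d + 1) ^ card U"
    using assms by (auto simp: bij_betw_finite bij_betw_same_card card_PiE finite_PiE)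
qed

definition vars :: "nat \<Rightarrow> lss_var set" where
  "vars n = VX ` {1..n} \<union> VY ` {1..n}"

lemma mem_vars: "v \<in> vars n \<longleftrightarrow> var_index v \<in> {1..n}"
  by (cases v) (auto simp: vars_def)

lemma card_vars: "finite (vars n)" "card (vars n) = 2 * n"
proof -
  have "card (VX ` {1..n}) = n" "card (VY ` {1..n}) = n"
    by (simp_all add: card_image inj_on_def)
  moreover have "VX ` {1..n} \<inter> VY ` {1..n} = {}" by auto
  ultimately show "finite (vars n)" "card (vars n) = 2 * n"
    by (simp_all add: vars_def card_Un_disjoint)
qed

text \<open>\<open>independent_family n P L N\<close>: the quotient by \<open>P\<close> of the space of polynomials with all
  exponents at most \<open>L\<close> has dimension at least \<open>N\<close>.\<close>

definition independent_family :: "nat \<Rightarrow> 'k::field lss_poly set \<Rightarrow> nat \<Rightarrow> nat \<Rightarrow> bool" where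
  "independent_family n P L N \<longleftrightarrow> (\<exists>b. (\<forall>i<N. b i \<in> box n L) \<and>
     (\<forall>c. (\<Sum>i<N. Const (c i) * b i) \<in> P \<longrightarrow> (\<forall>i<N. c i = 0)))"

lemma independent_familyI:
  fixes b :: "'i \<Rightarrow> 'k::field lss_poly"
  assumes "finite I" "\<And>i. i \<in> I \<Longrightarrow> b i \<in> box n L"
    "\<And>c. (\<Sum>i\<in>I. Const (c i) * b i) \<in> P \<Longrightarrow> \<forall>i\<in>I. c i = 0"
  shows "independent_family n P L (card I)"
proof -
  obtain f where f: "bij_betw f {..<card I} I"
    using ex_bij_betw_nat_finite[OF assms(1)] by (auto simp: atLeast0LessThan)
  let ?g = "inv_into {..<card I} f"
  have g: "?g (f i) = i" if "i < card I" for i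
    using f that by (simp add: bij_betw_inv_into_left)
  have fI: "f i \<in> I" if "i < card I" for i using f that by (auto simp: bij_betw_def)
  show ?thesis
    unfolding independent_family_def
  proof (intro exI[of _ "b \<circ> f"] conjI allI impI)
    show "(b \<circ> f) i \<in> box n L" if "i < card I" for i using assms(2) fI[OF that] by simp
    fix c i assume c: "(\<Sum>i<card I. Const (c i) * (b \<circ> f) i) \<in> P" and i: "i < card I"
    have "(\<Sum>i\<in>I. Const (c (?g i)) * b i) = (\<Sum>i<card I. Const (c (?g (f i))) * b (f i))"
      using sum.reindex_bij_betw[OF f, of "\<lambda>i. Const (c (?g i)) * b i"] by simp
    also have "\<dots> = (\<Sum>i<card I. Const (c i) * (b \<circ> f) i)" using g by simp
    finally have "\<forall>i\<in>I. c (?g i) = 0" using assms(3)[of "c \<circ> ?g"] c by simp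
    then show "c i = 0" using fI[OF i] g[OF i] by metis
  qed
qed

text \<open>If \<open>g \<in> Q\<close> is not in \<open>P\<close>, then \<open>1, g, \<dots>, g\<^sup>d\<close> is independent modulo \<open>P\<close> over any family that is
  independent modulo \<open>Q\<close>: reduce a relation modulo \<open>Q\<close>, then divide it by \<open>g\<close>.\<close>

lemma independent_family_powers:
  fixes P Q :: "'k::field lss_poly set"
  assumes P: "primeideal P (poly_S n)" and Q: "primeideal Q (poly_S n)" and PQ: "P \<subseteq> Q"
    and g: "g \<in> Q" "g \<notin> P" "g \<in> box n e" and fam: "independent_family n Q L N"
  shows "independent_family n P (d * e + L) ((d + 1) * N)"
proof -
  have P': "\<And>a b. a \<in> S n \<Longrightarrow> b \<in> S n \<Longrightarrow> a * b \<in> P \<Longrightarrow> a \<in> P \<or> b \<in> P"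
    using P by (simp add: primeideal_S_iff)
  have Q': "ideal Q (poly_S n)" using Q by (simp add: primeideal_S_iff)
  have gS: "g \<in> S n" using g(3) by (simp add: box_def)
  obtain b where b: "\<And>i. i < N \<Longrightarrow> b i \<in> box n L"
    and ind: "\<And>c. (\<Sum>i<N. Const (c i) * b i) \<in> Q \<Longrightarrow> \<forall>i<N. c i = 0"
    using fam unfolding independent_family_def by blast
  have powS: "g ^ j \<in> S n" for j using box_pow[OF g(3)] by (simp add: box_def)
  have bS: "b i \<in> S n" if "i < N" for i using b[OF that] by (simp add: box_def)
  have key: "\<forall>j\<le>d. \<forall>i<N. c j i = 0"
    if "(\<Sum>j\<le>d. g ^ j * (\<Sum>i<N. Const (c j i) * b i)) \<in> P" for c d
    using that
  proof (induction d arbitrary: c)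
    case 0
    then show ?case using ind[of "c 0"] PQ by auto
  next
    case (Suc d)
    let ?h = "\<lambda>j. \<Sum>i<N. Const (c j i) * b i"
    let ?r = "\<Sum>j\<le>d. g ^ j * ?h (Suc j)"
    have hS: "?h j \<in> S n" for j using bS by (intro S.sum_S) auto
    have rS: "?r \<in> S n" using hS powS by (intro S.sum_S) auto
    have "(\<Sum>j\<le>Suc d. g ^ j * ?h j) = ?h 0 + g * ?r"
      by (simp only: sum.atMost_Suc_shift power_0 mult_1 power_Suc sum_distrib_left[of g] mult.assoc)
    then have sum: "?h 0 + g * ?r \<in> P" using Suc.prems by simp
    have "?r * g \<in> Q" using rS g(1) Q' unfolding ideal_S_iff by blast
    then have "(-1) * (?r * g) \<in> Q" using Q' S.uminus_S[OF S.one_S] unfolding ideal_S_iff by blast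
    then have "(?h 0 + g * ?r) + (-1) * (?r * g) \<in> Q"
      using sum PQ Q' unfolding ideal_S_iff by blast
    then have "?h 0 \<in> Q" by (simp add: algebra_simps)
    then have c0: "\<forall>i<N. c 0 i = 0" by (rule ind)
    then have "?h 0 = 0" by simp
    then have "g * ?r \<in> P" using sum by simp
    then have "?r \<in> P" using P' gS rS g(2) by blast
    then have "\<forall>j\<le>d. \<forall>i<N. c (Suc j) i = 0" by (rule Suc.IH)
    then show ?case using c0 by (metis Suc_le_mono not0_implies_Suc)
  qed
  let ?I = "{..d} \<times> {..<N}"
  have "independent_family n P (d * e + L) (card ?I)"
  proof (rule independent_familyI[where b = "\<lambda>(j, i). g ^ j * b i"])
    fix x assume "x \<in> ?I"
    then obtain j i where x: "x = (j, i)" "j \<le> d" "i < N" by auto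
    have "g ^ j * b i \<in> box n (j * e + L)" using box_mult[OF box_pow[OF g(3)] b] x by simp
    moreover have "j * e + L \<le> d * e + L" using x by simp
    ultimately have "g ^ j * b i \<in> box n (d * e + L)" using subsetD[OF box_mono] by blast
    then show "(case x of (j, i) \<Rightarrow> g ^ j * b i) \<in> box n (d * e + L)" using x(1) by simp
  next
    fix c assume c: "(\<Sum>x\<in>?I. Const (c x) * (case x of (j, i) \<Rightarrow> g ^ j * b i)) \<in> P"
    have "(\<Sum>x\<in>?I. Const (c x) * (case x of (j, i) \<Rightarrow> g ^ j * b i)) = (\<Sum>j\<le>d. g ^ j * (\<Sum>i<N. Const (c (j, i)) * b i))"
      by (simp add: sum_distrib_left sum.cartesian_product split_def mult.left_commute)
    then show "\<forall>x\<in>?I. c x = 0" using key[of "\<lambda>j i. c (j, i)" d] c by auto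
  qed simp
  then show ?thesis by simp
qed

text \<open>The family is independent over the field, and its members use only
  \<open>(L + 1) ^ (2 * n)\<close> monomials.\<close>

lemma independent_family_bound:
  fixes P :: "'k::field lss_poly set"
  assumes "independent_family n P L N" "0 \<in> P"
  shows "N \<le> (L + 1) ^ (2 * n)"
proof (rule ccontr)
  assume N: "\<not> N \<le> (L + 1) ^ (2 * n)"
  obtain b where b: "\<And>i. i < N \<Longrightarrow> b i \<in> box n L"
    and ind: "\<And>c. (\<Sum>i<N. Const (c i) * b i) \<in> P \<Longrightarrow> \<forall>i<N. c i = 0"
    using assms(1) unfolding independent_family_def by blast
  let ?M = "monoms (vars n) L"
  have M: "finite ?M" "card ?M = (L + 1) ^ (2 * n)"
    using card_monoms[OF card_vars(1), of n L] by (simp_all add: card_vars)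
  obtain w where w: "\<exists>i\<in>{..<N}. w i \<noteq> 0" "\<forall>m\<in>?M. (\<Sum>i\<in>{..<N}. w i * lookup (b i) m) = 0"
    using underdetermined_system[of ?M "{..<N}" "\<lambda>i m. lookup (b i) m"] M N by auto
  have "(\<Sum>i<N. Const (w i) * b i) = 0"
  proof (rule poly_mapping_eqI)
    fix m
    have "lookup (\<Sum>i<N. Const (w i) * b i) m = (\<Sum>i<N. w i * lookup (b i) m)"
      by (simp add: lookup_sum lookup_Const_mult)
    also have "\<dots> = 0"
    proof (cases "m \<in> ?M")
      case False
      have "lookup (b i) m = 0" if "i < N" for i
      proof (rule ccontr)
        assume "lookup (b i) m \<noteq> 0"
        then have "m \<in> keys (b i)" by (simp add: in_keys_iff)
        then have "m \<in> ?M" using b[OF that] by (auto simp: box_def monoms_def S_iff mem_vars)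
        then show False using False by blast
      qed
      then show ?thesis by simp
    qed (use w in simp)
    finally show "lookup (\<Sum>i<N. Const (w i) * b i) m = lookup 0 m" by simp
  qed
  then show False using ind[of w] assms(2) w(1) by auto
qed

text \<open>Each step down the chain contributes powers of some \<open>g\<close> up to the exponent
  \<open>d\<close>: the size gains a factor \<open>d + 1\<close>, the exponents grow by a multiple
  of \<open>d\<close>. The bound thus keeps the form \<open>A * d\<close> with \<open>A\<close>
  independent of \<open>d\<close>, which the comparison of growth requires.\<close>

lemma independent_family_chain:
  fixes P :: "'k::field lss_poly set"
  assumes "prime_chain (poly_S n) j P" "\<And>d. independent_family n P (B * d) ((d + 1) ^ i)"
  shows "\<exists>A Q. primeideal Q (poly_S n) \<and> (\<forall>d. independent_family n (Q :: 'k lss_poly set) (A * d) ((d + 1) ^ (i + j)))"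
  using assms
proof (induction j arbitrary: P B i)
  case 0
  then show ?case using prime_chain_prime by (intro exI[of _ B] exI[of _ P]) auto
next
  case (Suc j)
  obtain Q where Q: "prime_chain (poly_S n) j Q" "Q \<subset> P" using prime_chain_SucD[OF Suc.prems(1)] by blast
  have P: "primeideal P (poly_S n)" using prime_chain_prime[OF Suc.prems(1)] .
  obtain g where g: "g \<in> P" "g \<notin> Q" using Q(2) by blast
  have "g \<in> S n" using P g(1) by (auto simp: primeideal_S_iff ideal_S_iff)
  then obtain e where e: "g \<in> box n e" by (rule box_exhausts)
  have "independent_family n Q ((e + B) * d) ((d + 1) ^ (Suc i))" for d
    using independent_family_powers[OF prime_chain_prime[OF Q(1)] P _ g e Suc.prems(2)[of d], of d] Q(2)
    by (simp add: algebra_simps)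
  from Suc.IH[OF Q(1) this] show ?case by simp
qed

text \<open>The assumption \<open>free\<close> says that the variables in \<open>U\<close> remain
  independent modulo \<open>P\<close>. The result is the inequality between height plus dimension
  and \<open>2 * n\<close>, with \<open>card U\<close> as a lower bound for the dimension.\<close>

lemma prime_chain_le:
  fixes P :: "'k::field lss_poly set"
  assumes chain: "prime_chain (poly_S n) k P" and U: "U \<subseteq> vars n"
    and free: "\<And>p. p \<in> P \<Longrightarrow> (\<And>m. m \<in> keys p \<Longrightarrow> keys m \<subseteq> U) \<Longrightarrow> p = 0"
  shows "k + card U \<le> 2 * n"
proof -
  have finU: "finite U" using U card_vars(1) finite_subset by blast
  have base: "independent_family n P d ((d + 1) ^ card U)" for d
  proof -
    have "independent_family n P d (card (monoms U d))"
    proof (rule independent_familyI[where b = "\<lambda>m. single m 1"])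
      show "finite (monoms U d)" using card_monoms[OF finU] by blast
      show "single m 1 \<in> box n d" if "m \<in> monoms U d" for m
      proof -
        have "keys m \<subseteq> vars n" "\<forall>v. lookup m v \<le> d" using that U by (auto simp: monoms_def)
        then show ?thesis using mem_vars by (auto simp: box_def S_iff subset_iff)
      qed
      fix c :: "_ \<Rightarrow> 'k" assume c: "(\<Sum>m\<in>monoms U d. Const (c m) * single m 1) \<in> P"
      let ?p = "\<Sum>m\<in>monoms U d. single m (c m)"
      have lk: "lookup ?p m = (if m \<in> monoms U d then c m else 0)" for m
        using card_monoms(1)[OF finU] by (simp add: lookup_sum lookup_single when_def)
      have "?p \<in> P" using c by (simp add: Const_def mult_single)
      moreover have "keys m \<subseteq> U" if "m \<in> keys ?p" for m
      proof -
        have "m \<in> monoms U d" using that lk[of m] by (metis in_keys_iff)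
        then show ?thesis by (simp add: monoms_def)
      qed
      ultimately have "?p = 0" by (rule free)
      then show "\<forall>m\<in>monoms U d. c m = 0" using lk by (metis lookup_zero)
    qed
    then show ?thesis using card_monoms(2)[OF finU] by simp
  qed
  then obtain A and Q :: "'k lss_poly set" where Q: "primeideal Q (poly_S n)"
    "\<And>d. independent_family n Q (A * d) ((d + 1) ^ (card U + k))"
    using independent_family_chain[OF chain, of 1 "card U"] by auto
  have "0 \<in> Q" using Q(1) by (simp add: primeideal_S_iff ideal_S_iff)
  then have bound: "(d + 1) ^ (card U + k) \<le> (A * d + 1) ^ (2 * n)" for d
    using independent_family_bound[OF Q(2)] by blast
  show ?thesis
  proof (rule ccontr)
    assume "\<not> ?thesis"
    then have ge: "2 * n + 1 \<le> card U + k" by simp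
    \<comment> \<open>Chosen so that \<open>(A + 1) ^ (2 * n)\<close> is smaller than
      \<open>d + 1\<close>: the constant factor lost in degree \<open>2 * n\<close> cannot make up
      for one more factor \<open>d + 1\<close>.\<close>
    define d where "d = (A + 1) ^ (2 * n)"
    have "(d + 1) ^ (2 * n + 1) \<le> (d + 1) ^ (card U + k)" using ge by (rule power_increasing) simp
    also have "\<dots> \<le> (A * d + 1) ^ (2 * n)" by (rule bound)
    also have "\<dots> \<le> ((A + 1) * (d + 1)) ^ (2 * n)" by (rule power_mono) simp_all
    also have "\<dots> = d * (d + 1) ^ (2 * n)" by (simp only: power_mult_distrib d_def)
    also have "\<dots> < (d + 1) ^ (2 * n + 1)" by simp
    finally show False by simp
  qed
qed

section \<open>Parametrized primes\<close>

definition polys_in :: "lss_var set \<Rightarrow> 'k::field lss_poly set" where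
  "polys_in U = {p. \<forall>m\<in>keys p. keys m \<subseteq> U}"

lemma polys_in_add: "p \<in> polys_in U \<Longrightarrow> q \<in> polys_in U \<Longrightarrow> p + q \<in> polys_in U"
  using keys_add[of p q] unfolding polys_in_def by blast

lemma polys_in_mult:
  assumes "p \<in> polys_in U" "q \<in> polys_in U" shows "p * q \<in> polys_in U"
  unfolding polys_in_def
proof (intro CollectI ballI)
  fix m assume "m \<in> keys (p * q)"
  then obtain x y where xy: "m = x + y" "x \<in> keys p" "y \<in> keys q" using keys_mult[of p q] by blast
  then show "keys m \<subseteq> U" using assms keys_add[of x y] unfolding polys_in_def by blast
qed

lemma polys_in_Const [simp]: "Const c \<in> polys_in U" by (simp add: polys_in_def Const_def)

lemma polys_in_var [simp]: "var_poly v \<in> polys_in U \<longleftrightarrow> v \<in> U"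
  by (simp add: polys_in_def var_poly_def)

lemma S_eq_polys_in: "S n = polys_in (vars n)"
proof -
  have "keys m \<subseteq> vars n \<longleftrightarrow> (\<forall>v\<in>keys m. var_index v \<in> {1..n})" for m :: "lss_var \<Rightarrow>\<^sub>0 nat"
    by (simp only: subset_iff mem_vars Ball_def)
  then show ?thesis unfolding polys_in_def by (intro Set.set_eqI) (simp only: S_iff mem_Collect_eq)
qed

lemma polys_in_S: "U \<subseteq> vars n \<Longrightarrow> polys_in U \<subseteq> S n"
  unfolding S_eq_polys_in polys_in_def by blast

lemma single_power: "\<exists>\<mu>. (single e c) ^ k = single \<mu> (c ^ k) \<and> (\<forall>x. lookup \<mu> x = k * lookup e x)"
  for c :: "'k::field" and e :: "lss_var \<Rightarrow>\<^sub>0 nat"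
proof (induction k)
  case 0
  show ?case by (intro exI[of _ 0]) simp
next
  case (Suc k)
  then obtain \<mu> where "(single e c) ^ k = single \<mu> (c ^ k)" "\<forall>x. lookup \<mu> x = k * lookup e x" by blast
  then show ?case by (intro exI[of _ "e + \<mu>"]) (simp add: mult_single lookup_add)
qed

text \<open>Distinct monomials are sent to non-zero multiples of distinct monomials, so nothing
  cancels; \<open>inj\<close> expresses this by exponent vectors.\<close>

lemma subst_monomials_inj:
  fixes f :: "'k::field lss_poly" and e :: "lss_var \<Rightarrow> (lss_var \<Rightarrow>\<^sub>0 nat)"
  assumes U: "finite U" and f: "f \<in> polys_in U"
    and \<sigma>: "\<And>v. v \<in> U \<Longrightarrow> \<sigma> v = single (e v) (c v)" "\<And>v. v \<in> U \<Longrightarrow> c v \<noteq> 0"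
    and inj: "\<And>m m'. keys m \<subseteq> U \<Longrightarrow> keys m' \<subseteq> U \<Longrightarrow>
        (\<And>x. (\<Sum>v\<in>U. lookup m v * lookup (e v) x) = (\<Sum>v\<in>U. lookup m' v * lookup (e v) x)) \<Longrightarrow> m = m'"
    and zero: "subst Const \<sigma> f = 0"
  shows "f = 0"
proof -
  have prod: "\<exists>\<mu> d. (\<Prod>v\<in>A. \<sigma> v ^ lookup m v) = single \<mu> d \<and> d \<noteq> 0 \<and> (\<forall>x. lookup \<mu> x = (\<Sum>v\<in>A. lookup m v * lookup (e v) x))"
    if "finite A" "A \<subseteq> U" for A m
    using that
  proof (induction A)
    case empty
    show ?case by (intro exI[of _ 0] exI[of _ 1]) simp
  next
    case (insert v A)
    then obtain \<mu> d where 1: "(\<Prod>v\<in>A. \<sigma> v ^ lookup m v) = single \<mu> d" "d \<noteq> 0" "\<forall>x. lookup \<mu> x = (\<Sum>v\<in>A. lookup m v * lookup (e v) x)"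
      by auto
    obtain \<nu> where 2: "\<sigma> v ^ lookup m v = single \<nu> (c v ^ lookup m v)" "\<forall>x. lookup \<nu> x = lookup m v * lookup (e v) x"
      using single_power[of "e v" "c v" "lookup m v"] \<sigma>(1)[of v] insert.prems by auto
    show ?case
      using insert.hyps insert.prems 1 2 \<sigma>(2)[of v]
      by (intro exI[of _ "\<nu> + \<mu>"] exI[of _ "c v ^ lookup m v * d"]) (simp add: mult_single lookup_add)
  qed
  let ?Q = "\<lambda>m y. monom_val \<sigma> m = single (fst y) (snd y) \<and> snd y \<noteq> 0 \<and>
    (\<forall>x. lookup (fst y) x = (\<Sum>v\<in>U. lookup m v * lookup (e v) x))"
  have "\<forall>m\<in>{m. keys m \<subseteq> U}. \<exists>y. ?Q m y"
  proof
    fix m :: "lss_var \<Rightarrow>\<^sub>0 nat" assume "m \<in> {m. keys m \<subseteq> U}"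
    then have k: "keys m \<subseteq> U" by simp
    obtain \<mu> d where "(\<Prod>v\<in>U. \<sigma> v ^ lookup m v) = single \<mu> d" "d \<noteq> 0"
      "\<forall>x. lookup \<mu> x = (\<Sum>v\<in>U. lookup m v * lookup (e v) x)"
      using prod[OF U subset_refl, of m] by blast
    then show "\<exists>y. ?Q m y" unfolding monom_val_superset[OF U k] by (intro exI[of _ "(\<mu>, d)"]) simp
  qed
  from bchoice[OF this] obtain y where y: "\<forall>m\<in>{m. keys m \<subseteq> U}. ?Q m (y m)" by blast
  define \<mu> d where "\<mu> m = fst (y m)" and "d m = snd (y m)" for m
  have md: "\<And>m. keys m \<subseteq> U \<Longrightarrow> monom_val \<sigma> m = single (\<mu> m) (d m)"
    "\<And>m. keys m \<subseteq> U \<Longrightarrow> d m \<noteq> 0"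
    "\<And>m x. keys m \<subseteq> U \<Longrightarrow> lookup (\<mu> m) x = (\<Sum>v\<in>U. lookup m v * lookup (e v) x)"
    using y by (simp_all add: \<mu>_def d_def)
  have \<mu>_inj: "m = m'" if "keys m \<subseteq> U" "keys m' \<subseteq> U" "\<mu> m = \<mu> m'" for m m'
    using md(3)[OF that(1)] md(3)[OF that(2)] that(3) by (intro inj[OF that(1,2)]) simp
  have kU: "keys m \<subseteq> U" if "m \<in> keys f" for m using f that by (auto simp: polys_in_def)
  have "m \<notin> keys f" for m
  proof
    assume m: "m \<in> keys f"
    have "0 = lookup (subst Const \<sigma> f) (\<mu> m)" using zero by simp
    also have "subst Const \<sigma> f = (\<Sum>m'\<in>keys f. single (\<mu> m') (lookup f m' * d m'))"
      unfolding subst_def by (rule sum.cong) (use md(1) kU in \<open>simp_all add: Const_def mult_single\<close>)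
    also have "lookup \<dots> (\<mu> m) = (\<Sum>m'\<in>keys f. if m' = m then lookup f m' * d m' else 0)"
      unfolding lookup_sum
      by (rule sum.cong) (use \<mu>_inj kU m in \<open>auto simp: lookup_single when_def\<close>)
    also have "\<dots> = lookup f m * d m" using m by simp
    finally show False using m md(2)[OF kU[OF m]] by (simp add: in_keys_iff)
  qed
  then have "keys f = {}" by blast
  then show ?thesis by (metis sum.empty poly_mapping_expand)
qed

section \<open>Coordinates in which the edge generators are 2-minors\<close>

locale twisted_graph =
  fixes n :: nat and E :: "nat set set" and \<zeta> :: "nat \<Rightarrow> 'k::field" and a b :: "nat \<Rightarrow> lss_var"
  assumes graph: "simple_graph {1..n} E" and zeta: "\<And>i. \<zeta> i * \<zeta> i = 1"
    and ab: "\<And>i. {a i, b i} = {VX i, VY i}"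
begin

lemma index_ab [simp]: "var_index (a i) = i" "var_index (b i) = i"
proof -
  have "a i \<in> {VX i, VY i}" "b i \<in> {VX i, VY i}" using ab[of i] by blast+
  then show "var_index (a i) = i" "var_index (b i) = i" by auto
qed

lemma a_neq_b: "a i \<noteq> b i"
  using ab[of i] by (metis insert_absorb2 lss_var.distinct(1) singletonD insertI1 insertI2)

lemma var_cases: "v = a (var_index v) \<or> v = b (var_index v)"
proof -
  have "v \<in> {VX (var_index v), VY (var_index v)}" by (cases v) auto
  then show ?thesis using ab[of "var_index v"] by blast
qed

lemma zeta_neq_0 [simp]: "\<zeta> i \<noteq> 0" using zeta[of i] by auto

text \<open>The change of variables is not carried out as an automorphism: \<open>p i\<close> and
  \<open>q i\<close> are names, within the same ring, for the entries of column \<open>i\<close> of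
  the matrix whose 2-minors are taken.\<close>

definition p :: "nat \<Rightarrow> 'k lss_poly" where "p i = Const (\<zeta> i) * var_poly (a i)"
definition q :: "nat \<Rightarrow> 'k lss_poly" where "q i = var_poly (b i)"
definition minor :: "nat \<Rightarrow> nat \<Rightarrow> 'k lss_poly" where "minor i j = p i * q j - p j * q i"
definition edge_ideal :: "'k lss_poly set" where
  "edge_ideal = Idl\<^bsub>poly_S n\<^esub> {minor i j | i j. {i, j} \<in> E}"

lemma pq_S: "i \<in> {1..n} \<Longrightarrow> p i \<in> S n" "i \<in> {1..n} \<Longrightarrow> q i \<in> S n"
  by (simp_all add: p_def q_def)

lemma minor_S: "i \<in> {1..n} \<Longrightarrow> j \<in> {1..n} \<Longrightarrow> minor i j \<in> S n"
  unfolding minor_def using pq_S by simp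

lemma minors_sub: "{minor i j | i j. {i, j} \<in> E} \<subseteq> S n"
  using simple_graphD(4)[OF graph] minor_S by blast

lemma edge_ideal_ideal: "ideal edge_ideal (poly_S n)"
  unfolding edge_ideal_def using S.R.genideal_ideal minors_sub by simp

lemma edge_ideal_subset_iff:
  "ideal J (poly_S n) \<Longrightarrow> edge_ideal \<subseteq> J \<longleftrightarrow> (\<forall>i j. {i, j} \<in> E \<longrightarrow> minor i j \<in> J)"
  unfolding edge_ideal_def by (subst Idl_S_subset_iff[OF minors_sub]) auto

lemma minor_in_edge_ideal: "{i, j} \<in> E \<Longrightarrow> minor i j \<in> edge_ideal"
  using edge_ideal_subset_iff[OF edge_ideal_ideal] by simp

end

section \<open>Kernels of monomial substitutions\<close>

locale class_data = twisted_graph n E \<zeta> a b for n E and \<zeta> :: "nat \<Rightarrow> 'k::field" and a b +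
  fixes T :: "nat set" and r :: "nat \<Rightarrow> nat" and flip :: "nat \<Rightarrow> bool"
  assumes T_sub: "T \<subseteq> {1..n}" and r_mem: "\<And>i. i \<in> {1..n} - T \<Longrightarrow> r i \<in> {1..n} - T"
    and r_idem: "\<And>i. i \<in> {1..n} - T \<Longrightarrow> r (r i) = r i"
begin

text \<open>\<open>u i\<close> is the entry of column \<open>i\<close> that is kept,
  \<open>w i\<close> the dependent one. \<open>flip\<close> selects the row through the
  representative, once for each class, because a prime may contain all entries of a class in one
  row.\<close>

definition u where "u i = (if flip (r i) then b i else a i)"
definition w where "w i = (if flip (r i) then a i else b i)"

text \<open>Makes the columns of a class proportional: the dependent entry becomes the kept one
  times the common slope, with \<open>\<zeta> i\<close> cancelling the factor in \<open>p i\<close>.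
  The variable \<open>w (r i)\<close> of the representative doubles as the slope; the dependent
  entry of the representative itself is also replaced by a product with it.\<close>

definition full :: "lss_var \<Rightarrow> 'k lss_poly" where
  "full v = (let i = var_index v in
     if i \<in> T then 0
     else if i \<in> {1..n} \<and> v = w i then Const (\<zeta> i) * var_poly (u i) * var_poly (w (r i))
     else var_poly v)"

text \<open>The variables that are determined by the others: both at a deleted vertex, one at a
  vertex that is not a representative. Their number is the height of the kernel.\<close>

definition Dom :: "lss_var set" where
  "Dom = w ` {i \<in> {1..n} - T. r i \<noteq> i} \<union> VX ` T \<union> VY ` T"

text \<open>Interpolates between leaving all of \<open>Dom\<close> free and \<open>full\<close>.
  Imposing the relations for one variable of \<open>Dom\<close> after another yields the chain of
  primes.\<close>

definition stage :: "lss_var set \<Rightarrow> lss_var \<Rightarrow> 'k lss_poly" where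
  "stage D v = (if v \<in> Dom - D then var_poly v else full v)"

text \<open>In classical terms, the prime given by the variables at \<open>T\<close> and, for each
  class, the 2-minors of its columns.\<close>

definition kernel :: "'k lss_poly set" where "kernel = ker n full"

definition gen :: "lss_var \<Rightarrow> 'k lss_poly" where
  "gen v = (let i = var_index v in
     if i \<in> T then var_poly v
     else Const (\<zeta> (r i)) * var_poly (u (r i)) * var_poly v - Const (\<zeta> i) * var_poly (u i) * var_poly (w (r i)))"

lemma index_uw [simp]: "var_index (u i) = i" "var_index (w i) = i"
  by (auto simp: u_def w_def)

lemma u_neq_w: "u i \<noteq> w i" using a_neq_b[of i] a_neq_b[of i, symmetric] by (auto simp: u_def w_def)

lemma uw_cases: "v = u (var_index v) \<or> v = w (var_index v)"
  using var_cases[of v] by (auto simp: u_def w_def)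

lemma u_eq_w_iff [simp]: "u i \<noteq> w j" "w j \<noteq> u i"
  using u_neq_w by (metis index_uw)+

lemma u_eq_iff [simp]: "u i = u j \<longleftrightarrow> i = j" and w_eq_iff [simp]: "w i = w j \<longleftrightarrow> i = j"
  by (metis index_uw)+

lemma r_in: "i \<in> {1..n} \<Longrightarrow> i \<notin> T \<Longrightarrow> r i \<in> {1..n} \<and> r i \<notin> T \<and> r (r i) = r i"
  using r_mem r_idem by auto

lemma mem_Dom: "v \<in> Dom \<longleftrightarrow> var_index v \<in> T \<or>
    (var_index v \<in> {1..n} - T \<and> r (var_index v) \<noteq> var_index v \<and> v = w (var_index v))"
proof -
  have "v \<in> VX ` T \<union> VY ` T \<longleftrightarrow> var_index v \<in> T" by (cases v) auto
  then show ?thesis unfolding Dom_def by auto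
qed

lemma Dom_sub: "Dom \<subseteq> vars n"
  using T_sub by (auto simp: mem_Dom mem_vars)

lemma finite_Dom: "finite Dom" using Dom_sub card_vars(1) finite_subset by blast

lemma card_Dom: "card Dom + card (r ` ({1..n} - T)) = n + card T"
proof -
  let ?N = "{i \<in> {1..n} - T. r i \<noteq> i}" and ?R = "{i \<in> {1..n} - T. r i = i}"
  have finT: "finite T" using T_sub finite_subset by blast
  have rR: "r ` ({1..n} - T) = ?R"
  proof
    show "r ` ({1..n} - T) \<subseteq> ?R" using r_in by auto
    show "?R \<subseteq> r ` ({1..n} - T)" by force
  qed
  have "card ?N + card ?R = card ({1..n} - T)"
  proof -
    have "card (?N \<union> ?R) = card ?N + card ?R" by (rule card_Un_disjoint) auto
    moreover have "?N \<union> ?R = {1..n} - T" by blast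
    ultimately show ?thesis by simp
  qed
  moreover have "card ({1..n} - T) + card T = n"
    using T_sub finT by (simp add: card_Diff_subset card_mono[of "{1..n}" T, simplified])
  moreover have "card Dom = card ?N + (card T + card T)"
  proof -
    have "card (w ` ?N) = card ?N" "card (VX ` T) = card T" "card (VY ` T) = card T"
      by (simp_all add: card_image inj_on_def)
    moreover have "VX ` T \<inter> VY ` T = {}" by auto
    moreover have "w ` ?N \<inter> (VX ` T \<union> VY ` T) = {}"
    proof -
      have "v \<in> w ` ?N \<Longrightarrow> var_index v \<notin> T" "v \<in> VX ` T \<union> VY ` T \<Longrightarrow> var_index v \<in> T" for v by auto
      then show ?thesis by blast
    qed
    ultimately show ?thesis unfolding Dom_def Un_assoc using finT by (simp add: card_Un_disjoint)
  qed
  ultimately show ?thesis unfolding rR by linarith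
qed

lemma u_notin_Dom: "i \<notin> T \<Longrightarrow> u i \<notin> Dom" by (simp add: mem_Dom)

lemma rep_notin_Dom: "i \<in> {1..n} - T \<Longrightarrow> w (r i) \<notin> Dom" using r_in by (simp add: mem_Dom)

lemma full_T: "var_index v \<in> T \<Longrightarrow> full v = 0" by (simp add: full_def Let_def)

lemma full_u: "i \<in> {1..n} \<Longrightarrow> i \<notin> T \<Longrightarrow> full (u i) = var_poly (u i)"
  by (simp add: full_def Let_def)

lemma full_w: "i \<in> {1..n} \<Longrightarrow> i \<notin> T \<Longrightarrow> full (w i) = Const (\<zeta> i) * var_poly (u i) * var_poly (w (r i))"
  by (simp add: full_def Let_def)

text \<open>The images under \<open>full\<close> contain no variable of \<open>Dom\<close>, so a
  substitution that moves only variables of \<open>Dom\<close> leaves them alone.\<close>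

lemma subst_full_avoiding_Dom:
  assumes "\<And>x. x \<notin> Dom \<Longrightarrow> \<tau> x = var_poly x" "v \<in> Dom \<or> \<tau> v = var_poly v"
  shows "subst Const \<tau> (full v) = full v"
proof -
  let ?i = "var_index v"
  consider "?i \<in> T" | "?i \<notin> T" "?i \<in> {1..n}" "v = w ?i" | "?i \<notin> T" "\<not> (?i \<in> {1..n} \<and> v = w ?i)" by blast
  then show ?thesis
  proof cases
    case 1
    then show ?thesis by (simp add: full_T)
  next
    case 2
    then have "full v = Const (\<zeta> ?i) * var_poly (u ?i) * var_poly (w (r ?i))"
      using full_w by metis
    then show ?thesis using assms(1)[OF u_notin_Dom[OF 2(1)]] assms(1)[OF rep_notin_Dom] 2 by simp
  next
    case 3
    then have "full v = var_poly v" by (auto simp: full_def Let_def)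
    moreover have "v \<notin> Dom" using 3 by (auto simp: mem_Dom)
    ultimately show ?thesis using assms by simp
  qed
qed

lemma prime_kernel: "primeideal kernel (poly_S n)"
  unfolding kernel_def by (rule primeideal_ker)

lemma gen_S: "v \<in> Dom \<Longrightarrow> gen v \<in> S n"
proof -
  assume v: "v \<in> Dom"
  let ?i = "var_index v"
  have vS: "(var_poly v :: 'k lss_poly) \<in> S n" using v subsetD[OF Dom_sub, of v] unfolding var_S mem_vars by simp
  show ?thesis
  proof (cases "?i \<in> T")
    case True
    then show ?thesis using vS by (simp add: gen_def Let_def)
  next
    case False
    then have "?i \<in> {1..n}" "r ?i \<in> {1..n}" using v r_in by (auto simp: mem_Dom)
    then show ?thesis using False vS by (simp add: gen_def Let_def)
  qed
qed

lemma gen_w: "i \<notin> T \<Longrightarrow> gen (w i) =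
    Const (\<zeta> (r i)) * var_poly (u (r i)) * var_poly (w i) - Const (\<zeta> i) * var_poly (u i) * var_poly (w (r i))"
  by (simp add: gen_def Let_def)

lemma gen_in_kernel: "v \<in> Dom \<Longrightarrow> subst Const full (gen v) = 0"
proof -
  assume v: "v \<in> Dom"
  let ?i = "var_index v"
  show ?thesis
  proof (cases "?i \<in> T")
    case True
    then show ?thesis by (simp add: gen_def Let_def full_T)
  next
    case False
    then have i: "?i \<in> {1..n}" "v = w ?i" using v by (auto simp: mem_Dom)
    then have r: "r ?i \<in> {1..n}" "r ?i \<notin> T" "r (r ?i) = r ?i" using r_in False by auto
    have "subst Const full (gen (w ?i)) = 0"
      unfolding gen_w[OF False] using full_w[OF i(1) False] full_u[OF i(1) False] full_w[OF r(1,2)] full_u[OF r(1,2)] r(3)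
      by (simp add: algebra_simps)
    then show ?thesis using i(2) by simp
  qed
qed

text \<open>The larger stage factors through the smaller one by substituting for \<open>v\<close>
  alone. The element \<open>gen v\<close> shows strictness: it is the relation that has just been
  imposed.\<close>

lemma chain_step:
  assumes D: "D \<subseteq> Dom" "v \<in> Dom" "v \<notin> D"
  shows "ker n (stage D) \<subset> ker n (stage (insert v D))"
proof -
  define \<tau> where "\<tau> x = (if x = v then full v else var_poly x)" for x
  have \<tau>_id: "\<tau> x = var_poly x" if "x \<notin> Dom" for x using that D by (auto simp: \<tau>_def)
  have "stage (insert v D) x = subst Const \<tau> (stage D x)" for x
  proof (cases "x \<in> Dom - D")
    case True
    then show ?thesis using D by (auto simp: stage_def \<tau>_def)
  next
    case False
    have "x \<in> Dom \<or> \<tau> x = var_poly x" using \<tau>_id by blast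
    then have "subst Const \<tau> (full x) = full x" using subst_full_avoiding_Dom \<tau>_id by blast
    then show ?thesis using False D by (auto simp: stage_def)
  qed
  then have "subst Const (stage (insert v D)) f = subst Const \<tau> (subst Const (stage D) f)" for f
    by (rule subst_comp)
  then have sub: "ker n (stage D) \<subseteq> ker n (stage (insert v D))" by (auto simp: ker_def)
  have stage_v: "stage D v = var_poly v" "stage (insert v D) v = full v" using D by (auto simp: stage_def)
  have st: "stage D' x = full x" if "x \<notin> Dom" for x D' using that by (simp add: stage_def)
  have "gen v \<in> ker n (stage (insert v D)) - ker n (stage D)"
  proof (cases "var_index v \<in> T")
    case True
    have "(var_poly v :: 'k lss_poly) \<noteq> 0" by (simp add: var_poly_def) (metis lookup_single_eq lookup_zero one_neq_zero)
    then show ?thesis using gen_S[OF D(2)] stage_v True full_T by (simp add: gen_def Let_def ker_def)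
  next
    case False
    define i where "i = var_index v"
    have i: "i \<in> {1..n}" "i \<notin> T" "v = w i" "r i \<noteq> i" using D(2) False by (auto simp: mem_Dom i_def)
    then have r: "r i \<in> {1..n}" "r i \<notin> T" "r (r i) = r i" using r_in by auto
    have nD: "u i \<notin> Dom" "u (r i) \<notin> Dom" "w (r i) \<notin> Dom" using u_notin_Dom rep_notin_Dom i r by auto
    have "subst Const (stage (insert v D)) (gen v) = subst Const full (gen v)"
      unfolding i(3) gen_w[OF i(2)] using st nD stage_v i(3) by simp
    then have 1: "gen v \<in> ker n (stage (insert v D))" using gen_in_kernel[OF D(2)] gen_S[OF D(2)] by (simp add: ker_def)
    have 2: "subst Const (stage D) (gen v) = Const (\<zeta> (r i)) * var_poly (u (r i)) * var_poly (w i)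
        - Const (\<zeta> i) * var_poly (u i) * (Const (\<zeta> (r i)) * var_poly (u (r i)) * var_poly (w (r i)))"
      unfolding i(3) gen_w[OF i(2)] using st nD stage_v i(3) full_u[OF i(1,2)] full_u[OF r(1,2)] full_w[OF r(1,2)] r(3) by simp
    \<comment> \<open>Slope 0 and all other variables 1: the term containing the slope vanishes and
      the other one becomes a non-zero constant.\<close>
    define \<rho> :: "lss_var \<Rightarrow> 'k lss_poly" where "\<rho> x = (if x = w (r i) then 0 else 1)" for x
    have "subst Const \<rho> (subst Const (stage D) (gen v)) = Const (\<zeta> (r i))"
      unfolding 2 using i(4) by (simp add: \<rho>_def)
    then have "subst Const (stage D) (gen v) \<noteq> 0" by auto
    then show ?thesis using 1 by (simp add: ker_def)
  qed
  then show ?thesis using sub by blast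
qed

lemma chain_stage:
  assumes "finite D" "D \<subseteq> Dom"
  shows "prime_chain (poly_S n) (card D) (ker n (stage D))"
  using assms
proof (induction D)
  case empty
  then show ?case using prime_chain_0[OF primeideal_ker] by simp
next
  case (insert v D)
  then have "prime_chain (poly_S n) (Suc (card D)) (ker n (stage (insert v D)))"
    using prime_chain_Suc[OF _ primeideal_ker chain_step[of D v]] by simp
  then show ?case using insert by simp
qed

lemma chain_kernel: "prime_chain (poly_S n) (card Dom) kernel"
proof -
  have "stage Dom = full" by (rule ext) (simp add: stage_def)
  then show ?thesis using chain_stage[OF finite_Dom subset_refl] by (simp add: kernel_def)
qed

text \<open>Outside \<open>Dom\<close> the map of exponents is triangular: the exponent of a slope
  is unchanged and that of \<open>u i\<close> grows by the exponent of \<open>w i\<close>. Both can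
  therefore be recovered from the image.\<close>

lemma kernel_free:
  assumes f: "f \<in> polys_in (vars n - Dom)" and z: "subst Const full f = 0"
  shows "f = 0"
proof -
  let ?U = "vars n - Dom"
  define rep where "rep v \<longleftrightarrow> v = w (var_index v)" for v
  define e where "e v = (if rep v then single (u (var_index v)) 1 + single v 1 else single v (1::nat))" for v
  define c where "c v = (if rep v then \<zeta> (var_index v) else 1)" for v
  have full_U: "full v = single (e v) (c v)" if v: "v \<in> ?U" for v
  proof -
    let ?i = "var_index v"
    have i: "?i \<in> {1..n}" "?i \<notin> T" using v by (auto simp: mem_vars mem_Dom)
    show ?thesis
    proof (cases "rep v")
      case True
      then have "v = w ?i" by (simp add: rep_def)
      moreover have "r ?i = ?i" using True v i by (auto simp: mem_Dom rep_def)
      ultimately have "full v = Const (\<zeta> ?i) * var_poly (u ?i) * var_poly v" using full_w[OF i] by simp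
      then show ?thesis using True by (simp add: e_def c_def Const_def var_poly_def mult_single)
    next
      case False
      then show ?thesis using i by (simp add: full_def Let_def rep_def e_def c_def var_poly_def)
    qed
  qed
  show ?thesis
  proof (rule subst_monomials_inj[OF _ f full_U _ _ z])
    show "finite ?U" using card_vars by simp
    show "\<And>v. v \<in> ?U \<Longrightarrow> c v \<noteq> 0" by (simp add: c_def)
    fix m m' assume m: "keys m \<subseteq> ?U" and m': "keys m' \<subseteq> ?U"
      and eq: "\<And>x. (\<Sum>v\<in>?U. lookup m v * lookup (e v) x) = (\<Sum>v\<in>?U. lookup m' v * lookup (e v) x)"
    have sum_w: "(\<Sum>v\<in>?U. lookup l v * lookup (e v) x) = lookup l x" if "keys l \<subseteq> ?U" "rep x" for l x
    proof -
      have "(\<Sum>v\<in>?U. lookup l v * lookup (e v) x) = (\<Sum>v\<in>?U. if v = x then lookup l v else 0)"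
      proof (rule sum.cong)
        fix v
        have "u i \<noteq> x" for i using that(2) u_eq_w_iff(1) by (metis rep_def)
        then show "lookup l v * lookup (e v) x = (if v = x then lookup l v else 0)"
          by (simp add: e_def lookup_add lookup_single when_def)
      qed simp
      also have "\<dots> = lookup l x" using that card_vars(1) by (auto simp: in_keys_iff)
      finally show ?thesis .
    qed
    have sum_u: "(\<Sum>v\<in>?U. lookup l v * lookup (e v) x) = lookup l x + lookup l (w (var_index x))"
      if l: "keys l \<subseteq> ?U" and x: "\<not> rep x" for l x
    proof -
      have xu: "x = u (var_index x)" using x uw_cases[of x] by (auto simp: rep_def)
      have "(\<Sum>v\<in>?U. lookup l v * lookup (e v) x) =
          (\<Sum>v\<in>?U. (if v = x then lookup l v else 0) + (if v = w (var_index x) then lookup l v else 0))"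
      proof (rule sum.cong)
        fix v
        have "rep v \<Longrightarrow> u (var_index v) = x \<longleftrightarrow> v = w (var_index x)"
          using xu by (metis index_uw rep_def)
        moreover have "rep (w (var_index x))" by (simp add: rep_def)
        ultimately show "lookup l v * lookup (e v) x =
          (if v = x then lookup l v else 0) + (if v = w (var_index x) then lookup l v else 0)"
          using x by (auto simp: e_def lookup_add lookup_single when_def)
      qed simp
      also have "\<dots> = lookup l x + lookup l (w (var_index x))"
        using l card_vars(1) by (auto simp: sum.distrib in_keys_iff)
      finally show ?thesis .
    qed
    show "m = m'"
    proof (rule poly_mapping_eqI)
      fix x
      have repw: "rep (w i)" for i by (simp add: rep_def)
      show "lookup m x = lookup m' x"
        using eq[of x] sum_w[OF m] sum_w[OF m'] sum_u[OF m] sum_u[OF m'] eq[of "w (var_index x)"] repw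
        by (cases "rep x") auto
    qed
  qed
qed

text \<open>Exactly \<open>2 * n - card Dom\<close> variables stay independent modulo the kernel, so
  the counting bound meets the length of the explicit chain.\<close>

lemma height_kernel: "prime_height (poly_S n) kernel = enat (card Dom)"
proof (rule antisym)
  show "enat (card Dom) \<le> prime_height (poly_S n) kernel" using chain_kernel by (rule prime_height_ge)
  have "k \<le> card Dom" if "prime_chain (poly_S n) k kernel" for k
  proof -
    have "k + card (vars n - Dom) \<le> 2 * n"
      by (rule prime_chain_le[OF that]) (use kernel_free in \<open>auto simp: kernel_def ker_def polys_in_def\<close>)
    moreover have "card (vars n - Dom) = 2 * n - card Dom" "card Dom \<le> 2 * n"
      using Dom_sub card_vars finite_Dom card_mono[of "vars n" Dom] by (simp_all add: card_Diff_subset)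
    ultimately show ?thesis by simp
  qed
  then show "prime_height (poly_S n) kernel \<le> enat (card Dom)"
    unfolding prime_height_alt by (intro Sup_least) auto
qed

end

lemma prime_S:
  assumes "primeideal P (poly_S n)"
  shows prime_S_sub: "P \<subseteq> S n" and prime_S_0: "0 \<in> P" and prime_S_1: "1 \<notin> P"
    and prime_S_add: "\<And>x y. x \<in> P \<Longrightarrow> y \<in> P \<Longrightarrow> x + y \<in> P"
    and prime_S_mult: "\<And>x y. x \<in> S n \<Longrightarrow> y \<in> P \<Longrightarrow> x * y \<in> P"
    and prime_S_notin: "\<And>x y. x \<in> S n \<Longrightarrow> y \<in> S n \<Longrightarrow> x \<notin> P \<Longrightarrow> y \<notin> P \<Longrightarrow> x * y \<notin> P"
    and prime_S_Const: "\<And>c. c \<noteq> 0 \<Longrightarrow> Const c \<notin> P"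
proof -
  show 1: "P \<subseteq> S n" "0 \<in> P" "1 \<notin> P" "\<And>x y. x \<in> P \<Longrightarrow> y \<in> P \<Longrightarrow> x + y \<in> P"
    and m: "\<And>x y. x \<in> S n \<Longrightarrow> y \<in> P \<Longrightarrow> x * y \<in> P"
    and "\<And>x y. x \<in> S n \<Longrightarrow> y \<in> S n \<Longrightarrow> x \<notin> P \<Longrightarrow> y \<notin> P \<Longrightarrow> x * y \<notin> P"
    using assms by (auto simp: primeideal_S_iff ideal_S_iff)
  fix c :: 'a assume "c \<noteq> 0"
  then have "Const (1 / c) * Const c = 1" using Const_simps(4)[of "1 / c" c] by simp
  then show "Const c \<notin> P" using m[OF Const_S, of "Const c" "1 / c"] 1(3) by auto
qed

lemma ideal_S_diff: "ideal J (poly_S n) \<Longrightarrow> x \<in> J \<Longrightarrow> y \<in> J \<Longrightarrow> x - y \<in> J"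
  using S.uminus_S[OF S.one_S, of n] unfolding ideal_S_iff by (metis add_uminus_conv_diff mult_minus1)

lemma ideal_S_mult: "ideal J (poly_S n) \<Longrightarrow> x \<in> S n \<Longrightarrow> y \<in> J \<Longrightarrow> x * y \<in> J"
  and ideal_S_add: "ideal J (poly_S n) \<Longrightarrow> x \<in> J \<Longrightarrow> y \<in> J \<Longrightarrow> x + y \<in> J"
  and ideal_S_0: "ideal J (poly_S n) \<Longrightarrow> 0 \<in> J"
  by (simp_all add: ideal_S_iff)

section \<open>Identities between 2-minors\<close>

context twisted_graph
begin

lemma Const_zeta [simp]: "Const (\<zeta> i) * Const (\<zeta> i) = 1" "Const (\<zeta> i) * (Const (\<zeta> i) * x) = x"
  using Const_simps(4)[of "\<zeta> i" "\<zeta> i"] zeta[of i] by (simp_all add: mult.assoc[symmetric])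

lemma minor_self [simp]: "minor i i = 0" by (simp add: minor_def)

lemma minor_swap: "minor j i = - minor i j" by (simp add: minor_def)

text \<open>Expansions of the 3-minors with a repeated row, which vanish. They make proportionality
  of columns transitive through any column \<open>j\<close> with an entry that can be divided
  out.\<close>

lemma minor_p_relation: "p j * minor i k = p i * minor j k + p k * minor i j"
  and minor_q_relation: "q j * minor i k = q i * minor j k + q k * minor i j"
  by (simp_all add: minor_def algebra_simps)

text \<open>Cramer's rule for column \<open>v\<close> in terms of columns \<open>i\<close> and
  \<open>j\<close>. If \<open>v\<close> is adjacent to both, it puts the entries of column
  \<open>v\<close> into the edge ideal wherever \<open>minor i j\<close> is invertible.\<close>

lemma minor_cramer: "p v * minor i j = p i * minor v j - p j * minor v i"
  "q v * minor i j = q i * minor v j - q j * minor v i"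
  by (simp_all add: minor_def algebra_simps)

lemma minor_comb: "minor i j \<in> J" if "ideal J (poly_S n)" "i \<in> {1..n}" "j \<in> {1..n}"
  "var_poly (a i) \<in> J" "var_poly (b i) \<in> J" for J
proof -
  have "minor i j = (Const (\<zeta> i) * q j) * var_poly (a i) - p j * var_poly (b i)"
    by (simp add: minor_def p_def q_def algebra_simps)
  then show ?thesis using that pq_S by (simp add: ideal_S_diff ideal_S_mult)
qed

end

section \<open>Comparing kernels with the edge ideal and with other primes\<close>

context class_data
begin

abbreviation U where "U i \<equiv> (var_poly (u i) :: 'k lss_poly)"
abbreviation W where "W i \<equiv> (var_poly (w i) :: 'k lss_poly)"

lemma pq_UW: "p i = (if flip (r i) then Const (\<zeta> i) * W i else Const (\<zeta> i) * U i)"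
  "q i = (if flip (r i) then U i else W i)"
  by (simp_all add: p_def q_def u_def w_def)

lemma subst_pq:
  assumes "i \<in> {1..n}" "i \<notin> T"
  shows "subst Const full (p i) = (if flip (r i) then U i * W (r i) else Const (\<zeta> i) * U i)"
    "subst Const full (q i) = (if flip (r i) then U i else Const (\<zeta> i) * U i * W (r i))"
  using full_u[OF assms] full_w[OF assms] by (simp_all add: pq_UW mult.assoc)

lemma edge_ideal_subset_kernel:
  assumes "\<And>i j. {i, j} \<in> E \<Longrightarrow> i \<notin> T \<Longrightarrow> j \<notin> T \<Longrightarrow> r i = r j"
  shows "edge_ideal \<subseteq> kernel"
proof -
  have id: "ideal kernel (poly_S n)" using prime_kernel by (simp add: primeideal_S_iff)
  have "minor i j \<in> kernel" if e: "{i, j} \<in> E" for i j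
  proof -
    have ij: "i \<in> {1..n}" "j \<in> {1..n}" using simple_graphD(4)[OF graph e] by auto
    have T0: "minor i j \<in> kernel" if "i \<in> T" "i \<in> {1..n}" "j \<in> {1..n}" for i j
      by (rule minor_comb[OF id that(2,3)]) (use that full_T in \<open>simp_all add: kernel_def ker_def\<close>)
    consider "i \<in> T" | "j \<in> T" | "i \<notin> T" "j \<notin> T" by blast
    then show ?thesis
    proof cases
      case 1
      then show ?thesis using T0 ij by simp
    next
      case 2
      then have "0 - minor j i \<in> kernel" using T0[of j i] ij ideal_S_diff[OF id ideal_S_0[OF id]] by simp
      then show ?thesis using minor_swap[of i j] by simp
    next
      case 3
      then have "r i = r j" using assms e by blast
      then have "subst Const full (minor i j) = 0"
        unfolding minor_def using subst_pq[OF ij(1) 3(1)] subst_pq[OF ij(2) 3(2)]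
        by (simp add: algebra_simps)
      then show ?thesis using minor_S[OF ij] by (simp add: kernel_def ker_def)
    qed
  qed
  then show ?thesis using edge_ideal_subset_iff[OF id] by simp
qed

text \<open>Different classes have independent slopes. Slope 0 for the class of \<open>i\<close>,
  slope 1 for the class of \<open>j\<close> and 1 for all kept entries give a non-zero
  minor.\<close>

lemma minor_notin_kernel:
  assumes i: "i \<in> {1..n}" "i \<notin> T" and j: "j \<in> {1..n}" "j \<notin> T" and ne: "r i \<noteq> r j"
  shows "minor i j \<notin> kernel"
proof
  assume "minor i j \<in> kernel"
  then have z: "subst Const full (minor i j) = 0" by (simp add: kernel_def ker_def)
  define \<rho> :: "lss_var \<Rightarrow> 'k lss_poly" where "\<rho> x = (if x = w (r i) then 0 else 1)" for x
  have "subst Const \<rho> (subst Const full (minor i j)) \<noteq> 0"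
    unfolding minor_def using subst_pq[OF i] subst_pq[OF j] ne
    by (simp add: \<rho>_def mult.assoc[symmetric] flip: Const_simps(4))
  then show False using z by simp
qed

lemma gen_minor:
  assumes "i \<in> {1..n}" "i \<notin> T"
  shows "\<exists>c. c \<noteq> 0 \<and> gen (w i) = Const c * minor (r i) i"
proof (cases "flip (r i)")
  case True
  have rr: "r (r i) = r i" using r_in assms by blast
  have "gen (w i) = - (Const (\<zeta> (r i)) * Const (\<zeta> i)) * minor (r i) i"
    unfolding gen_w[OF assms(2)] minor_def pq_UW using True rr by (simp add: algebra_simps)
  then show ?thesis by (intro exI[of _ "- (\<zeta> (r i) * \<zeta> i)"]) simp
next
  case False
  have rr: "r (r i) = r i" using r_in assms by blast
  have "gen (w i) = minor (r i) i"
    unfolding gen_w[OF assms(2)] minor_def pq_UW using False rr by (simp add: algebra_simps)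
  then show ?thesis by (intro exI[of _ 1]) simp
qed

text \<open>Modulo the generators, every polynomial becomes, after multiplication by a product of
  variables \<open>u\<close> outside the prime, a polynomial in the variables outside \<open>Dom\<close>, on which the
  substitution is injective.\<close>

lemma kernel_subset:
  assumes P: "primeideal P (poly_S n)" and g: "\<And>v. v \<in> Dom \<Longrightarrow> gen v \<in> P"
    and u: "\<And>i. i \<in> {1..n} - T \<Longrightarrow> U i \<notin> P"
  shows "kernel \<subseteq> P"
proof
  note PS = prime_S[OF P]
  have idP: "ideal P (poly_S n)" using P by (simp add: primeideal_S_iff)
  define F where "F = (polys_in (vars n - Dom) :: 'k lss_poly set)"
  \<comment> \<open>Two congruences are carried along: modulo \<open>P\<close>, which finally yields
    \<open>s * f \<in> P\<close>, and under the substitution, which shows that the reduced form of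
    an \<open>f\<close> in the kernel is itself sent to 0.\<close>
  define J where "J = {x \<in> P. subst Const full x = 0}"
  have FS: "F \<subseteq> S n" unfolding F_def by (rule polys_in_S) blast
  have F_ops: "x + y \<in> F" "x * y \<in> F" if "x \<in> F" "y \<in> F" for x y
    using that polys_in_add polys_in_mult by (auto simp: F_def)
  have J_ops: "x + y \<in> J" "z * x \<in> J" if "x \<in> J" "y \<in> J" "z \<in> S n" for x y z
    using that PS(4,5) by (auto simp: J_def)
  have zJ: "0 \<in> J" using PS(2) by (simp add: J_def)
  have claim: "\<exists>s g. s \<in> F \<and> s \<notin> P \<and> g \<in> F \<and> s * f - g \<in> J" if "f \<in> S n" for f
    using that
  proof (induction rule: S_induct)
    case (Const c)
    have "(1::'k lss_poly) \<in> F" using polys_in_Const[of 1] by (simp add: F_def)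
    then show ?case using PS(3) zJ polys_in_Const by (intro exI[of _ 1] exI[of _ "Const c"]) (simp add: F_def)
  next
    case (var v)
    have v: "v \<in> vars n" using var by (simp only: mem_vars)
    have one: "(1::'k lss_poly) \<in> F" using polys_in_Const[of 1] by (simp add: F_def)
    show ?case
    proof (cases "v \<in> Dom")
      case False
      then have "var_poly v \<in> F" using v by (simp add: F_def)
      then show ?thesis using PS(3) zJ one by (intro exI[of _ 1] exI[of _ "var_poly v"]) simp
    next
      case True
      show ?thesis
      proof (cases "var_index v \<in> T")
        case T: True
        then have "var_poly v \<in> J" using g[OF True] full_T by (simp add: gen_def Let_def J_def)
        moreover have "0 \<in> F" using polys_in_Const[of 0] by (simp add: F_def)
        ultimately show ?thesis using PS(3) one by (intro exI[of _ 1] exI[of _ 0]) simp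
      next
        case False
        define i where "i = var_index v"
        have i: "i \<in> {1..n}" "i \<notin> T" "v = w i" using True False by (auto simp: mem_Dom i_def)
        have r: "r i \<in> {1..n}" "r i \<notin> T" using r_in i by auto
        have U_mem: "U k \<in> F" if "k \<in> {1..n}" "k \<notin> T" for k
          using that u_notin_Dom[of k] by (simp add: F_def mem_vars)
        have W_mem: "W (r i) \<in> F" using rep_notin_Dom[of i] i r by (simp add: F_def mem_vars)
        have C_mem: "Const c \<in> F" for c by (simp add: F_def)
        let ?s = "Const (\<zeta> (r i)) * U (r i)" and ?g = "Const (\<zeta> i) * U i * W (r i)"
        have "?s \<notin> P" using PS(6)[of "Const (\<zeta> (r i))" "U (r i)"] PS(7) u[of "r i"] r by simp
        moreover have "?s \<in> F" by (rule F_ops(2)[OF C_mem U_mem[OF r]])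
        moreover have "?g \<in> F" by (rule F_ops(2)[OF F_ops(2)[OF C_mem U_mem[OF i(1,2)]] W_mem])
        moreover have "?s * var_poly v - ?g = gen v" unfolding i(3) gen_w[OF i(2)] ..
        then have "?s * var_poly v - ?g \<in> J"
          using g[OF True] gen_in_kernel[OF True] unfolding J_def by simp
        ultimately show ?thesis by (intro exI[of _ ?s] exI[of _ ?g] conjI)
      qed
    qed
  next
    case (add f1 f2)
    then obtain s1 g1 s2 g2 where 1: "s1 \<in> F" "s1 \<notin> P" "g1 \<in> F" "s1 * f1 - g1 \<in> J"
      and 2: "s2 \<in> F" "s2 \<notin> P" "g2 \<in> F" "s2 * f2 - g2 \<in> J" by blast
    have "s2 * (s1 * f1 - g1) + s1 * (s2 * f2 - g2) \<in> J"
      by (rule J_ops(1)[OF J_ops(2)[OF 1(4) 1(4)] J_ops(2)[OF 2(4) 2(4)] S.zero_S]) (use 1 2 FS in auto)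
    then have "(s1 * s2) * (f1 + f2) - (s2 * g1 + s1 * g2) \<in> J" by (simp add: algebra_simps)
    moreover have "s1 * s2 \<notin> P" by (rule PS(6)) (use 1 2 FS in auto)
    moreover have "s1 * s2 \<in> F" by (rule F_ops(2)[OF 1(1) 2(1)])
    moreover have "s2 * g1 + s1 * g2 \<in> F"
      by (rule F_ops(1)[OF F_ops(2)[OF 2(1) 1(3)] F_ops(2)[OF 1(1) 2(3)]])
    ultimately show ?case by (intro exI[of _ "s1 * s2"] exI[of _ "s2 * g1 + s1 * g2"] conjI)
  next
    case (mult f1 f2)
    then obtain s1 g1 s2 g2 where 1: "s1 \<in> F" "s1 \<notin> P" "g1 \<in> F" "s1 * f1 - g1 \<in> J"
      and 2: "s2 \<in> F" "s2 \<notin> P" "g2 \<in> F" "s2 * f2 - g2 \<in> J" by blast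
    have "s2 * f2 \<in> S n" using mult(2) 2(1) FS by auto
    then have "(s2 * f2) * (s1 * f1 - g1) + g1 * (s2 * f2 - g2) \<in> J"
      by (intro J_ops(1)[OF J_ops(2)[OF 1(4) 1(4)] J_ops(2)[OF 2(4) 2(4)] S.zero_S]) (use 1 FS in auto)
    then have "(s1 * s2) * (f1 * f2) - (g1 * g2) \<in> J" by (simp add: algebra_simps)
    moreover have "s1 * s2 \<notin> P" by (rule PS(6)) (use 1 2 FS in auto)
    moreover have "s1 * s2 \<in> F" by (rule F_ops(2)[OF 1(1) 2(1)])
    moreover have "g1 * g2 \<in> F" by (rule F_ops(2)[OF 1(3) 2(3)])
    ultimately show ?case by (intro exI[of _ "s1 * s2"] exI[of _ "g1 * g2"] conjI)
  qed
  fix f assume "f \<in> kernel"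
  then have f: "f \<in> S n" "subst Const full f = 0" by (auto simp: kernel_def ker_def)
  obtain s h where sh: "s \<in> F" "s \<notin> P" "h \<in> F" "s * f - h \<in> J" using claim[OF f(1)] by blast
  have "subst Const full h = 0" using sh(4) f(2) by (simp add: J_def)
  then have "h = 0" using kernel_free sh(3) by (simp add: F_def)
  then have "s * f \<in> P" using sh(4) by (simp add: J_def)
  then show "f \<in> P" using PS(6) sh(1,2) f(1) FS by blast
qed

section \<open>Derivatives at the generic point of a kernel\<close>

definition lift_subst :: "lss_var \<Rightarrow> 'k lss_poly \<Rightarrow> 'k lss_poly poly" where
  "lift_subst d = subst (\<lambda>k. [:Const k:]) (\<lambda>v. [:full v, if v = d then 1 else 0:])"

text \<open>The coefficient of the dual variable is the partial derivative by \<open>d\<close>, modulo the kernel.\<close>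

definition deriv :: "lss_var \<Rightarrow> 'k lss_poly \<Rightarrow> 'k lss_poly" where
  "deriv d f = poly.coeff (lift_subst d f) 1"

lemma coeff_hom_pCons: "coeff_hom (\<lambda>k :: 'k. [:Const k:])"
  by unfold_locales (simp_all add: one_pCons)

text \<open>Setting the dual variable to 0 gives back \<open>full\<close>. Only the coefficients 0
  and 1 of \<open>lift_subst\<close> are ever read, so an ordinary polynomial variable can stand for
  the dual number.\<close>

lemma lift_subst_0: 
  assumes "f \<in> S n" shows "poly.coeff (lift_subst d f) 0 = subst Const full f"
proof -
  interpret L: coeff_hom "\<lambda>k :: 'k. [:Const k:]" by (rule coeff_hom_pCons)
  show ?thesis using assms
  proof (induction rule: S_induct)
  qed (simp_all add: lift_subst_def coeff_mult)
qed

lemma deriv_simps: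
  "deriv d (f + g) = deriv d f + deriv d g" "deriv d (f - g) = deriv d f - deriv d g"
  "deriv d (Const c) = 0" "deriv d (var_poly v) = (if v = d then 1 else 0)"
  "deriv d (sum h A) = (\<Sum>x\<in>A. deriv d (h x))"
proof -
  interpret L: coeff_hom "\<lambda>k :: 'k. [:Const k:]" by (rule coeff_hom_pCons)
  show "deriv d (f + g) = deriv d f + deriv d g" "deriv d (f - g) = deriv d f - deriv d g"
    "deriv d (Const c) = 0" "deriv d (var_poly v) = (if v = d then 1 else 0)"
    "deriv d (sum h A) = (\<Sum>x\<in>A. deriv d (h x))"
    by (simp_all add: deriv_def lift_subst_def coeff_sum)
qed

text \<open>The Leibniz rule at the generic point: undifferentiated factors are evaluated by
  \<open>full\<close>, so one term drops out when a factor lies in the kernel.\<close>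

lemma deriv_mult:
  assumes "f \<in> S n" "g \<in> S n"
  shows "deriv d (f * g) = subst Const full f * deriv d g + deriv d f * subst Const full g"
proof -
  interpret L: coeff_hom "\<lambda>k :: 'k. [:Const k:]" by (rule coeff_hom_pCons)
  have "lift_subst d (f * g) = lift_subst d f * lift_subst d g" by (simp add: lift_subst_def)
  then show ?thesis using lift_subst_0 assms
    by (simp add: deriv_def coeff_mult)
qed

text \<open>Among the variables of \<open>Dom\<close>, only \<open>v\<close> itself occurs in
  \<open>gen v\<close>. It occurs linearly, with coefficient 1 or a non-zero multiple of
  \<open>u (r i)\<close>, and the latter is not killed by \<open>full\<close>.\<close>

lemma deriv_gen:
  assumes d: "d \<in> Dom" and v: "v \<in> Dom"
  shows "v \<noteq> d \<Longrightarrow> deriv d (gen v) = 0" "deriv d (gen d) \<noteq> 0"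
proof -
  have nd: "x \<noteq> d" if "x \<notin> Dom" for x using d that by blast
  have formula: "deriv d (gen v) = (if v = d then Const (\<zeta> (r i)) * U (r i) else 0)"
    if v: "v \<in> Dom" "var_index v \<notin> T" "i = var_index v" for v i
  proof -
    have i: "i \<in> {1..n}" "i \<notin> T" "v = w i" using v by (auto simp: mem_Dom)
    have r: "r i \<in> {1..n}" "r i \<notin> T" using r_in i by auto
    have ne: "u (r i) \<noteq> d" "u i \<noteq> d" "w (r i) \<noteq> d"
      using nd u_notin_Dom rep_notin_Dom i r by auto
    have S: "U (r i) \<in> S n" "U i \<in> S n" "W (r i) \<in> S n" "W i \<in> S n" using i r by simp_all
    show ?thesis
      unfolding i(3) gen_w[OF i(2)]
      using ne S full_u[OF r] by (simp add: deriv_mult deriv_simps mult.assoc)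
  qed
  show "deriv d (gen v) = 0" if "v \<noteq> d"
  proof (cases "var_index v \<in> T")
    case True
    then show ?thesis using that by (simp add: gen_def Let_def deriv_simps)
  next
    case False
    then show ?thesis using formula[OF v False refl] that by simp
  qed
  show "deriv d (gen d) \<noteq> 0"
  proof (cases "var_index d \<in> T")
    case True
    then show ?thesis by (simp add: gen_def Let_def deriv_simps)
  next
    case False
    have "var_poly x \<noteq> (0 :: 'k lss_poly)" for x
      by (simp add: var_poly_def) (metis lookup_single_eq lookup_zero one_neq_zero)
    then show ?thesis using formula[OF d False refl] by simp
  qed
qed

text \<open>All \<open>x \<alpha>\<close> vanish at the generic point, so differentiating the
  relations gives a matrix identity: the Jacobian of the \<open>gen v\<close>, with rows scaled by
  the values of the \<open>s\<close>, is a coefficient matrix times the Jacobian of the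
  \<open>x \<alpha>\<close>. The left side has rank \<open>card Dom\<close>, the right side rank at
  most \<open>card A\<close>.\<close>

lemma jacobian_bound:
  assumes A: "finite A" "\<And>\<alpha>. \<alpha> \<in> A \<Longrightarrow> x \<alpha> \<in> kernel"
    and rel: "\<And>v. v \<in> Dom \<Longrightarrow> \<exists>s c. s \<in> S n \<and> s \<notin> kernel \<and> (\<forall>\<alpha>\<in>A. c \<alpha> \<in> S n) \<and> s * gen v = (\<Sum>\<alpha>\<in>A. c \<alpha> * x \<alpha>)"
  shows "card Dom \<le> card A"
proof (rule ccontr)
  assume "\<not> card Dom \<le> card A"
  then have lt: "card A < card Dom" by simp
  have "\<forall>v\<in>Dom. \<exists>y. fst y \<in> S n \<and> fst y \<notin> kernel \<and> (\<forall>\<alpha>\<in>A. snd y \<alpha> \<in> S n) \<and> fst y * gen v = (\<Sum>\<alpha>\<in>A. snd y \<alpha> * x \<alpha>)"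
    using rel by simp
  from bchoice[OF this] obtain y where y: "\<And>v. v \<in> Dom \<Longrightarrow> fst (y v) \<in> S n" "\<And>v. v \<in> Dom \<Longrightarrow> fst (y v) \<notin> kernel"
    "\<And>v \<alpha>. v \<in> Dom \<Longrightarrow> \<alpha> \<in> A \<Longrightarrow> snd (y v) \<alpha> \<in> S n"
    "\<And>v. v \<in> Dom \<Longrightarrow> fst (y v) * gen v = (\<Sum>\<alpha>\<in>A. snd (y v) \<alpha> * x \<alpha>)" by blast
  let ?\<phi> = "subst Const full"
  \<comment> \<open>A non-trivial combination \<open>k\<close> of the rows annihilates the
    coefficient matrix; as the other side is diagonal with non-zero entries, each \<open>k d\<close>
    must be 0.\<close>
  obtain k where k: "\<exists>v\<in>Dom. k v \<noteq> 0" "\<forall>\<alpha>\<in>A. (\<Sum>v\<in>Dom. k v * ?\<phi> (snd (y v) \<alpha>)) = 0"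
    using underdetermined_system[OF A(1) finite_Dom lt, of "\<lambda>v \<alpha>. ?\<phi> (snd (y v) \<alpha>)"] by blast
  have xS: "x \<alpha> \<in> S n" "?\<phi> (x \<alpha>) = 0" if "\<alpha> \<in> A" for \<alpha>
    using A(2)[OF that] by (auto simp: kernel_def ker_def)
  have der: "?\<phi> (fst (y v)) * deriv d (gen v) = (\<Sum>\<alpha>\<in>A. ?\<phi> (snd (y v) \<alpha>) * deriv d (x \<alpha>))"
    if v: "v \<in> Dom" for v d
  proof -
    have "?\<phi> (fst (y v)) * deriv d (gen v) = deriv d (fst (y v) * gen v)"
      using deriv_mult[OF y(1)[OF v] gen_S[OF v]] gen_in_kernel[OF v] by simp
    also have "\<dots> = (\<Sum>\<alpha>\<in>A. deriv d (snd (y v) \<alpha> * x \<alpha>))"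
      unfolding y(4)[OF v] by (rule deriv_simps)
    also have "\<dots> = (\<Sum>\<alpha>\<in>A. ?\<phi> (snd (y v) \<alpha>) * deriv d (x \<alpha>))"
      by (rule sum.cong) (use deriv_mult y(3)[OF v] xS in simp_all)
    finally show ?thesis .
  qed
  have "k d = 0" if d: "d \<in> Dom" for d
  proof -
    have "(\<Sum>v\<in>Dom. k v * (?\<phi> (fst (y v)) * deriv d (gen v))) = (\<Sum>v\<in>Dom. k v * (\<Sum>\<alpha>\<in>A. ?\<phi> (snd (y v) \<alpha>) * deriv d (x \<alpha>)))"
      using der by simp
    also have "\<dots> = (\<Sum>\<alpha>\<in>A. (\<Sum>v\<in>Dom. k v * ?\<phi> (snd (y v) \<alpha>)) * deriv d (x \<alpha>))"
      unfolding sum_distrib_left sum_distrib_right by (subst sum.swap) (simp add: mult.assoc)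
    also have "\<dots> = 0" using k(2) by simp
    finally have "(\<Sum>v\<in>Dom. k v * (?\<phi> (fst (y v)) * deriv d (gen v))) = 0" .
    moreover have "(\<Sum>v\<in>Dom. k v * (?\<phi> (fst (y v)) * deriv d (gen v))) = (\<Sum>v\<in>Dom. if v = d then k d * (?\<phi> (fst (y d)) * deriv d (gen d)) else 0)"
      by (rule sum.cong) (use deriv_gen(1)[OF d] in auto)
    ultimately have "k d * (?\<phi> (fst (y d)) * deriv d (gen d)) = 0" using finite_Dom d by simp
    moreover have "?\<phi> (fst (y d)) \<noteq> 0" using y(1,2)[OF d] by (simp add: kernel_def ker_def)
    ultimately show ?thesis using deriv_gen(2)[OF d d] by simp
  qed
  then show False using k(1) by blast
qed

end

section \<open>Deleted vertices of a minimal kernel\<close>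

context class_data
begin

text \<open>Otherwise the undeleted neighbours of \<open>v\<close> lie in at most one class, and
  \<open>v\<close> can be restored to that class. The new kernel still contains the edge ideal and
  is strictly smaller. This is the analogue of the cut-vertex condition for minimal primes of
  binomial edge ideals; it supplies the two columns for Cramer's rule.\<close>

lemma minimal_kernel_neighbours:
  assumes edges: "\<And>i j. {i, j} \<in> E \<Longrightarrow> i \<notin> T \<Longrightarrow> j \<notin> T \<Longrightarrow> r i = r j"
    and min: "\<And>Q. primeideal Q (poly_S n) \<Longrightarrow> edge_ideal \<subseteq> Q \<Longrightarrow> Q \<subseteq> kernel \<Longrightarrow> Q = kernel"
    and v: "v \<in> T"
  shows "\<exists>i j. i \<notin> T \<and> j \<notin> T \<and> {v, i} \<in> E \<and> {v, j} \<in> E \<and> r i \<noteq> r j"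
proof (rule ccontr)
  assume "\<not> ?thesis"
  then have same: "\<And>i j. i \<notin> T \<Longrightarrow> j \<notin> T \<Longrightarrow> {v, i} \<in> E \<Longrightarrow> {v, j} \<in> E \<Longrightarrow> r i = r j" by blast
  note G = simple_graphD(4)[OF graph]
  define T' where "T' = T - {v}"
  \<comment> \<open>The representative of the class met by the neighbours; without such neighbours
    \<open>v\<close> becomes a class of its own.\<close>
  define c where "c = (if \<exists>i. i \<notin> T \<and> {v, i} \<in> E then r (SOME i. i \<notin> T \<and> {v, i} \<in> E) else v)"
  define r' where "r' = r(v := c)"
  have r'_neq: "r' k = r k" if "k \<noteq> v" for k using that by (simp add: r'_def)
  have vV: "v \<in> {1..n}" using v T_sub by blast
  have c_nb: "r i = c" if "i \<notin> T" "{v, i} \<in> E" for i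
  proof -
    let ?s = "SOME i. i \<notin> T \<and> {v, i} \<in> E"
    have s: "?s \<notin> T \<and> {v, ?s} \<in> E"
      by (rule someI[of "\<lambda>i. i \<notin> T \<and> {v, i} \<in> E" i]) (use that in simp)
    have "c = r ?s" unfolding c_def by (rule if_P) (use that in blast)
    moreover have "r i = r ?s" by (rule same) (use that s in simp_all)
    ultimately show ?thesis by simp
  qed
  have c_mem: "c = v \<or> c \<in> {1..n} - T \<and> r c = c"
  proof (cases "\<exists>i. i \<notin> T \<and> {v, i} \<in> E")
    case True
    then obtain i where i: "i \<notin> T" "{v, i} \<in> E" by blast
    then have "c = r i" "i \<in> {1..n}" using c_nb G by auto
    then show ?thesis using r_in i by auto
  next
    case False
    then have "c = v" unfolding c_def by (rule if_not_P)
    then show ?thesis by simp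
  qed
  interpret C': class_data n E \<zeta> a b T' r' flip
  proof
    show "T' \<subseteq> {1..n}" using T_sub by (auto simp: T'_def)
    fix i assume i: "i \<in> {1..n} - T'"
    show "r' i \<in> {1..n} - T'"
      using c_mem vV i r_in[of i] by (cases "i = v") (auto simp: r'_def T'_def)
    show "r' (r' i) = r' i"
      using c_mem vV i r_in[of i] v by (cases "i = v") (auto simp: r'_def T'_def)
  qed
  have "edge_ideal \<subseteq> C'.kernel"
  proof (rule C'.edge_ideal_subset_kernel)
    fix i j assume ij: "{i, j} \<in> E" "i \<notin> T'" "j \<notin> T'"
    have ne: "i \<noteq> j" using G[OF ij(1)] by simp
    consider "i = v" "j \<noteq> v" | "j = v" "i \<noteq> v" | "i \<noteq> v" "j \<noteq> v" using ne by blast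
    then show "r' i = r' j"
    proof cases
      case 1
      then show ?thesis using ij c_nb[of j] by (simp add: r'_def T'_def)
    next
      case 2
      then show ?thesis using ij c_nb[of i] by (simp add: r'_def T'_def insert_commute)
    next
      case 3
      then show ?thesis using ij edges by (simp add: r'_def T'_def)
    qed
  qed
  moreover have "C'.kernel \<subseteq> kernel"
  proof -
    \<comment> \<open>Setting both variables at the restored vertex to 0 turns the new substitution
      into the old one, whence the inclusion of the kernels.\<close>
    define \<tau> :: "lss_var \<Rightarrow> 'k lss_poly" where "\<tau> y = (if var_index y = v then 0 else var_poly y)" for y
    have "full x = subst Const \<tau> (C'.full x)" for x
    proof -
      define i where "i = var_index x"
      consider "i = v" | "i \<noteq> v" "i \<in> T" | "i \<noteq> v" "i \<notin> T" by blast
      then show ?thesis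
      proof cases
        case 1
        then have "full x = 0" using v by (simp add: full_T i_def)
        moreover have "subst Const \<tau> (C'.full x) = 0"
          using 1 by (auto simp: C'.full_def Let_def i_def \<tau>_def)
        ultimately show ?thesis by simp
      next
        case 2
        then have "i \<in> T'" by (simp add: T'_def)
        then show ?thesis using 2 full_T[of x] C'.full_T[of x] by (simp add: i_def)
      next
        case 3
        have ui: "C'.u i = u i" "C'.w i = w i" using 3 r'_neq by (simp_all add: C'.u_def u_def C'.w_def w_def)
        have ri: "C'.w (r' i) = w (r i)" "r i \<noteq> v" if "i \<in> {1..n}"
        proof -
          have "r i \<notin> T" "r (r i) = r i" using r_in[OF that 3(2)] by auto
          then show "r i \<noteq> v" using v by auto
          then show "C'.w (r' i) = w (r i)" using 3 \<open>r (r i) = r i\<close> r'_neq by (simp add: C'.w_def w_def)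
        qed
        have "i \<notin> T'" using 3 by (simp add: T'_def)
        then have "C'.full x = full x"
          using 3 ui ri by (auto simp: C'.full_def full_def Let_def i_def[symmetric])
        moreover have "subst Const \<tau> (full x) = full x"
        proof (cases "i \<in> {1..n} \<and> x = w i")
          case True
          then have "full x = Const (\<zeta> i) * U i * W (r i)" using 3 full_w by blast
          then show ?thesis using 3 ri True by (simp add: \<tau>_def)
        next
          case False
          then have "full x = var_poly x" using 3 by (auto simp: full_def Let_def i_def)
          then show ?thesis using 3 by (simp add: \<tau>_def i_def)
        qed
        ultimately show ?thesis by simp
      qed
    qed
    then have "subst Const full f = subst Const \<tau> (subst Const C'.full f)" for f by (rule subst_comp)
    then show ?thesis by (auto simp: C'.kernel_def kernel_def ker_def)
  qed
  ultimately have "C'.kernel = kernel" using min[OF C'.prime_kernel] by blast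
  \<comment> \<open>Strictness: the kept variable at \<open>v\<close> is sent to 0 by the old
    substitution and to itself by the new one.\<close>
  moreover have "var_poly (C'.u v) \<in> kernel" using v vV full_T by (simp add: kernel_def ker_def)
  ultimately have "var_poly (C'.u v) \<in> C'.kernel" by simp
  then have "subst Const C'.full (var_poly (C'.u v)) = 0" by (simp add: C'.kernel_def ker_def)
  moreover have "v \<notin> T'" by (simp add: T'_def)
  ultimately have "(var_poly (C'.u v) :: 'k lss_poly) = 0" using C'.full_u[OF vV] by simp
  then show False by (simp add: var_poly_def) (metis lookup_single_eq lookup_zero one_neq_zero)
qed

end

section \<open>Primes over the edge ideal\<close>

context twisted_graph
begin

text \<open>The classes consist of columns that are proportional modulo the localized edge ideal, a
  stronger demand than proportionality modulo \<open>P\<close>. It is made so that the minors within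
  a class can serve as local generators of the edge ideal; the last two conclusions record what this
  needs.\<close>

lemma prime_over_edge_ideal:
  assumes P: "primeideal P (poly_S n)" and IP: "edge_ideal \<subseteq> P"
  obtains T r flip where "class_data n E \<zeta> a b T r"
    "\<And>i j. {i, j} \<in> E \<Longrightarrow> i \<notin> T \<Longrightarrow> j \<notin> T \<Longrightarrow> r i = r j"
    "class_data.kernel n \<zeta> a b T r flip \<subseteq> P"
    "\<And>i. i \<in> {1..n} \<Longrightarrow> i \<notin> T \<Longrightarrow> \<exists>s. s \<in> S n \<and> s \<notin> P \<and> s * minor (r i) i \<in> edge_ideal"
    "\<And>i. i \<in> {1..n} \<Longrightarrow> i \<notin> T \<Longrightarrow> p i \<notin> P \<or> q i \<notin> P"
proof -
  note PS = prime_S[OF P] and I = edge_ideal_ideal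
  define T where "T = {i \<in> {1..n}. var_poly (a i) \<in> P \<and> var_poly (b i) \<in> P}"
  \<comment> \<open>Membership in the extension of the edge ideal to the localization at
    \<open>P\<close>, expressed by polynomials.\<close>
  define sat where "sat f \<longleftrightarrow> f \<in> S n \<and> (\<exists>s. s \<in> S n \<and> s \<notin> P \<and> s * f \<in> edge_ideal)" for f
  have sat_I: "sat f" if "f \<in> edge_ideal" for f
    using that I PS(3) unfolding sat_def ideal_S_iff by (auto intro!: exI[of _ 1])
  have sat_P: "f \<in> P" if "sat f" for f
    using that PS(6) IP unfolding sat_def by blast
  have sat_mult: "sat (x * f)" if x: "x \<in> S n" and f: "sat f" for x f
  proof -
    obtain s where s: "s \<in> S n" "s \<notin> P" "s * f \<in> edge_ideal" "f \<in> S n" using f by (auto simp: sat_def)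
    have "x * (s * f) \<in> edge_ideal" using ideal_S_mult[OF I x s(3)] .
    then have "s * (x * f) \<in> edge_ideal" by (simp add: mult.left_commute)
    then show ?thesis using s x unfolding sat_def by auto
  qed
  have sat_add: "sat (f + g)" if f: "sat f" and g: "sat g" for f g
  proof -
    obtain s where s: "s \<in> S n" "s \<notin> P" "s * f \<in> edge_ideal" "f \<in> S n" using f by (auto simp: sat_def)
    obtain t where t: "t \<in> S n" "t \<notin> P" "t * g \<in> edge_ideal" "g \<in> S n" using g by (auto simp: sat_def)
    have "t * (s * f) + s * (t * g) \<in> edge_ideal"
      by (rule ideal_S_add[OF I ideal_S_mult[OF I t(1) s(3)] ideal_S_mult[OF I s(1) t(3)]])
    then have "(s * t) * (f + g) \<in> edge_ideal" by (simp add: algebra_simps)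
    moreover have "s * t \<notin> P" by (rule PS(6)[OF s(1) t(1) s(2) t(2)])
    ultimately show ?thesis using s t unfolding sat_def by (intro conjI exI[of _ "s * t"]) auto
  qed
  have sat_div: "sat f" if x: "x \<in> S n" "x \<notin> P" and f: "f \<in> S n" and xf: "sat (x * f)" for x f
  proof -
    obtain s where s: "s \<in> S n" "s \<notin> P" "s * (x * f) \<in> edge_ideal" using xf by (auto simp: sat_def)
    have "s * x \<notin> P" by (rule PS(6)[OF s(1) x(1) s(2) x(2)])
    then show ?thesis using s x f unfolding sat_def by (intro conjI exI[of _ "s * x"]) (auto simp: mult.assoc)
  qed
  have p_notin: "p i \<notin> P" if "i \<in> {1..n}" "var_poly (a i) \<notin> P" for i
    unfolding p_def using PS(6)[of "Const (\<zeta> i)"] PS(7) that by simp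
  have pq: "p i \<notin> P \<or> q i \<notin> P" if "i \<in> {1..n}" "i \<notin> T" for i
    using that p_notin[OF that(1)] by (auto simp: T_def q_def)
  define rel where "rel i j \<longleftrightarrow> sat (minor i j)" for i j
  have rel_refl: "rel i i" for i
    unfolding rel_def using sat_I[OF ideal_S_0[OF I]] by simp
  have rel_sym: "rel j i" if "rel i j" for i j
    using sat_mult[OF S.uminus_S[OF S.one_S], of "minor i j"] that minor_swap[of j i] by (simp add: rel_def)
  \<comment> \<open>Column \<open>j\<close> has an entry outside \<open>P\<close>, which can be
    divided out of the relation; this is where vertices of \<open>T\<close> have to be
    excluded.\<close>
  have rel_trans: "rel i k"
    if ij: "rel i j" and jk: "rel j k" and V: "i \<in> {1..n}" "j \<in> {1..n} - T" "k \<in> {1..n}" for i j k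
  proof -
    have "sat (p j * minor i k)" "sat (q j * minor i k)"
      unfolding minor_p_relation[of j i k] minor_q_relation[of j i k]
      using sat_add sat_mult ij jk pq_S V by (auto simp: rel_def)
    moreover have "p j \<notin> P \<or> q j \<notin> P" using pq V by blast
    ultimately show ?thesis
      unfolding rel_def using sat_div minor_S[OF V(1,3)] pq_S V by blast
  qed
  define r where "r i = (LEAST j. j \<in> {1..n} - T \<and> rel i j)" for i
  have r: "r i \<in> {1..n} - T \<and> rel i (r i)" if "i \<in> {1..n} - T" for i
    unfolding r_def by (rule LeastI[of _ i]) (use that rel_refl in simp)
  have r_eq: "r i = r j" if ij: "i \<in> {1..n} - T" "j \<in> {1..n} - T" "rel i j" for i j
  proof -
    have "(k \<in> {1..n} - T \<and> rel i k) = (k \<in> {1..n} - T \<and> rel j k)" for k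
      using rel_trans[of i j k] rel_trans[of j i k] rel_sym[OF ij(3)] ij by auto
    then show ?thesis unfolding r_def by presburger
  qed
  \<comment> \<open>The representative is not in \<open>T\<close>, so one of its entries is outside
    \<open>P\<close>; \<open>flip\<close> makes that entry the kept one.\<close>
  define flip where "flip k \<longleftrightarrow> var_poly (a k) \<in> P" for k
  interpret C: class_data n E \<zeta> a b T r flip
  proof
    show "T \<subseteq> {1..n}" by (auto simp: T_def)
    fix i assume i: "i \<in> {1..n} - T"
    show "r i \<in> {1..n} - T" using r[OF i] by blast
    show "r (r i) = r i" using r_eq[OF i, of "r i"] r[OF i] by simp
  qed
  have minor_r: "sat (minor (r i) i)" if "i \<in> {1..n}" "i \<notin> T" for i
    using rel_sym r[of i] that by (simp add: rel_def)
  \<comment> \<open>If the kept entry of column \<open>i\<close> were in \<open>P\<close>, the minor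
    with the representative, whose kept entry is outside \<open>P\<close>, would put the other entry
    into \<open>P\<close> as well, and \<open>i\<close> would belong to \<open>T\<close>.\<close>
  have U_notin: "C.U i \<notin> P" if i: "i \<in> {1..n}" "i \<notin> T" for i
  proof
    assume U: "C.U i \<in> P"
    let ?k = "r i"
    have k: "?k \<in> {1..n}" "?k \<notin> T" "r ?k = ?k" using C.r_in[OF i] by auto
    have m: "minor ?k i \<in> P" using minor_r[OF i] sat_P by blast
    have mem: "var_poly (a i) \<in> S n" "var_poly (b i) \<in> S n" "var_poly (a ?k) \<in> S n" "var_poly (b ?k) \<in> S n"
      using i k by simp_all
    have "var_poly (a i) \<in> P \<and> var_poly (b i) \<in> P"
    proof (cases "flip ?k")
      case True
      then have bi: "var_poly (b i) \<in> P" using U by (simp add: C.u_def)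
      have bk: "q ?k \<notin> P" using True k(1,2) by (auto simp: flip_def T_def q_def)
      have "p ?k * q i \<in> P" unfolding q_def using bi PS(5) pq_S k by simp
      then have "p ?k * q i - minor ?k i \<in> P" using m ideal_S_diff P primeideal_S_iff by blast
      then have "p i * q ?k \<in> P" by (simp add: minor_def)
      then have "p i \<in> P" using PS(6)[of "p i" "q ?k"] bk pq_S i k by blast
      then show ?thesis using bi p_notin[OF i(1)] by blast
    next
      case False
      then have ai: "var_poly (a i) \<in> P" using U by (simp add: C.u_def)
      have pk: "p ?k \<notin> P" using False k(1) p_notin by (simp add: flip_def)
      have "(Const (\<zeta> i) * q ?k) * var_poly (a i) \<in> P" using ai PS(5) pq_S k by simp
      then have "p i * q ?k \<in> P" by (simp add: p_def algebra_simps)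
      then have "minor ?k i + p i * q ?k \<in> P" using m PS(4) by blast
      then have "p ?k * q i \<in> P" by (simp add: minor_def)
      then have "q i \<in> P" using PS(6)[of "p ?k" "q i"] pk pq_S i k by blast
      then show ?thesis using ai by (simp add: q_def)
    qed
    then show False using i by (simp add: T_def)
  qed
  have "C.kernel \<subseteq> P"
  proof (rule C.kernel_subset[OF P])
    show "C.U i \<notin> P" if "i \<in> {1..n} - T" for i using U_notin that by blast
    fix v assume v: "v \<in> C.Dom"
    define i where "i = var_index v"
    show "C.gen v \<in> P"
    proof (cases "i \<in> T")
      case True
      then have "var_poly v \<in> P" using var_cases[of v] by (auto simp: T_def i_def)
      then show ?thesis using True by (simp add: C.gen_def Let_def i_def)
    next
      case False
      then have i: "i \<in> {1..n}" "i \<notin> T" "v = C.w i" using v by (auto simp: C.mem_Dom i_def)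
      obtain c where "C.gen v = Const c * minor (r i) i" using C.gen_minor[OF i(1,2)] i(3) by blast
      then show ?thesis using sat_P[OF minor_r[OF i(1,2)]] PS(5)[OF Const_S] by simp
    qed
  qed
  moreover have "r i = r j" if "{i, j} \<in> E" "i \<notin> T" "j \<notin> T" for i j
    using r_eq[of i j] that simple_graphD(4)[OF graph that(1)] sat_I[OF minor_in_edge_ideal[OF that(1)]]
    by (simp add: rel_def)
  ultimately show ?thesis
    using that[OF C.class_data_axioms] minor_r pq unfolding sat_def by blast
qed

lemma prime_over_edge_ideal_height:
  assumes P: "primeideal P (poly_S n)" and IP: "edge_ideal \<subseteq> P"
  obtains T and r :: "nat \<Rightarrow> nat" and h where "separation {1..n} E T r" "h + card (r ` ({1..n} - T)) = n + card T"
    "enat h \<le> prime_height (poly_S n) P"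
proof -
  obtain T r flip where c: "class_data n E \<zeta> a b T r"
    and e: "\<And>i j. {i, j} \<in> E \<Longrightarrow> i \<notin> T \<Longrightarrow> j \<notin> T \<Longrightarrow> r i = r j"
    and k: "class_data.kernel n \<zeta> a b T r flip \<subseteq> P"
    using prime_over_edge_ideal[OF P IP] by metis
  interpret C: class_data n E \<zeta> a b T r flip by (rule c)
  have "separation {1..n} E T r" using C.T_sub e by (auto simp: separation_def)
  then show ?thesis
    using that C.card_Dom prime_height_mono_superset[OF C.chain_kernel P k] by blast
qed

text \<open>Labels are replaced by chosen members of the classes, because the substitution uses a
  variable at the representative as the slope. No prime is prescribed here, so the same row is kept
  everywhere.\<close>

lemma separation_prime:
  fixes c :: "nat \<Rightarrow> nat"
  assumes sep: "separation {1..n} E T c"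
  obtains P h where "primeideal P (poly_S n)" "edge_ideal \<subseteq> P" "prime_height (poly_S n) P = enat h"
    "h + card (c ` ({1..n} - T)) = n + card T"
proof -
  define V where "V = {1..n} - T"
  define r where "r i = inv_into V c (c i)" for i
  have r: "r i \<in> V" "c (r i) = c i" if "i \<in> V" for i
    using that by (simp_all add: r_def inv_into_into f_inv_into_f)
  interpret C: class_data n E \<zeta> a b T r "\<lambda>_. False"
  proof
    show "T \<subseteq> {1..n}" using sep by (simp add: separation_def)
    fix i assume i: "i \<in> {1..n} - T"
    then show "r i \<in> {1..n} - T" using r by (simp add: V_def)
    show "r (r i) = r i" using r[of i] i unfolding r_def V_def by simp
  qed
  have "edge_ideal \<subseteq> C.kernel"
  proof (rule C.edge_ideal_subset_kernel)
    fix i j assume "{i, j} \<in> E" "i \<notin> T" "j \<notin> T"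
    then have "c i = c j" using sep simple_graphD(4)[OF graph, of i j] by (simp add: separation_def)
    then show "r i = r j" by (simp add: r_def)
  qed
  moreover have "card (r ` V) = card (c ` V)"
  proof -
    have "r ` V = inv_into V c ` (c ` V)" by (auto simp: r_def image_image)
    then show ?thesis using inj_on_inv_into[of "c ` V" c V] by (simp add: card_image)
  qed
  then have "card C.Dom + card (c ` ({1..n} - T)) = n + card T"
    using C.card_Dom by (simp add: V_def)
  ultimately show ?thesis using that[OF C.prime_kernel _ C.height_kernel] by blast
qed

text \<open>At a minimal prime the edge generators and the elements \<open>gen v\<close> express
  each other up to multipliers outside the prime. Minimality enters at the deleted vertices, where
  single variables must be recovered from minors.\<close>

lemma edge_ideal_generically_ci:
  assumes P: "P \<in> minimal_primes (poly_S n) edge_ideal"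
  shows "enat (min_gens (localization (poly_S n) P) (localized_ideal (poly_S n) P edge_ideal)) =
    height (localization (poly_S n) P) (localized_ideal (poly_S n) P edge_ideal)"
proof -
  have prime: "primeideal P (poly_S n)" and IP: "edge_ideal \<subseteq> P"
    and min: "\<And>Q. primeideal Q (poly_S n) \<Longrightarrow> edge_ideal \<subseteq> Q \<Longrightarrow> Q \<subseteq> P \<Longrightarrow> Q = P"
    using P by (auto simp: minimal_primes_def)
  note PS = prime_S[OF prime] and I = edge_ideal_ideal and G = simple_graphD(4)[OF graph]
  obtain T r flip where c: "class_data n E \<zeta> a b T r"
    and e: "\<And>i j. {i, j} \<in> E \<Longrightarrow> i \<notin> T \<Longrightarrow> j \<notin> T \<Longrightarrow> r i = r j"
    and k: "class_data.kernel n \<zeta> a b T r flip \<subseteq> P"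
    and sat: "\<And>i. i \<in> {1..n} \<Longrightarrow> i \<notin> T \<Longrightarrow> \<exists>s. s \<in> S n \<and> s \<notin> P \<and> s * minor (r i) i \<in> edge_ideal"
    and uP: "\<And>i. i \<in> {1..n} \<Longrightarrow> i \<notin> T \<Longrightarrow> p i \<notin> P \<or> q i \<notin> P"
    by (rule prime_over_edge_ideal[OF prime IP], rule that; assumption)
  interpret C: class_data n E \<zeta> a b T r flip by (rule c)
  have Pk: "P = C.kernel"
    using min[OF C.prime_kernel C.edge_ideal_subset_kernel[OF e] k] by simp
  have "prime_localization (S n) P"
    by (intro prime_localization.intro prime_localization_axioms.intro S.subdomain_carrier_axioms)
      (simp add: prime)
  then interpret Loc: prime_localization "S n" P .
  have M: "s \<in> Loc.M \<longleftrightarrow> s \<in> S n \<and> s \<notin> P" for s by (auto simp: Loc.M_def)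
  let ?L = "localization (poly_S n) P" and ?J = "localized_ideal (poly_S n) P edge_ideal"
  have ht: "height ?L ?J = enat (card C.Dom)"
    using Loc.height_ext_minimal_prime[of edge_ideal] I P C.height_kernel Pk by simp
  let ?F = "{minor i j | i j. {i, j} \<in> E}" and ?G = "C.gen ` C.Dom"
  have GS: "?G \<subseteq> S n" using C.gen_S by blast
  have IdG: "ideal (Idl\<^bsub>poly_S n\<^esub> ?G) (poly_S n)" "?G \<subseteq> Idl\<^bsub>poly_S n\<^esub> ?G"
    using S.R.genideal_ideal[of ?G] S.R.genideal_self[of ?G] GS by simp_all
  have sat_gen: "\<exists>s\<in>Loc.M. s * C.gen v \<in> edge_ideal" if v: "v \<in> C.Dom" for v
  proof -
    define i where "i = var_index v"
    show ?thesis
    proof (cases "i \<in> T")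
      case False
      then have i: "i \<in> {1..n}" "i \<notin> T" "v = C.w i" using v by (auto simp: C.mem_Dom i_def)
      obtain d where d: "C.gen v = Const d * minor (r i) i" using C.gen_minor[OF i(1,2)] i(3) by blast
      obtain s where s: "s \<in> S n" "s \<notin> P" "s * minor (r i) i \<in> edge_ideal" using sat[OF i(1,2)] by blast
      have "Const d * (s * minor (r i) i) \<in> edge_ideal" using ideal_S_mult[OF I Const_S s(3)] .
      then have "s * C.gen v \<in> edge_ideal" unfolding d by (simp add: mult.left_commute)
      then show ?thesis using s M by blast
    next
      case True
      \<comment> \<open>Neighbours of \<open>i\<close> in two different classes: their minor is
        outside \<open>P\<close>, so by Cramer's rule both variables at \<open>i\<close> lie in the
        edge ideal locally.\<close>
      obtain j l where jl: "j \<notin> T" "l \<notin> T" "{i, j} \<in> E" "{i, l} \<in> E" "r j \<noteq> r l"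
        using C.minimal_kernel_neighbours[OF e _ True] min Pk by blast
      have V: "i \<in> {1..n}" "j \<in> {1..n}" "l \<in> {1..n}" using G[OF jl(3)] G[OF jl(4)] by auto
      have m: "minor j l \<notin> P" "minor j l \<in> S n"
        using C.minor_notin_kernel[OF V(2) jl(1) V(3) jl(2,5)] Pk minor_S V by auto
      have m2: "minor i j \<in> edge_ideal" "minor i l \<in> edge_ideal" using minor_in_edge_ideal jl by auto
      have pm: "p i * minor j l \<in> edge_ideal" and qm: "q i * minor j l \<in> edge_ideal"
        unfolding minor_cramer[of i j l]
        by (rule ideal_S_diff[OF I ideal_S_mult[OF I _ m2(2)] ideal_S_mult[OF I _ m2(1)]];
            use pq_S V in blast)+
      have "Const (\<zeta> i) * (p i * minor j l) \<in> edge_ideal"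
        by (rule ideal_S_mult[OF I Const_S pm])
      then have "minor j l * var_poly (a i) \<in> edge_ideal" "minor j l * var_poly (b i) \<in> edge_ideal"
        using qm unfolding p_def q_def by (simp_all add: mult.assoc mult.commute[of "minor j l"])
      then have "minor j l * var_poly v \<in> edge_ideal" using var_cases[of v] by (auto simp: i_def)
      then show ?thesis using m M True by (auto simp: C.gen_def Let_def i_def)
    qed
  qed
  have minor_r_G: "minor (r i) i \<in> Idl\<^bsub>poly_S n\<^esub> ?G" if i: "i \<in> {1..n}" "i \<notin> T" for i
  proof (cases "r i = i")
    case True
    then show ?thesis using ideal_S_0[OF IdG(1)] by simp
  next
    case False
    then have "C.w i \<in> C.Dom" using i by (simp add: C.mem_Dom)
    then have g: "C.gen (C.w i) \<in> Idl\<^bsub>poly_S n\<^esub> ?G" using IdG(2) by blast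
    obtain d where d: "d \<noteq> 0" "C.gen (C.w i) = Const d * minor (r i) i" using C.gen_minor[OF i] by blast
    have eq: "Const (1 / d) * (Const d * minor (r i) i) = minor (r i) i"
      using d(1) Const_simps(4)[of "1 / d" d] by (simp add: mult.assoc[symmetric] del: Const_simps(4))
    have "Const (1 / d) * C.gen (C.w i) \<in> Idl\<^bsub>poly_S n\<^esub> ?G"
      by (rule ideal_S_mult[OF IdG(1) Const_S g])
    then show ?thesis unfolding d(2) eq .
  qed
  have sat_minor: "\<exists>s\<in>Loc.M. s * f \<in> Idl\<^bsub>poly_S n\<^esub> ?G" if fF: "f \<in> ?F" for f
  proof -
    obtain i j where ij: "f = minor i j" "{i, j} \<in> E" using fF by blast
    have V: "i \<in> {1..n}" "j \<in> {1..n}" using G[OF ij(2)] by auto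
    have T_case: "minor i j \<in> Idl\<^bsub>poly_S n\<^esub> ?G" if "i \<in> T" "i \<in> {1..n}" "j \<in> {1..n}" for i j
    proof (rule minor_comb[OF IdG(1) that(2,3)])
      have "a i \<in> C.Dom" "b i \<in> C.Dom" using that(1) by (simp_all add: C.mem_Dom)
      moreover have "C.gen (a i) = var_poly (a i)" "C.gen (b i) = var_poly (b i)"
        using that(1) by (simp_all add: C.gen_def)
      ultimately show "var_poly (a i) \<in> Idl\<^bsub>poly_S n\<^esub> ?G" "var_poly (b i) \<in> Idl\<^bsub>poly_S n\<^esub> ?G"
        using IdG(2) by (metis image_eqI subsetD)+
    qed
    consider "i \<in> T" | "j \<in> T" | "i \<notin> T" "j \<notin> T" by blast
    then show ?thesis
    proof cases
      case 1
      then show ?thesis using T_case[OF 1 V] ij(1) by (intro bexI[of _ 1]) simp_all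
    next
      case 2
      have "0 - minor j i \<in> Idl\<^bsub>poly_S n\<^esub> ?G"
        using T_case[OF 2 V(2,1)] ideal_S_diff[OF IdG(1) ideal_S_0[OF IdG(1)]] by blast
      then show ?thesis using ij(1) minor_swap[of i j] by (intro bexI[of _ 1]) simp_all
    next
      case 3
      let ?k = "r i"
      have rk: "r j = ?k" using e[OF ij(2) 3] by simp
      have k: "?k \<in> {1..n}" "?k \<notin> T" using C.r_in[OF V(1) 3(1)] by auto
      have m: "minor ?k j \<in> Idl\<^bsub>poly_S n\<^esub> ?G" "minor i ?k \<in> Idl\<^bsub>poly_S n\<^esub> ?G"
        using minor_r_G[OF V(2) 3(2)] rk minor_r_G[OF V(1) 3(1)] minor_swap[of i ?k]
          ideal_S_diff[OF IdG(1) ideal_S_0[OF IdG(1)], of "minor ?k i"] by simp_all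
      \<comment> \<open>Both columns are compared with the column of their common representative,
        which has an entry outside \<open>P\<close> to serve as multiplier.\<close>
      have "p ?k * minor i j \<in> Idl\<^bsub>poly_S n\<^esub> ?G" "q ?k * minor i j \<in> Idl\<^bsub>poly_S n\<^esub> ?G"
        unfolding minor_p_relation[of ?k i j] minor_q_relation[of ?k i j]
        by (rule ideal_S_add[OF IdG(1) ideal_S_mult[OF IdG(1) _ m(1)] ideal_S_mult[OF IdG(1) _ m(2)]];
            use pq_S V in blast)+
      then show ?thesis using uP[OF k] M pq_S k(1) ij(1) by blast
    qed
  qed
  have gens: "Idl\<^bsub>?L\<^esub> ((\<lambda>g. frac (poly_S n) (S n - P) g 1) ` ?G) = ?J"
  proof -
    have "\<exists>s\<in>Loc.M. s * g \<in> Idl\<^bsub>poly_S n\<^esub> ?F" if "g \<in> ?G" for g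
      using sat_gen that unfolding edge_ideal_def by blast
    from Loc.Idl_fractions_eq_ext[of ?G ?F, OF GS _ minors_sub] this sat_minor
    show ?thesis by (simp add: edge_ideal_def)
  qed
  let ?A = "(\<lambda>g. frac (poly_S n) (S n - P) g 1) ` ?G"
  \<comment> \<open>An upper bound on the size is enough here; equality will follow from
    \<open>lower\<close>, which holds for every generating set.\<close>
  have A: "finite ?A" "card ?A \<le> card C.Dom" "?A \<subseteq> carrier ?L"
  proof -
    show "finite ?A" using C.finite_Dom by simp
    have "card ?A \<le> card ?G" using C.finite_Dom by (intro card_image_le) simp
    also have "\<dots> \<le> card C.Dom" using C.finite_Dom by (rule card_image_le)
    finally show "card ?A \<le> card C.Dom" .
    show "?A \<subseteq> carrier ?L" using Loc.frac_carrier GS by auto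
  qed
  have lower: "card C.Dom \<le> card B" if B: "finite B" "B \<subseteq> carrier ?L" "Idl\<^bsub>?L\<^esub> B = ?J" for B
  proof -
    have 1: "ideal edge_ideal (class_ring (S n))" "B \<subseteq> carrier (localization (class_ring (S n)) P)"
      "Idl\<^bsub>localization (class_ring (S n)) P\<^esub> B = localized_ideal (class_ring (S n)) P edge_ideal"
      using I B by simp_all
    obtain x where x: "\<And>\<alpha>. \<alpha> \<in> B \<Longrightarrow> x \<alpha> \<in> edge_ideal"
      "\<And>f. f \<in> S n \<Longrightarrow> (\<exists>s\<in>Loc.M. s * f \<in> edge_ideal) \<Longrightarrow>
         \<exists>s\<in>Loc.M. \<exists>c. (\<forall>\<alpha>\<in>B. c \<alpha> \<in> S n) \<and> s * f = (\<Sum>\<alpha>\<in>B. c \<alpha> * x \<alpha>)"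
      by (rule Loc.generators_of_ext[OF 1(1) B(1) 1(2,3)]) blast
    show ?thesis
    proof (rule C.jacobian_bound[OF B(1)])
      show "x \<alpha> \<in> C.kernel" if "\<alpha> \<in> B" for \<alpha> using x(1)[OF that] IP Pk by blast
      fix v assume v: "v \<in> C.Dom"
      show "\<exists>s c. s \<in> S n \<and> s \<notin> C.kernel \<and> (\<forall>\<alpha>\<in>B. c \<alpha> \<in> S n) \<and> s * C.gen v = (\<Sum>\<alpha>\<in>B. c \<alpha> * x \<alpha>)"
        using x(2)[OF C.gen_S[OF v] sat_gen[OF v]] M Pk by blast
    qed
  qed
  have "min_gens ?L ?J = card C.Dom"
    unfolding min_gens_def
  proof (rule Least_equality)
    show "\<exists>B. finite B \<and> B \<subseteq> carrier ?L \<and> card B = card C.Dom \<and> Idl\<^bsub>?L\<^esub> B = ?J"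
      using A gens lower[OF A(1,3) gens] by (intro exI[of _ ?A]) simp
    show "card C.Dom \<le> y" if "\<exists>B. finite B \<and> B \<subseteq> carrier ?L \<and> card B = y \<and> Idl\<^bsub>?L\<^esub> B = ?J" for y
      using that lower by blast
  qed
  then show ?thesis using ht by simp
qed

section \<open>The height of the edge ideal\<close>

lemma Inf_enat_mem: "(X :: enat set) \<noteq> {} \<Longrightarrow> Inf X \<in> X"
  unfolding Inf_enat_def by (auto intro: LeastI)

lemma height_edge_ideal_iff:
  "enat (card E) = height (poly_S n) edge_ideal + 1 \<longleftrightarrow>
    edge_excess_bound {1..n} E \<and> edge_excess_attained {1..n} E"
proof -
  let ?X = "{prime_height (poly_S n) P | P. primeideal P (poly_S n) \<and> edge_ideal \<subseteq> P}"
  have ht: "height (poly_S n) edge_ideal = Inf ?X" by (simp add: height_def)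
  have up: "Inf ?X + enat (card (c ` ({1..n} - T))) \<le> enat (n + card T)" if sep: "separation {1..n} E T c" for T and c :: "nat \<Rightarrow> nat"
  proof -
    obtain P h where "primeideal P (poly_S n)" "edge_ideal \<subseteq> P" "prime_height (poly_S n) P = enat h"
      and h: "h + card (c ` ({1..n} - T)) = n + card T" by (rule separation_prime[OF sep])
    then have "Inf ?X \<le> enat h" by (intro Inf_lower) force
    then have "Inf ?X + enat (card (c ` ({1..n} - T))) \<le> enat h + enat (card (c ` ({1..n} - T)))"
      by (rule add_right_mono)
    then show ?thesis using h by simp
  qed
  have "separation {1..n} E {} (\<lambda>_. 0 :: nat)" by (simp add: separation_def)
  then obtain P0 where "primeideal P0 (poly_S n)" "edge_ideal \<subseteq> P0" by (rule separation_prime)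
  then have ne: "?X \<noteq> {}" by blast
  \<comment> \<open>The separation belongs to a prime of least height and bounds this height from
    below; the prime constructed from the same separation shows that the bound is attained.\<close>
  obtain T0 and c0 :: "nat \<Rightarrow> nat" and h0 where sep0: "separation {1..n} E T0 c0"
    and h0: "h0 + card (c0 ` ({1..n} - T0)) = n + card T0" "enat h0 \<le> Inf ?X"
  proof -
    obtain P where P: "primeideal P (poly_S n)" "edge_ideal \<subseteq> P" "Inf ?X = prime_height (poly_S n) P"
      using Inf_enat_mem[OF ne] by blast
    show ?thesis using prime_over_edge_ideal_height[OF P(1,2)] that P(3) by metis
  qed
  have "Inf ?X + enat (card (c0 ` ({1..n} - T0))) \<le> enat h0 + enat (card (c0 ` ({1..n} - T0)))"
    using up[OF sep0] h0(1) by simp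
  then have "Inf ?X \<le> enat h0" by (cases "Inf ?X") simp_all
  then have inf: "Inf ?X = enat h0" using h0(2) by simp
  have up': "h0 + card (c ` ({1..n} - T)) \<le> n + card T" if "separation {1..n} E T c" for T and c :: "nat \<Rightarrow> nat"
    using up[OF that] inf by simp
  have "enat (card E) = height (poly_S n) edge_ideal + 1 \<longleftrightarrow> card E = h0 + 1"
    unfolding ht inf by (simp add: one_enat_def)
  also have "\<dots> \<longleftrightarrow> edge_excess_bound {1..n} E \<and> edge_excess_attained {1..n} E"
  proof
    assume c: "card E = h0 + 1"
    show "edge_excess_bound {1..n} E \<and> edge_excess_attained {1..n} E"
      unfolding edge_excess_bound_def edge_excess_attained_def using c up' sep0 h0(1) by fastforce
  next
    assume ex: "edge_excess_bound {1..n} E \<and> edge_excess_attained {1..n} E"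
    then have "card E + card (c0 ` ({1..n} - T0)) \<le> n + card T0 + 1"
      using sep0 unfolding edge_excess_bound_def by fastforce
    moreover obtain T and c :: "nat \<Rightarrow> nat" where "separation {1..n} E T c" "card E + card (c ` ({1..n} - T)) = n + card T + 1"
      using ex unfolding edge_excess_attained_def by auto
    ultimately show "card E = h0 + 1" using up' h0(1) by fastforce
  qed
  finally show ?thesis .
qed

end

section \<open>The ideals of a bipartite graph\<close>

text \<open>\<open>\<epsilon> = 1\<close> gives the generators of the LSS ideal and
  \<open>\<epsilon> = - 1\<close> those of the parity binomial edge ideal; what the proof uses is
  that \<open>\<epsilon>\<close> squares to 1.\<close>

definition edge_quadric :: "'k::field \<Rightarrow> nat \<Rightarrow> nat \<Rightarrow> 'k lss_poly" where
  "edge_quadric \<epsilon> i j = xvar i * xvar j + Const \<epsilon> * (yvar i * yvar j)"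

lemma edge_quadric_commute: "edge_quadric \<epsilon> i j = edge_quadric \<epsilon> j i"
  by (simp add: edge_quadric_def mult.commute)

lemma edge_quadric_single:
  "edge_quadric \<epsilon> i j = single (single (VX i) 1 + single (VX j) 1) 1 + single (single (VY i) 1 + single (VY j) 1) \<epsilon>"
  by (simp add: edge_quadric_def var_poly_def Const_def mult_single)

text \<open>The product of the \<open>x\<close> variables at \<open>k\<close> and \<open>l\<close>
  occurs only in the quadric of the edge \<open>{k, l}\<close>. Reading off these coefficients shows
  that the quadrics of distinct edges are linearly independent.\<close>

lemma lookup_edge_quadric:
  assumes "i \<noteq> j" "k \<noteq> l"
  shows "lookup (edge_quadric \<epsilon> i j) (single (VX k) 1 + single (VX l) 1) = (if {i, j} = {k, l} then 1 else 0)"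
proof -
  have lk: "lookup (single (VX i) 1 + single (VX j) (1::nat)) (VX x) = (if x = i then 1 else 0) + (if x = j then 1 else 0)" for i j x
    by (auto simp: lookup_add lookup_single when_def)
  have "single (VX i) 1 + single (VX j) (1::nat) = single (VX k) 1 + single (VX l) 1 \<longleftrightarrow> {i, j} = {k, l}" (is "?m = ?m' \<longleftrightarrow> _")
  proof
    assume eq: "?m = ?m'"
    have "lookup (single (VX i) 1 + single (VX j) (1::nat)) (VX x) = 0 \<longleftrightarrow> x \<notin> {i, j}" for i j x
      unfolding lk by simp
    then have "x \<in> {i, j} \<longleftrightarrow> x \<in> {k, l}" for x
      using eq by metis
    then show "{i, j} = {k, l}" by blast
  qed (auto simp: doubleton_eq_iff add.commute)
  moreover have "single (VY i) 1 + single (VY j) (1::nat) \<noteq> single (VX k) 1 + single (VX l) 1"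
  proof
    assume eq: "single (VY i) 1 + single (VY j) (1::nat) = single (VX k) 1 + single (VX l) 1"
    have "lookup (single (VY i) 1 + single (VY j) (1::nat)) (VX k) = 0"
      by (simp add: lookup_add lookup_single when_def)
    then show False unfolding eq lk by simp
  qed
  ultimately show ?thesis
    by (auto simp: edge_quadric_single lookup_add[of "single _ _ :: 'a lss_poly"] lookup_single when_def)
qed

lemma mu_edge_quadrics:
  assumes sg: "simple_graph {1..n} E"
  shows "mu n (Idl\<^bsub>poly_S n\<^esub> {edge_quadric \<epsilon> i j | i j. {i, j} \<in> E}) = card E"
proof -
  note D = simple_graphD[OF sg]
  define F where "F = {edge_quadric \<epsilon> i j | i j. {i, j} \<in> E}"
  \<comment> \<open>An arbitrary orientation of the edges, which allows the generators to be indexed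
    by edges; the quadric is symmetric in the two ends.\<close>
  obtain fs sn where e: "\<And>e. e \<in> E \<Longrightarrow> e = {fs e, sn e} \<and> fs e \<noteq> sn e" using D(3) by metis
  define Q where "Q e = edge_quadric \<epsilon> (fs e) (sn e)" for e
  define m where "m e = single (VX (fs e)) 1 + single (VX (sn e)) (1::nat)" for e
  have lk: "lookup (Q e) (m e') = (if e = e' then 1 else 0)" if "e \<in> E" "e' \<in> E" for e e'
    using lookup_edge_quadric[of "fs e" "sn e" "fs e'" "sn e'" \<epsilon>] e[OF that(1)] e[OF that(2)]
    unfolding Q_def m_def by metis
  have FQ: "F = Q ` E"
  proof
    show "F \<subseteq> Q ` E"
    proof
      fix f assume "f \<in> F"
      then obtain i j where ij: "f = edge_quadric \<epsilon> i j" "{i, j} \<in> E" by (auto simp: F_def)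
      then have "Q {i, j} = f"
        using e[OF ij(2)] edge_quadric_commute[of \<epsilon> i j] by (auto simp: Q_def doubleton_eq_iff)
      then show "f \<in> Q ` E" using ij(2) by blast
    qed
    show "Q ` E \<subseteq> F"
    proof
      fix f assume "f \<in> Q ` E"
      then obtain x where "x \<in> E" "f = Q x" by blast
      then have "{fs x, sn x} \<in> E" "f = edge_quadric \<epsilon> (fs x) (sn x)" using e[of x] by (simp_all add: Q_def)
      then show "f \<in> F" unfolding F_def by blast
    qed
  qed
  have inj: "inj_on Q E"
  proof (rule inj_onI)
    fix x y assume "x \<in> E" "y \<in> E" "Q x = Q y"
    then show "x = y" using lk[of x y] lk[of y y] by (auto split: if_splits)
  qed
  have "mu n (Idl\<^bsub>poly_S n\<^esub> F) = card F"
  proof (rule mu_quadrics)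
    show "finite F" using D(2) by (simp add: FQ)
    show "F \<subseteq> S n"
      using D(4) by (auto simp: F_def edge_quadric_def)
    fix f k assume f: "f \<in> F" "k \<in> keys f"
    then obtain i j where "f = edge_quadric \<epsilon> i j" by (auto simp: F_def)
    then have "k \<in> keys (single (single (VX i) 1 + single (VX j) 1) (1::'a)) \<union> keys (single (single (VY i) 1 + single (VY j) 1) \<epsilon>)"
      using f(2) unfolding edge_quadric_single by (metis keys_add subsetD)
    then have "k = single (VX i) 1 + single (VX j) 1 \<or> k = single (VY i) 1 + single (VY j) 1"
      by (simp split: if_splits)
    moreover have "monom_degree (single v 1) = 1" for v by (simp add: monom_degree_def)
    ultimately show "monom_degree k = 2" by (auto simp: monom_degree_add)
  next
    fix c assume z: "(\<Sum>f\<in>F. Const (c f) * f) = 0"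
    show "\<forall>f\<in>F. c f = 0"
    proof
      fix f assume "f \<in> F"
      then obtain x where x: "x \<in> E" "f = Q x" using FQ by blast
      have "0 = lookup (\<Sum>e\<in>E. Const (c (Q e)) * Q e) (m x)"
        using z by (simp add: FQ sum.reindex[OF inj])
      also have "\<dots> = (\<Sum>e\<in>E. if e = x then c (Q e) else 0)"
        unfolding lookup_sum lookup_Const_mult by (rule sum.cong) (use lk x in auto)
      also have "\<dots> = c f" using x D(2) by simp
      finally show "c f = 0" ..
    qed
  qed
  moreover have "card F = card E" using inj by (simp add: FQ card_image)
  ultimately show ?thesis by (simp add: F_def)
qed

text \<open>On one side of the bipartition replace \<open>(x\<^sub>j, y\<^sub>j)\<close> by \<open>(- \<epsilon> y\<^sub>j, x\<^sub>j)\<close>: this turns the edge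
  generators into the 2-minors generating the binomial edge ideal.\<close>

lemma bipartite_aci_iff:
  fixes \<epsilon> :: "'k::field"
  assumes sg: "simple_graph {1..n} E" and bip: "bipartite_graph {1..n} E" and \<epsilon>: "\<epsilon> * \<epsilon> = 1"
  shows "almost_complete_intersection n (Idl\<^bsub>poly_S n\<^esub> {edge_quadric \<epsilon> i j | i j. {i, j} \<in> E}) \<longleftrightarrow>
    edge_excess_bound {1..n} E \<and> edge_excess_attained {1..n} E"
proof -
  obtain A B where AB: "A \<inter> B = {}" "\<forall>e\<in>E. \<exists>a\<in>A. \<exists>b\<in>B. e = {a, b}"
    using bip by (auto simp: bipartite_graph_def)
  define \<zeta> where "\<zeta> i = (if i \<in> B then - \<epsilon> else 1)" for i
  define a where "a i = (if i \<in> B then VY i else VX i)" for i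
  define b where "b i = (if i \<in> B then VX i else VY i)" for i
  interpret twisted_graph n E \<zeta> a b
    by unfold_locales (use sg \<epsilon> in \<open>auto simp: \<zeta>_def a_def b_def\<close>)
  have m: "minor i j = edge_quadric \<epsilon> i j" if "i \<notin> B" "j \<in> B" for i j
    using that by (simp add: minor_def p_def q_def edge_quadric_def \<zeta>_def a_def b_def algebra_simps)
  \<comment> \<open>Exchanging the ends changes the sign of the minor but not the quadric, so the
    two generating sets agree up to sign.\<close>
  have mm: "minor i j = edge_quadric \<epsilon> i j \<or> minor i j = - edge_quadric \<epsilon> i j" if ij: "{i, j} \<in> E" for i j
  proof -
    obtain x y where "x \<in> A" "y \<in> B" "{i, j} = {x, y}" using AB(2) ij by blast
    then have "i \<notin> B \<and> j \<in> B \<or> j \<notin> B \<and> i \<in> B" using AB(1) by (auto simp: doubleton_eq_iff)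
    then show ?thesis
      using m[of i j] m[of j i] minor_swap[of i j] edge_quadric_commute[of \<epsilon> i j] by auto
  qed
  let ?F = "{edge_quadric \<epsilon> i j | i j. {i, j} \<in> E}"
  have FS: "?F \<subseteq> S n"
    using simple_graphD(4)[OF sg] by (auto simp: edge_quadric_def)
  have idF: "ideal (Idl\<^bsub>poly_S n\<^esub> ?F) (poly_S n)" "?F \<subseteq> Idl\<^bsub>poly_S n\<^esub> ?F"
    using S.R.genideal_ideal[of ?F] S.R.genideal_self[of ?F] FS by simp_all
  have neg: "x \<in> J \<Longrightarrow> - x \<in> J" if "ideal J (poly_S n)" for J :: "'k lss_poly set" and x
    using ideal_S_diff[OF that ideal_S_0[OF that], of x] by simp
  have "Idl\<^bsub>poly_S n\<^esub> ?F = edge_ideal"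
  proof
    have "edge_quadric \<epsilon> i j \<in> edge_ideal" if "{i, j} \<in> E" for i j
      using mm[OF that] minor_in_edge_ideal[OF that] neg[OF edge_ideal_ideal, of "minor i j"] by auto
    then show "Idl\<^bsub>poly_S n\<^esub> ?F \<subseteq> edge_ideal"
      using Idl_S_subset_iff[OF FS edge_ideal_ideal] by blast
    have "minor i j \<in> Idl\<^bsub>poly_S n\<^esub> ?F" if "{i, j} \<in> E" for i j
    proof -
      have e: "edge_quadric \<epsilon> i j \<in> Idl\<^bsub>poly_S n\<^esub> ?F" using idF(2) that by blast
      show ?thesis using mm[OF that]
      proof
        assume "minor i j = - edge_quadric \<epsilon> i j"
        then show ?thesis using neg[OF idF(1) e] by (simp only:)
      qed (simp only: e)
    qed
    then show "edge_ideal \<subseteq> Idl\<^bsub>poly_S n\<^esub> ?F" unfolding edge_ideal_subset_iff[OF idF(1)] by blast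
  qed
  moreover have "mu n (Idl\<^bsub>poly_S n\<^esub> ?F) = card E" by (rule mu_edge_quadrics[OF sg])
  ultimately show ?thesis
    unfolding almost_complete_intersection_def using height_edge_ideal_iff edge_ideal_generically_ci by simp
qed

theorem theorem3p7:
  fixes n :: nat and E :: "nat set set"
  assumes "simple_graph {1..n} E"
    and "connected_graph {1..n} E"
    and "bipartite_graph {1..n} E"
    and "\<not> path_graph {1..n} E"
  shows "(almost_complete_intersection n (LSS_ideal n E :: 'k::field lss_poly set) \<longleftrightarrow>
            almost_complete_intersection n (parity_binomial_edge_ideal n E :: 'k lss_poly set)) \<and>
         (almost_complete_intersection n (parity_binomial_edge_ideal n E :: 'k lss_poly set) \<longleftrightarrow>
            edge_between_paths {1..n} E \<or>
            edge_within_path {1..n} E \<and> (\<exists>g. girth E = enat g \<and> even g))"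
proof -
  have "LSS_ideal n E = Idl\<^bsub>poly_S n\<^esub> {edge_quadric (1::'k) i j | i j. {i, j} \<in> E}"
    by (simp add: LSS_ideal_def edge_quadric_def)
  moreover have "parity_binomial_edge_ideal n E = Idl\<^bsub>poly_S n\<^esub> {edge_quadric (- 1 :: 'k) i j | i j. {i, j} \<in> E}"
    by (simp add: parity_binomial_edge_ideal_def edge_quadric_def)
  moreover note bipartite_aci_iff[OF assms(1,3), of "1::'k"] bipartite_aci_iff[OF assms(1,3), of "- 1 :: 'k"]
    excess_characterization[OF assms]
  ultimately show ?thesis by simp
qed

end
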